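(* Let $\mathfrak{n}$ be a uniform Lie algebra of type $(p,q,r)$ with $q \le 5$. Then $\mathfrak{n}$ is isomorphic (as a Lie algebra) to exactly one of the following twelve Lie algebras. Each is given by a basis $\{v_i\}_{i=1}^{q}\cup\{z_j\}_{j=1}^{p}$ (or $\{v_i\}_{i=1}^q \cup \{z_{ij}\}_{1\le i<j\le q}$) together with its nonzero brackets of basis vectors up to skew-symmetry; the type $(p,q,r)$ of the displayed basis is listed in front. (1) $(1,2,1)$: $[v_1,v_2]=z_1$ (the Heisenberg algebra $\mathfrak{h}_3$). (2) $(1,4,2)$: $[v_1,v_2]=[v_3,v_4]=z_1$ (the Heisenberg algebra $\mathfrak{h}_5$). (3) $(2,4,1)$: $[v_1,v_2]=z_1$, $[v_3,v_4]=z_2$ (that is, $\mathfrak{h}_3\oplus\mathfrak{h}_3$); this same Lie algebra, up to isomorphism, is also given with type $(2,4,2)$ by $[v_1,v_3]=[v_2,v_4]=z_1$, $[v_1,v_4]=[v_2,v_3]=z_2$. (4) $(3,3,1)$: $[v_i,v_j]=z_{ij}$ for $1\le i<j\le 3$ (the free two-step nilpotent Lie algebra on $3$ generators). (5) $(4,4,1)$: $[v_1,v_2]=z_1$, $[v_2,v_3]=z_2$, $[v_3,v_4]=z_3$, $[v_4,v_1]=z_4$. (6) $(2,4,2)$: $[v_1,v_2]=[v_3,v_4]=z_1$, $[v_2,v_3]=[v_1,v_4]=z_2$. (7) $(5,5,1)$: $[v_1,v_2]=z_1$, $[v_2,v_3]=z_2$, $[v_3,v_4]=z_3$, $[v_4,v_5]=z_4$,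 $[v_5,v_1]=z_5$. (8) $(3,4,2)$: $[v_1,v_2]=[v_3,v_4]=z_1$, $[v_1,v_3]=-[v_2,v_4]=z_2$, $[v_1,v_4]=[v_2,v_3]=z_3$. (9) $(3,4,2)$: $[v_1,v_2]=[v_3,v_4]=z_1$, $[v_1,v_3]=[v_2,v_4]=z_2$, $[v_1,v_4]=-[v_2,v_3]=z_3$. (10) $(6,4,1)$: $[v_i,v_j]=z_{ij}$ for $1\le i<j\le 4$ (the free two-step nilpotent Lie algebra on $4$ generators). (11) $(5,5,2)$: $[v_1,v_5]=[v_2,v_4]=z_1$, $[v_2,v_5]=[v_3,v_4]=z_2$, $[v_1,v_3]=[v_4,v_5]=z_3$, $[v_3,v_5]=[v_1,v_2]=z_4$, $[v_1,v_4]=[v_2,v_3]=z_5$. (12) $(10,5,1)$: $[v_i,v_j]=z_{ij}$ for $1\le i<j\le 5$ (the free two-step nilpotent Lie algebra on $5$ generators).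
   Context: All Lie algebras are finite-dimensional over $\mathbb{R}$. Let $p,q,r$ be positive integers. A nilpotent Lie algebra $\mathfrak{n}$ is uniform of type $(p,q,r)$ if there exist a basis $\mathcal{B}=\{v_i\}_{i=1}^q\cup\{z_j\}_{j=1}^p$ of $\mathfrak{n}$ (a uniform basis) and a positive integer $s$ (the degree) such that: (i) for all $i,j\in\{1,\dots,q\}$ and $l,m\in\{1,\dots,p\}$, $[v_i,z_l]=0$, $[z_l,z_m]=0$ and $[v_i,v_j]\in\{0,\pm z_1,\dots,\pm z_p\}$; (ii) if $[v_i,v_j]$ is nonzero and $[v_i,v_j]=\pm[v_i,v_k]$, then $v_j=v_k$; (iii) for every $l$ there are exactly $r$ pairs $\{v_i,v_j\}$ (necessarily disjoint) with $[v_i,v_j]=z_l$ for one of the two orderings of the pair; (iv) for every $j$ there are exactly $s$ basis vectors $v_i$ with $[v_i,v_j]\neq 0$. *)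

theory Defs
  imports "HOL-Analysis.Finite_Function_Topology"
begin

section \<open>Finite-dimensional real Lie algebras\<close>

text \<open>A Lie algebra is carried by a subspace of an ambient real vector space, so that Lie algebras
  of different dimensions can live in one type. The bracket is irrelevant outside this subspace.\<close>

record 'a lie =
  lie_space :: "'a set"
  lie_bracket :: "'a \<Rightarrow> 'a \<Rightarrow> 'a"

definition lie_algebra :: "('a::real_vector) lie \<Rightarrow> bool" where
  "lie_algebra L \<longleftrightarrow>
     (let S = lie_space L; br = lie_bracket L in
       subspace S \<and> (\<exists>B. finite B \<and> S = span B) \<and>
       (\<forall>x\<in>S. \<forall>y\<in>S. br x y \<in> S) \<and>
       (\<forall>x\<in>S. \<forall>y\<in>S. \<forall>w\<in>S. br (x + y) w = br x w + br y w \<and> br w (x + y) = br w x + br w y) \<and>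
       (\<forall>c. \<forall>x\<in>S. \<forall>y\<in>S. br (c *\<^sub>R x) y = c *\<^sub>R br x y \<and> br x (c *\<^sub>R y) = c *\<^sub>R br x y) \<and>
       (\<forall>x\<in>S. br x x = 0) \<and>
       (\<forall>x\<in>S. \<forall>y\<in>S. \<forall>w\<in>S. br x (br y w) + br y (br w x) + br w (br x y) = 0))"

fun lower_central :: "('a::real_vector) lie \<Rightarrow> nat \<Rightarrow> 'a set" where
  "lower_central L 0 = lie_space L"
| "lower_central L (Suc n) = span {lie_bracket L x y | x y. x \<in> lie_space L \<and> y \<in> lower_central L n}"

definition nilpotent_lie :: "('a::real_vector) lie \<Rightarrow> bool" where
  "nilpotent_lie L \<longleftrightarrow> lie_algebra L \<and> (\<exists>n. lower_central L n = {0})"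

definition lie_isomorphic :: "('a::real_vector) lie \<Rightarrow> ('b::real_vector) lie \<Rightarrow> bool" where
  "lie_isomorphic L M \<longleftrightarrow>
     (\<exists>f. bij_betw f (lie_space L) (lie_space M) \<and>
       (\<forall>x\<in>lie_space L. \<forall>y\<in>lie_space L. f (x + y) = f x + f y) \<and>
       (\<forall>c. \<forall>x\<in>lie_space L. f (c *\<^sub>R x) = c *\<^sub>R f x) \<and>
       (\<forall>x\<in>lie_space L. \<forall>y\<in>lie_space L. f (lie_bracket L x y) = lie_bracket M (f x) (f y)))"


section \<open>Uniform Lie algebras\<close>

text \<open>The uniform basis is the disjoint union of the set \<open>V\<close> of the \<open>v\<^sub>i\<close> and the set \<open>Z\<close> of the
  \<open>z\<^sub>j\<close>. None of the defining conditions depends on how these sets are enumerated.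
  In the third condition of \<open>uniform_basis_deg\<close> the set \<open>{x, y}\<close> is an unordered pair, so it is
  counted once if either of its two orderings has bracket \<open>c\<close>.\<close>

definition uniform_basis_deg ::
    "('a::real_vector) lie \<Rightarrow> 'a set \<Rightarrow> 'a set \<Rightarrow> nat \<Rightarrow> nat \<Rightarrow> bool" where
  "uniform_basis_deg L V Z r s \<longleftrightarrow>
     (let br = lie_bracket L in
       ((\<forall>x\<in>V. \<forall>c\<in>Z. br x c = 0) \<and> (\<forall>c\<in>Z. \<forall>d\<in>Z. br c d = 0) \<and>
        (\<forall>x\<in>V. \<forall>y\<in>V. br x y \<in> {0} \<union> Z \<union> uminus ` Z)) \<and>
       (\<forall>x\<in>V. \<forall>y\<in>V. \<forall>y'\<in>V. br x y \<noteq> 0 \<and> (br x y = br x y' \<or> br x y = - br x y') \<longrightarrow> y = y') \<and>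
       (\<forall>c\<in>Z. card {{x, y} | x y. x \<in> V \<and> y \<in> V \<and> br x y = c} = r) \<and>
       (\<forall>y\<in>V. card {x\<in>V. br x y \<noteq> 0} = s))"

definition uniform_basis ::
    "('a::real_vector) lie \<Rightarrow> 'a set \<Rightarrow> 'a set \<Rightarrow> nat \<Rightarrow> nat \<Rightarrow> nat \<Rightarrow> bool" where
  "uniform_basis L V Z p q r \<longleftrightarrow>
     finite V \<and> card V = q \<and> finite Z \<and> card Z = p \<and> V \<inter> Z = {} \<and>
     independent (V \<union> Z) \<and> span (V \<union> Z) = lie_space L \<and>
     (\<exists>s>0. uniform_basis_deg L V Z r s)"

definition uniform_lie :: "('a::real_vector) lie \<Rightarrow> nat \<Rightarrow> nat \<Rightarrow> nat \<Rightarrow> bool" where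
  "uniform_lie L p q r \<longleftrightarrow>
     p > 0 \<and> q > 0 \<and> r > 0 \<and> nilpotent_lie L \<and> (\<exists>V Z. uniform_basis L V Z p q r)"


section \<open>Lie algebras given by a basis and its nonzero brackets\<close>

datatype basis_symbol = VS nat | ZS nat | ZZS nat nat

type_synonym symbol_vec = "basis_symbol \<Rightarrow>\<^sub>0 real"

definition vv :: "nat \<Rightarrow> symbol_vec" where "vv i = Poly_Mapping.single (VS i) 1"
definition zz :: "nat \<Rightarrow> symbol_vec" where "zz l = Poly_Mapping.single (ZS l) 1"
definition zz2 :: "nat \<Rightarrow> nat \<Rightarrow> symbol_vec" where "zz2 i j = Poly_Mapping.single (ZZS i j) 1"

text \<open>A presentation \<open>(q, Z, bs)\<close> stands for the basis \<open>{v\<^sub>1, \<dots>, v\<^sub>q} \<union> Z\<close> with a bracket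
  \<open>[v\<^sub>i, v\<^sub>j] = w\<close> for each entry \<open>((i, j), w)\<close> of \<open>bs\<close>. The list \<open>bs\<close> contains at most one of
  the two orderings of a pair; the bracket is extended bilinearly and skew-symmetrically, and
  all brackets of basis vectors that are not listed vanish.\<close>

type_synonym presentation = "nat \<times> symbol_vec set \<times> ((nat \<times> nat) \<times> symbol_vec) list"

fun pres_V :: "presentation \<Rightarrow> symbol_vec set" where
  "pres_V (q, Z, bs) = vv ` {1..q}"

fun pres_Z :: "presentation \<Rightarrow> symbol_vec set" where
  "pres_Z (q, Z, bs) = Z"

fun lie_of :: "presentation \<Rightarrow> symbol_vec lie" where
  "lie_of (q, Z, bs) =
     \<lparr> lie_space = span (vv ` {1..q} \<union> Z),
       lie_bracket = (\<lambda>f g. \<Sum>((i, j), w)\<leftarrow>bs.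
         (Poly_Mapping.lookup f (VS i) * Poly_Mapping.lookup g (VS j)
          - Poly_Mapping.lookup f (VS j) * Poly_Mapping.lookup g (VS i)) *\<^sub>R w) \<rparr>"

definition free_pres :: "nat \<Rightarrow> presentation" where
  "free_pres q =
     (q, {zz2 i j | i j. 1 \<le> i \<and> i < j \<and> j \<le> q},
      [((i, j), zz2 i j). i \<leftarrow> [1..<q+1], j \<leftarrow> [i+1..<q+1]])"

definition listed_algebras :: "((nat \<times> nat \<times> nat) \<times> presentation) list" where
  "listed_algebras =
    [((1, 2, 1), (2, zz ` {1..1}, [((1,2), zz 1)])),
     ((1, 4, 2), (4, zz ` {1..1}, [((1,2), zz 1), ((3,4), zz 1)])),
     ((2, 4, 1), (4, zz ` {1..2}, [((1,2), zz 1), ((3,4), zz 2)])),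
     ((3, 3, 1), free_pres 3),
     ((4, 4, 1), (4, zz ` {1..4}, [((1,2), zz 1), ((2,3), zz 2), ((3,4), zz 3), ((4,1), zz 4)])),
     ((2, 4, 2), (4, zz ` {1..2}, [((1,2), zz 1), ((3,4), zz 1), ((2,3), zz 2), ((1,4), zz 2)])),
     ((5, 5, 1), (5, zz ` {1..5}, [((1,2), zz 1), ((2,3), zz 2), ((3,4), zz 3), ((4,5), zz 4),
                                   ((5,1), zz 5)])),
     ((3, 4, 2), (4, zz ` {1..3}, [((1,2), zz 1), ((3,4), zz 1), ((1,3), zz 2), ((2,4), - zz 2),
                                   ((1,4), zz 3), ((2,3), zz 3)])),
     ((3, 4, 2), (4, zz ` {1..3}, [((1,2), zz 1), ((3,4), zz 1), ((1,3), zz 2), ((2,4), zz 2),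
                                   ((1,4), zz 3), ((2,3), - zz 3)])),
     ((6, 4, 1), free_pres 4),
     ((5, 5, 2), (5, zz ` {1..5}, [((1,5), zz 1), ((2,4), zz 1), ((2,5), zz 2), ((3,4), zz 2),
                                   ((1,3), zz 3), ((4,5), zz 3), ((3,5), zz 4), ((1,2), zz 4),
                                   ((1,4), zz 5), ((2,3), zz 5)])),
     ((10, 5, 1), free_pres 5)]"

text \<open>Positions in the list are counted from 1.\<close>

definition listed_type :: "nat \<Rightarrow> nat \<times> nat \<times> nat" where
  "listed_type k = fst (listed_algebras ! (k - 1))"

definition listed_pres :: "nat \<Rightarrow> presentation" where
  "listed_pres k = snd (listed_algebras ! (k - 1))"

definition alt_pres_3 :: presentation where
  "alt_pres_3 = (4, zz ` {1..2}, [((1,3), zz 1), ((2,4), zz 1), ((1,4), zz 2), ((2,3), zz 2)])"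

definition displays_type :: "presentation \<Rightarrow> nat \<times> nat \<times> nat \<Rightarrow> bool" where
  "displays_type P t \<longleftrightarrow>
     (case t of (p, q, r) \<Rightarrow>
       nilpotent_lie (lie_of P) \<and> p > 0 \<and> q > 0 \<and> r > 0 \<and>
       uniform_basis (lie_of P) (pres_V P) (pres_Z P) p q r)"

end

(* For uniqueness, the dimensions of the
   algebra and of its derived algebra separate all listed algebras except the pairs (3,6), (8,9)
   and (7,11), and these are separated by the smallest rank of ad x over the noncentral x.
   For existence, the pairs of generators with nonzero bracket form an s-regular graph whose edges
   are coloured properly by the central basis vectors, with r edges of each colour. Counting edges
   gives q s = 2 p r, and 2 r <= q. If r = 1, the graph alone determines the algebra. If r = 2,
   every edge has a unique disjoint partner of the same colour; on at most five vertices this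
   determines the colouring, and what remains are signs, which are normalised by flipping and
   relabelling generators. *)
theory Submission
  imports Defs "HOL-Analysis.Linear_Algebra"
begin

section \<open>Lie algebras and their isomorphisms\<close>

text \<open>Behind the rank test stand real division algebras. Algebra (6) is the complex Heisenberg
  algebra read over the reals, and (3) is its counterpart over the split-complex numbers, as its
  second presentation shows. Algebra (8) has the bracket Im(y conj(x)) on the quaternions, and (9)
  is the same construction on the split quaternions. In the division cases \<open>ad x\<close> has
  full rank for every noncentral \<open>x\<close>; zero divisors lower it in the split cases. The
  signs decide where one coloured graph carries several algebras. On four vertices with r = 2 each
  colour covers every vertex, so negating one generator changes all relative signs together, and
  products of two relative signs survive. On five vertices each colour misses one vertex, so more
  signs can be removed; the parity that sign changes cannot touch is reversed by a symmetry of the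
  colouring, which leaves only (11). Isomorphisms are built from the symbolic presentation into the
  abstract algebra; surjectivity is read off from the brackets, and equal dimensions then give
  injectivity.\<close>

lemma lie_algebraD:
  assumes "lie_algebra L"
  shows "subspace (lie_space L)"
    and "\<exists>B. finite B \<and> lie_space L = span B"
    and "x \<in> lie_space L \<Longrightarrow> y \<in> lie_space L \<Longrightarrow> lie_bracket L x y \<in> lie_space L"
    and "x \<in> lie_space L \<Longrightarrow> y \<in> lie_space L \<Longrightarrow> w \<in> lie_space L \<Longrightarrow>
           lie_bracket L (x + y) w = lie_bracket L x w + lie_bracket L y w"
    and "x \<in> lie_space L \<Longrightarrow> y \<in> lie_space L \<Longrightarrow> w \<in> lie_space L \<Longrightarrow>
           lie_bracket L w (x + y) = lie_bracket L w x + lie_bracket L w y"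
    and "x \<in> lie_space L \<Longrightarrow> y \<in> lie_space L \<Longrightarrow> lie_bracket L (c *\<^sub>R x) y = c *\<^sub>R lie_bracket L x y"
    and "x \<in> lie_space L \<Longrightarrow> y \<in> lie_space L \<Longrightarrow> lie_bracket L x (c *\<^sub>R y) = c *\<^sub>R lie_bracket L x y"
    and "x \<in> lie_space L \<Longrightarrow> lie_bracket L x x = 0"
  using assms unfolding lie_algebra_def Let_def by metis+

lemma lie_bracket_skew:
  assumes L: "lie_algebra L" and x: "x \<in> lie_space L" and y: "y \<in> lie_space L"
  shows "lie_bracket L y x = - lie_bracket L x y"
proof -
  have xy: "x + y \<in> lie_space L"
    using lie_algebraD(1)[OF L] x y by (rule subspace_add)
  have "0 = lie_bracket L (x + y) (x + y)"
    using lie_algebraD(8)[OF L xy] by simp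
  also have "\<dots> = lie_bracket L x y + lie_bracket L y x"
    using lie_algebraD(4)[OF L x y xy] lie_algebraD(5)[OF L x y x] lie_algebraD(5)[OF L x y y]
      lie_algebraD(8)[OF L x] lie_algebraD(8)[OF L y] by simp
  finally show ?thesis
    by (simp add: eq_neg_iff_add_eq_0 add.commute)
qed

text \<open>An isomorphism of Lie algebras is additive and homogeneous on the carrier only, while
  \<open>linear\<close> speaks about total functions. Extending the values on a basis of
  \<open>S\<close> gives a total linear map that agrees with \<open>f\<close> on all of
  \<open>S\<close>.\<close>

lemma additive_on_extend_linear:
  fixes f :: "'a::real_vector \<Rightarrow> 'b::real_vector"
  assumes S: "subspace S"
    and add: "\<And>x y. x \<in> S \<Longrightarrow> y \<in> S \<Longrightarrow> f (x + y) = f x + f y"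
    and scale: "\<And>c x. x \<in> S \<Longrightarrow> f (c *\<^sub>R x) = c *\<^sub>R f x"
  obtains g where "linear g" "\<And>x. x \<in> S \<Longrightarrow> g x = f x"
proof -
  obtain B where B: "B \<subseteq> S" "independent B" "S \<subseteq> span B"
    using maximal_independent_subset[of S] by blast
  obtain g where g: "linear g" "\<And>x. x \<in> B \<Longrightarrow> g x = f x"
    using linear_independent_extend[OF B(2), of f] by blast
  have "x \<in> S \<and> g x = f x" if "x \<in> span B" for x
    using that
  proof (induction rule: span_induct_alt)
    case base
    have "f 0 = 0" using scale[of 0 0] S by (simp add: subspace_0)
    then show ?case using S g(1) by (simp add: subspace_0 linear_0)
  next
    case (step c x y)
    have "x \<in> S" "c *\<^sub>R x \<in> S" using step B(1) S by (auto simp: subspace_scale)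
    then show ?case
      using step S g add[of "c *\<^sub>R x" y] scale[of x c]
      by (simp add: linear_add linear_scale subspace_add)
  qed
  then have "g x = f x" if "x \<in> S" for x
    using that B(3) by blast
  with g(1) show thesis by (rule that)
qed

lemma lie_isomorphic_linear:
  fixes L :: "('a::real_vector) lie" and M :: "('b::real_vector) lie"
  assumes L: "lie_algebra L" and iso: "lie_isomorphic L M"
  obtains g where "linear g" "inj_on g (lie_space L)" "g ` lie_space L = lie_space M"
    "\<And>x y. x \<in> lie_space L \<Longrightarrow> y \<in> lie_space L \<Longrightarrow> g (lie_bracket L x y) = lie_bracket M (g x) (g y)"
proof -
  note D = lie_algebraD[OF L]
  obtain f where f: "bij_betw f (lie_space L) (lie_space M)"
    "\<And>x y. x\<in>lie_space L \<Longrightarrow> y\<in>lie_space L \<Longrightarrow> f (x + y) = f x + f y"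
    "\<And>c x. x\<in>lie_space L \<Longrightarrow> f (c *\<^sub>R x) = c *\<^sub>R f x"
    "\<And>x y. x\<in>lie_space L \<Longrightarrow> y\<in>lie_space L \<Longrightarrow> f (lie_bracket L x y) = lie_bracket M (f x) (f y)"
    using iso unfolding lie_isomorphic_def by blast
  obtain g where g: "linear g" "\<And>x. x \<in> lie_space L \<Longrightarrow> g x = f x"
    using additive_on_extend_linear[OF D(1) f(2,3)] by blast
  show thesis
  proof (rule that[OF g(1)])
    show "inj_on g (lie_space L)" "g ` lie_space L = lie_space M"
      using f(1) g(2) by (auto simp: bij_betw_def inj_on_def image_def)
  qed (simp add: g f D)
qed

lemma lie_isomorphic_trans:
  assumes "lie_isomorphic L M" and "lie_isomorphic M N"
  shows "lie_isomorphic L N"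
proof -
  obtain f where f: "bij_betw f (lie_space L) (lie_space M)"
    "\<And>x y. x\<in>lie_space L \<Longrightarrow> y\<in>lie_space L \<Longrightarrow> f (x + y) = f x + f y"
    "\<And>c x. x\<in>lie_space L \<Longrightarrow> f (c *\<^sub>R x) = c *\<^sub>R f x"
    "\<And>x y. x\<in>lie_space L \<Longrightarrow> y\<in>lie_space L \<Longrightarrow> f (lie_bracket L x y) = lie_bracket M (f x) (f y)"
    using assms(1) unfolding lie_isomorphic_def by blast
  obtain g where g: "bij_betw g (lie_space M) (lie_space N)"
    "\<And>x y. x\<in>lie_space M \<Longrightarrow> y\<in>lie_space M \<Longrightarrow> g (x + y) = g x + g y"
    "\<And>c x. x\<in>lie_space M \<Longrightarrow> g (c *\<^sub>R x) = c *\<^sub>R g x"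
    "\<And>x y. x\<in>lie_space M \<Longrightarrow> y\<in>lie_space M \<Longrightarrow> g (lie_bracket M x y) = lie_bracket N (g x) (g y)"
    using assms(2) unfolding lie_isomorphic_def by blast
  have fM: "f x \<in> lie_space M" if "x \<in> lie_space L" for x
    using f(1) that by (auto simp: bij_betw_def)
  show ?thesis
    unfolding lie_isomorphic_def
    using bij_betw_trans[OF f(1) g(1)] f(2-) g(2-) fM
    by (intro exI[of _ "g \<circ> f"]) simp
qed

lemma lie_isomorphic_sym:
  assumes L: "lie_algebra L" and iso: "lie_isomorphic L M"
  shows "lie_isomorphic M L"
proof -
  note D = lie_algebraD[OF L]
  obtain f where f: "bij_betw f (lie_space L) (lie_space M)"
    "\<And>x y. x\<in>lie_space L \<Longrightarrow> y\<in>lie_space L \<Longrightarrow> f (x + y) = f x + f y"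
    "\<And>c x. x\<in>lie_space L \<Longrightarrow> f (c *\<^sub>R x) = c *\<^sub>R f x"
    "\<And>x y. x\<in>lie_space L \<Longrightarrow> y\<in>lie_space L \<Longrightarrow> f (lie_bracket L x y) = lie_bracket M (f x) (f y)"
    using iso unfolding lie_isomorphic_def by blast
  define h where "h = the_inv_into (lie_space L) f"
  have bij: "bij_betw h (lie_space M) (lie_space L)"
    unfolding h_def by (rule bij_betw_the_inv_into[OF f(1)])
  have hf: "h (f x) = x" if "x \<in> lie_space L" for x
    unfolding h_def using f(1) that by (auto simp: bij_betw_def the_inv_into_f_f)
  have fh: "f (h y) = y" "h y \<in> lie_space L" if "y \<in> lie_space M" for y
    using f(1) that bij unfolding h_def by (auto simp: bij_betw_def f_the_inv_into_f)
  have "h (x + y) = h x + h y" if "x \<in> lie_space M" "y \<in> lie_space M" for x y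
    using hf[OF subspace_add[OF D(1) fh(2)[OF that(1)] fh(2)[OF that(2)]]] that fh f(2) by metis
  moreover have "h (c *\<^sub>R x) = c *\<^sub>R h x" if "x \<in> lie_space M" for x c
    using hf[OF subspace_scale[OF D(1) fh(2)[OF that], of c]] that fh f(3) by metis
  moreover have "h (lie_bracket M x y) = lie_bracket L (h x) (h y)"
    if "x \<in> lie_space M" "y \<in> lie_space M" for x y
    using hf[OF D(3)[OF fh(2)[OF that(1)] fh(2)[OF that(2)]]] that fh f(4) by metis
  ultimately show ?thesis
    unfolding lie_isomorphic_def using bij by blast
qed

section \<open>Dimensions and adjoint ranks as isomorphism invariants\<close>

lemma dim_linear_image_eq:
  fixes g :: "'a::real_vector \<Rightarrow> 'b::real_vector"
  assumes g: "linear g" and inj: "inj_on g (span A)"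
  shows "dim (g ` A) = dim A"
proof -
  obtain B where B: "B \<subseteq> A" "independent B" "A \<subseteq> span B"
    using maximal_independent_subset[of A] by blast
  have AB: "span A = span B"
    using B by (metis span_eq span_superset subset_trans)
  have "dim (g ` A) = card (g ` B)"
  proof (rule dim_eq_card)
    show "span (g ` B) = span (g ` A)"
      using AB by (simp add: linear_span_image[OF g])
    show "independent (g ` B)"
      using linear_independent_injective_image[OF g B(2)] inj AB by simp
  qed
  also have "\<dots> = card B"
    using inj_on_subset[OF inj] B(1) span_superset[of A] by (intro card_image) blast
  also have "\<dots> = dim A"
    using dim_eq_card[OF _ B(2), of A] AB by simp
  finally show ?thesis .
qed

text \<open>Only the brackets themselves, without their span: \<open>dim\<close> does not see the
  difference.\<close>

definition derived :: "('a::real_vector) lie \<Rightarrow> 'a set" where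
  "derived L = {lie_bracket L x y | x y. x \<in> lie_space L \<and> y \<in> lie_space L}"

definition ad_image :: "('a::real_vector) lie \<Rightarrow> 'a \<Rightarrow> 'a set" where
  "ad_image L x = lie_bracket L x ` lie_space L"

text \<open>The smallest rank of \<open>ad x\<close> over noncentral \<open>x\<close>, expressed
  through a bound so that no minimum has to be formed. Excluding images inside \<open>{0}\<close>
  removes the central elements, whose rank 0 would hide the invariant.\<close>

definition has_ad_rank_le :: "nat \<Rightarrow> ('a::real_vector) lie \<Rightarrow> bool" where
  "has_ad_rank_le k L \<longleftrightarrow> (\<exists>x\<in>lie_space L. \<not> ad_image L x \<subseteq> {0} \<and> dim (ad_image L x) \<le> k)"

text \<open>A linear isomorphism \<open>g\<close> maps brackets onto brackets and conjugates the
  adjoint map of \<open>x\<close> into that of \<open>g x\<close>, so each of these sets is carried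
  to its counterpart with its dimension preserved.\<close>

lemma lie_isomorphic_invariants:
  fixes L :: "('a::real_vector) lie" and M :: "('b::real_vector) lie"
  assumes L: "lie_algebra L" and iso: "lie_isomorphic L M"
  shows "dim (lie_space M) = dim (lie_space L)"
    and "dim (derived M) = dim (derived L)"
    and "has_ad_rank_le k L \<Longrightarrow> has_ad_rank_le k M"
proof -
  note D = lie_algebraD[OF L]
  obtain g where g: "linear g" "inj_on g (lie_space L)" "g ` lie_space L = lie_space M"
    "\<And>x y. x \<in> lie_space L \<Longrightarrow> y \<in> lie_space L \<Longrightarrow> g (lie_bracket L x y) = lie_bracket M (g x) (g y)"
    by (rule lie_isomorphic_linear[OF L iso], rule that)
  have dim_g: "dim (g ` A) = dim A" if "A \<subseteq> lie_space L" for A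
    using dim_linear_image_eq[OF g(1)] inj_on_subset[OF g(2) span_minimal[OF that D(1)]] by blast
  show "dim (lie_space M) = dim (lie_space L)"
    using dim_g[of "lie_space L"] g(3) by simp
  have "derived L \<subseteq> lie_space L" unfolding derived_def using D(3) by blast
  moreover have "g ` derived L = derived M"
  proof
    show "g ` derived L \<subseteq> derived M"
      unfolding derived_def using g(3,4) by fastforce
    show "derived M \<subseteq> g ` derived L"
    proof
      fix z assume "z \<in> derived M"
      then obtain x y where "z = lie_bracket M (g x) (g y)" "x \<in> lie_space L" "y \<in> lie_space L"
        unfolding derived_def g(3)[symmetric] by blast
      then show "z \<in> g ` derived L"
        unfolding derived_def using g(4) by (metis (mono_tags, lifting) imageI mem_Collect_eq)
    qed
  qed
  ultimately show "dim (derived M) = dim (derived L)"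
    using dim_g by metis
  show "has_ad_rank_le k M" if "has_ad_rank_le k L"
  proof -
    from that obtain x where x: "x \<in> lie_space L" "\<not> ad_image L x \<subseteq> {0}" "dim (ad_image L x) \<le> k"
      unfolding has_ad_rank_le_def by blast
    have im: "g ` ad_image L x = ad_image M (g x)"
      unfolding ad_image_def g(3)[symmetric] image_image using g(4) x(1) by (intro image_cong) auto
    have sub: "ad_image L x \<subseteq> lie_space L"
      unfolding ad_image_def using D(3) x(1) by blast
    obtain y where y: "y \<in> ad_image L x" "y \<noteq> 0" using x(2) by blast
    have "g y \<noteq> 0"
      using inj_onD[OF g(2), of y 0] y sub subspace_0[OF D(1)] linear_0[OF g(1)] by auto
    then have "\<not> ad_image M (g x) \<subseteq> {0}" using im y by blast
    moreover have "g x \<in> lie_space M" using x(1) g(3) by blast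
    moreover have "dim (ad_image M (g x)) \<le> k" using x(3) dim_g[OF sub] im by simp
    ultimately show ?thesis unfolding has_ad_rank_le_def by blast
  qed
qed

section \<open>Presentations\<close>

lemma lookup_scaleR [simp]:
  fixes f :: "'a \<Rightarrow>\<^sub>0 'b::real_vector"
  shows "Poly_Mapping.lookup (c *\<^sub>R f) i = c *\<^sub>R Poly_Mapping.lookup f i"
proof -
  have "finite {i. c *\<^sub>R Poly_Mapping.lookup f i \<noteq> 0}"
    by (rule finite_subset[OF _ finite_keys[of f]]) (auto simp: in_keys_iff)
  then show ?thesis
    by (simp add: scaleR_poly_mapping_def)
qed

abbreviation unit_vec :: "basis_symbol \<Rightarrow> symbol_vec" where
  "unit_vec s \<equiv> Poly_Mapping.single s 1"

lemma inj_unit_vec: "inj unit_vec"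
  by (rule injI) (metis lookup_single_eq lookup_single_not_eq zero_neq_one)

lemma symbol_vec_expansion:
  assumes "finite A" "Poly_Mapping.keys f \<subseteq> A"
  shows "f = (\<Sum>s\<in>A. Poly_Mapping.lookup f s *\<^sub>R unit_vec s)"
proof (rule poly_mapping_eqI)
  fix t
  have "Poly_Mapping.lookup (\<Sum>s\<in>A. Poly_Mapping.lookup f s *\<^sub>R unit_vec s) t
      = (\<Sum>s\<in>A. if s = t then Poly_Mapping.lookup f s else 0)"
    by (auto simp: lookup_sum lookup_single when_def intro!: sum.cong)
  also have "\<dots> = Poly_Mapping.lookup f t"
    using assms by (auto simp: sum.delta in_keys_iff)
  finally show "Poly_Mapping.lookup f t
      = Poly_Mapping.lookup (\<Sum>s\<in>A. Poly_Mapping.lookup f s *\<^sub>R unit_vec s) t" ..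
qed

lemma span_unit_vec: "span (unit_vec ` A) = {f. Poly_Mapping.keys f \<subseteq> A}"
proof
  have "subspace {f :: symbol_vec. Poly_Mapping.keys f \<subseteq> A}"
  proof (rule subspaceI)
    fix f g :: symbol_vec and c :: real
    assume f: "f \<in> {f. Poly_Mapping.keys f \<subseteq> A}"
    then show "c *\<^sub>R f \<in> {f. Poly_Mapping.keys f \<subseteq> A}" by (auto simp: in_keys_iff)
    assume "g \<in> {f. Poly_Mapping.keys f \<subseteq> A}"
    then show "f + g \<in> {f. Poly_Mapping.keys f \<subseteq> A}"
      using f Poly_Mapping.keys_add[of f g] by blast
  qed simp
  then show "span (unit_vec ` A) \<subseteq> {f. Poly_Mapping.keys f \<subseteq> A}"
    by (intro span_minimal) auto
  show "{f. Poly_Mapping.keys f \<subseteq> A} \<subseteq> span (unit_vec ` A)"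
  proof safe
    fix f :: symbol_vec assume f: "Poly_Mapping.keys f \<subseteq> A"
    have "(\<Sum>s\<in>Poly_Mapping.keys f. Poly_Mapping.lookup f s *\<^sub>R unit_vec s) \<in> span (unit_vec ` A)"
      using f by (intro span_sum span_scale span_base) auto
    then show "f \<in> span (unit_vec ` A)"
      using symbol_vec_expansion[OF finite_keys order_refl, of f] by simp
  qed
qed

lemma independent_unit_vec: "independent (unit_vec ` A)"
  unfolding dependent_def
proof safe
  fix s assume "s \<in> A" "unit_vec s \<in> span (unit_vec ` A - {unit_vec s})"
  moreover have "unit_vec ` A - {unit_vec s} = unit_vec ` (A - {s})"
    using inj_unit_vec by (simp add: image_set_diff)
  ultimately show False by (simp add: span_unit_vec)
qed

text \<open>A presentation all of whose brackets are signed basis symbols; \<open>True\<close> stands for the sign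
  \<open>+\<close>.\<close>

type_synonym signed_symbol = "bool \<times> basis_symbol"
type_synonym bracket_list = "((nat \<times> nat) \<times> signed_symbol) list"

fun signed :: "('b \<Rightarrow> 'a::real_vector) \<Rightarrow> bool \<times> 'b \<Rightarrow> 'a" where
  "signed c (b, s) = (if b then c s else - c s)"

fun neg_signed :: "bool \<times> 'b \<Rightarrow> bool \<times> 'b" where
  "neg_signed (b, s) = (\<not> b, s)"

lemma signed_neg [simp]: "signed c (neg_signed w) = - signed c w"
  by (cases w) auto

lemma neg_signed_involutive: "neg_signed (neg_signed w) = w"
  by (cases w) auto

definition pres_of :: "nat \<Rightarrow> basis_symbol list \<Rightarrow> bracket_list \<Rightarrow> presentation" where
  "pres_of q S es = (q, unit_vec ` set S, map (\<lambda>(e, w). (e, signed unit_vec w)) es)"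

text \<open>Answers queries in both orientations: a reversed entry is found with the opposite sign,
  so skew-symmetry is built into the lookup.\<close>

fun table :: "bracket_list \<Rightarrow> nat \<Rightarrow> nat \<Rightarrow> signed_symbol option" where
  "table [] i j = None"
| "table (((k, l), w) # es) i j =
     (if i = k \<and> j = l then Some w else if i = l \<and> j = k then Some (neg_signed w) else table es i j)"

text \<open>Since \<open>table\<close> also finds reversed entries,
  \<open>table es k l = None\<close> excludes later entries for either ordering of the pair. Hence
  the first match of a lookup is the only one.\<close>

fun skew_list :: "bracket_list \<Rightarrow> bool" where
  "skew_list [] = True"
| "skew_list (((k, l), w) # es) = (k \<noteq> l \<and> table es k l = None \<and> skew_list es)"

definition is_VS :: "basis_symbol \<Rightarrow> bool" where
  "is_VS s = (case s of VS i \<Rightarrow> True | _ \<Rightarrow> False)"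

text \<open>The symbols in \<open>S\<close> must not be generators: then every bracket has vanishing
  generator coordinates, which makes it central.\<close>

definition proper_pres :: "basis_symbol list \<Rightarrow> bracket_list \<Rightarrow> bool" where
  "proper_pres S es \<longleftrightarrow> skew_list es \<and> distinct S \<and> list_all (\<lambda>s. \<not> is_VS s) S \<and>
     list_all (\<lambda>((k, l), (b, s)). s \<in> set S) es"

abbreviation opt_signed :: "('b \<Rightarrow> 'a::real_vector) \<Rightarrow> (bool \<times> 'b) option \<Rightarrow> 'a" where
  "opt_signed c w \<equiv> (case w of None \<Rightarrow> 0 | Some u \<Rightarrow> signed c u)"

lemma table_swap: "skew_list es \<Longrightarrow> table es j i = map_option neg_signed (table es i j)"
proof (induction es)
  case (Cons e es)
  obtain k l w where e: "e = ((k, l), w)" by (metis surj_pair)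
  have "k \<noteq> l" and IH: "table es j i = map_option neg_signed (table es i j)"
    using Cons by (simp_all add: e)
  then show ?case
    unfolding e table.simps IH by (auto simp: neg_signed_involutive)
qed simp

text \<open>The factors built from \<open>when\<close> are the coordinates of two basis generators.
  At most one entry of a skew list has a nonzero coefficient there, so the sum collapses to a single
  lookup.\<close>

lemma skew_list_sum:
  assumes "skew_list es"
  shows "(\<Sum>((k, l), w)\<leftarrow>es. ((1 when i = k) * (1 when j = l) - (1 when i = l) * (1 when j = k))
            *\<^sub>R signed c w) = opt_signed c (table es i j)"
  using assms
proof (induction es)
  case (Cons e es)
  obtain k l w where e: "e = ((k, l), w)" by (metis surj_pair)
  from Cons.prems have kl: "k \<noteq> l" "table es k l = None" "table es l k = None"
    using table_swap[of es k l] by (auto simp: e)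
  from Cons have IH: "(\<Sum>((k, l), w)\<leftarrow>es. ((1 when i = k) * (1 when j = l)
      - (1 when i = l) * (1 when j = k)) *\<^sub>R signed c w) = opt_signed c (table es i j)"
    by (simp add: e)
  consider "i = k" "j = l" | "i = l" "j = k" | "\<not> (i = k \<and> j = l)" "\<not> (i = l \<and> j = k)" by blast
  then show ?case
  proof cases
    case 1
    then show ?thesis unfolding e list.map sum_list.Cons IH using kl by simp
  next
    case 2
    then show ?thesis unfolding e list.map sum_list.Cons IH using kl by simp
  next
    case 3
    have w0: "(1 when P) * (1 when Q) = (0::real)" if "\<not> (P \<and> Q)" for P Q
      using that by (simp add: when_def)
    have tab: "table (((k, l), w) # es) i j = table es i j"
      unfolding table.simps using 3 by (simp only: if_False)
    show ?thesis
      unfolding e list.map sum_list.Cons IH tab prod.case w0[OF 3(1)] w0[OF 3(2)] by simp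
  qed
qed simp

lemma table_in_symbols:
  assumes "proper_pres S es" and "table es i j = Some w"
  shows "snd w \<in> set S"
proof -
  have "list_all (\<lambda>((k, l), (b, s)). s \<in> set S) es"
    using assms(1) by (simp add: proper_pres_def)
  then show ?thesis
    using assms(2) by (induction es i j rule: table.induct) (auto split: if_splits prod.splits)
qed

lemma lie_space_pres:
  "lie_space (lie_of (pres_of q S es)) = span (unit_vec ` (VS ` {1..q} \<union> set S))"
  by (simp add: pres_of_def image_Un image_image vv_def[abs_def])

lemma lie_bracket_pres:
  "lie_bracket (lie_of (pres_of q S es)) f g =
     (\<Sum>((k, l), w)\<leftarrow>es. (Poly_Mapping.lookup f (VS k) * Poly_Mapping.lookup g (VS l)
        - Poly_Mapping.lookup f (VS l) * Poly_Mapping.lookup g (VS k)) *\<^sub>R signed unit_vec w)"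
proof -
  have "(\<Sum>((k, l), w)\<leftarrow>map (\<lambda>(e, w). (e, signed unit_vec w)) es. c k l *\<^sub>R w)
      = (\<Sum>((k, l), w)\<leftarrow>es. c k l *\<^sub>R signed unit_vec w)" for c
    by (induction es) auto
  then show ?thesis by (simp only: pres_of_def lie_of.simps lie.select_convs)
qed

lemma sum_list_all_zero: "(\<And>e. h e = (0::'a::monoid_add)) \<Longrightarrow> (\<Sum>e\<leftarrow>es. h e) = 0"
  by (induction es) auto

lemma linear_sum_list:
  assumes "\<And>e. e \<in> set es \<Longrightarrow> linear (\<lambda>f. h f e)"
  shows "linear (\<lambda>f. \<Sum>e\<leftarrow>es. h f e)"
  using assms by (induction es) (auto intro: linear_compose_add module_hom_zero simp: linear_zero)

lemma linear_lie_bracket_pres: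
  "linear (\<lambda>f. lie_bracket (lie_of (pres_of q S es)) f g)"
  "linear (\<lambda>g. lie_bracket (lie_of (pres_of q S es)) f g)"
proof -
  have 1: "linear (\<lambda>f::symbol_vec. (Poly_Mapping.lookup f i * a - Poly_Mapping.lookup f j * b) *\<^sub>R w)"
    for i j a b and w :: symbol_vec
    by (rule linearI) (simp_all add: lookup_add algebra_simps)
  have 2: "linear (\<lambda>f::symbol_vec. (a * Poly_Mapping.lookup f i - b * Poly_Mapping.lookup f j) *\<^sub>R w)"
    for i j a b and w :: symbol_vec
    by (rule linearI) (simp_all add: lookup_add algebra_simps)
  show "linear (\<lambda>f. lie_bracket (lie_of (pres_of q S es)) f g)"
    unfolding lie_bracket_pres case_prod_beta by (rule linear_sum_list) (rule 1)
  show "linear (\<lambda>g. lie_bracket (lie_of (pres_of q S es)) f g)"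
    unfolding lie_bracket_pres case_prod_beta by (rule linear_sum_list) (rule 2)
qed

lemma lie_bracket_pres_vv:
  assumes "skew_list es"
  shows "lie_bracket (lie_of (pres_of q S es)) (vv i) (vv j) = opt_signed unit_vec (table es i j)"
  using skew_list_sum[OF assms, of i j unit_vec]
  by (simp add: lie_bracket_pres vv_def lookup_single)

lemma lie_bracket_pres_eq_0:
  assumes "(\<forall>k. Poly_Mapping.lookup f (VS k) = 0) \<or> (\<forall>k. Poly_Mapping.lookup g (VS k) = 0)"
  shows "lie_bracket (lie_of (pres_of q S es)) f g = 0"
proof -
  show ?thesis
    unfolding lie_bracket_pres using assms by (intro sum_list_all_zero) (auto simp: case_prod_beta)
qed

lemma lookup_span_central:
  assumes "proper_pres S es" and "z \<in> span (unit_vec ` set S)"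
  shows "Poly_Mapping.lookup z (VS k) = 0"
proof -
  have "VS k \<notin> set S"
    using assms(1) by (auto simp: proper_pres_def list_all_iff is_VS_def)
  then show ?thesis
    using assms(2) by (auto simp: span_unit_vec in_keys_iff)
qed

lemma lie_bracket_pres_central:
  assumes "proper_pres S es"
  shows "lie_bracket (lie_of (pres_of q S es)) f g \<in> span (unit_vec ` set S)"
proof -
  have "list_all (\<lambda>((k, l), (b, s)). s \<in> set S) es"
    using assms(1) by (simp add: proper_pres_def)
  then show ?thesis
    unfolding lie_bracket_pres
  proof (induction es)
    case (Cons e es)
    obtain k l b s where e: "e = ((k, l), (b, s))" by (metis surj_pair)
    have "signed unit_vec (b, s) \<in> span (unit_vec ` set S)"
      using Cons.prems by (auto simp: e intro: span_neg span_base)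
    then show ?case
      unfolding e list.map sum_list.Cons prod.case
      using Cons by (intro span_add span_scale) (auto simp: e)
  qed (simp add: span_zero)
qed

lemma lie_algebra_pres:
  assumes "proper_pres S es"
  shows "lie_algebra (lie_of (pres_of q S es))"
proof -
  let ?L = "lie_of (pres_of q S es)"
  note lin = linear_lie_bracket_pres[of q S es]
  have sub: "span (unit_vec ` set S) \<subseteq> lie_space ?L"
    unfolding lie_space_pres by (intro span_mono) auto
  \<comment> \<open>A bracket has no generator coordinates, so bracketing it again gives 0. This
    settles the Jacobi identity term by term.\<close>
  have nil: "lie_bracket ?L x (lie_bracket ?L y w) = 0" for x y w
    using lookup_span_central[OF assms lie_bracket_pres_central[OF assms]]
    by (intro lie_bracket_pres_eq_0) blast
  have alt: "lie_bracket ?L x x = 0" for x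
    unfolding lie_bracket_pres by (rule sum_list_all_zero) (simp add: case_prod_beta mult.commute)
  have "\<exists>B. finite B \<and> lie_space ?L = span B"
    unfolding lie_space_pres by (intro exI[of _ "unit_vec ` (VS ` {1..q} \<union> set S)"]) simp
  then show ?thesis
    unfolding lie_algebra_def Let_def
    using sub lie_bracket_pres_central[OF assms] nil alt
      linear_add[OF lin(1)] linear_add[OF lin(2)] linear_scale[OF lin(1)] linear_scale[OF lin(2)]
    by (intro conjI ballI allI) (simp_all add: lie_space_pres subset_iff)
qed

lemma nilpotent_pres:
  assumes "proper_pres S es"
  shows "nilpotent_lie (lie_of (pres_of q S es))"
proof -
  let ?L = "lie_of (pres_of q S es)"
  have 1: "lower_central ?L (Suc 0) \<subseteq> span (unit_vec ` set S)"
    unfolding lower_central.simps using lie_bracket_pres_central[OF assms]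
    by (intro span_minimal) auto
  have "{lie_bracket ?L x y | x y. x \<in> lie_space ?L \<and> y \<in> lower_central ?L (Suc 0)} \<subseteq> {0}"
    using lie_bracket_pres_eq_0 lookup_span_central[OF assms] 1 by blast
  then have "lower_central ?L (Suc (Suc 0)) \<subseteq> {0}"
    unfolding lower_central.simps(2)[of _ "Suc 0"] by (intro span_minimal) (auto simp: subspace_def)
  moreover have "0 \<in> lower_central ?L (Suc (Suc 0))"
    by (simp add: span_zero)
  ultimately show ?thesis
    unfolding nilpotent_lie_def using lie_algebra_pres[OF assms] by blast
qed

section \<open>Uniformity as an executable check on bracket tables\<close>

definition uniform_check :: "nat \<Rightarrow> basis_symbol list \<Rightarrow> bracket_list \<Rightarrow> nat \<Rightarrow> nat \<Rightarrow> bool" where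
  "uniform_check q S es r s \<longleftrightarrow> (let I = [1..<Suc q] in
     proper_pres S es \<and>
     list_all (\<lambda>x. list_all (\<lambda>y. list_all (\<lambda>y'. y = y' \<or> table es x y = None \<or> table es x y' = None \<or>
       snd (the (table es x y)) \<noteq> snd (the (table es x y'))) I) I) I \<and>
     list_all (\<lambda>t. length (filter (\<lambda>(i, j). table es i j = Some (True, t)) (List.product I I)) = r) S \<and>
     list_all (\<lambda>j. length (filter (\<lambda>i. table es i j \<noteq> None) I) = s) I)"

lemma unit_vec_eq_iff [simp]: "unit_vec s = unit_vec t \<longleftrightarrow> s = t"
  using inj_unit_vec by (auto dest: injD)

lemma unit_vec_neq_minus: "unit_vec s \<noteq> - unit_vec t"
proof
  assume "unit_vec s = - unit_vec t"
  then have "Poly_Mapping.lookup (unit_vec s) s = - Poly_Mapping.lookup (unit_vec t) s" by simp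
  then show False by (auto simp: lookup_single when_def split: if_splits)
qed

lemma unit_vec_neq_0 [simp]: "unit_vec s \<noteq> 0"
  by (metis lookup_single_eq lookup_zero zero_neq_one)

lemma opt_signed_unit_vec_0: "opt_signed unit_vec w = 0 \<longleftrightarrow> w = None"
  by (auto split: option.splits)

lemma opt_signed_unit_vec: "opt_signed unit_vec w = unit_vec t \<longleftrightarrow> w = Some (True, t)"
proof (cases w)
  case (Some u)
  obtain b s where "u = (b, s)" by (cases u)
  with Some show ?thesis
    using unit_vec_neq_minus[of t s] by auto
next
  case None
  then show ?thesis using unit_vec_neq_0[of t] by auto
qed

lemma opt_signed_unit_vec_parallel:
  assumes "opt_signed unit_vec u = opt_signed unit_vec w \<or> opt_signed unit_vec u = - opt_signed unit_vec w"
    and "opt_signed unit_vec u \<noteq> 0"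
  shows "u \<noteq> None" "w \<noteq> None" "snd (the u) = snd (the w)"
proof -
  have "opt_signed unit_vec w \<noteq> 0" using assms by auto
  then obtain u' w' where uw: "u = Some u'" "w = Some w'"
    using assms(2) unfolding opt_signed_unit_vec_0 by blast
  then show "u \<noteq> None" "w \<noteq> None" by simp_all
  obtain b s b' t where bs: "u' = (b, s)" "w' = (b', t)" by (cases u', cases w')
  then show "snd (the u) = snd (the w)"
    using assms(1) unit_vec_neq_minus[of s t] unit_vec_neq_minus[of t s] uw by (auto split: if_splits)
qed

lemma vv_unit_vec: "vv i = unit_vec (VS i)"
  by (simp add: vv_def)

text \<open>Reversing a pair flips the sign flag, so only one ordering of a pair can carry
  \<open>(True, t)\<close>. Counting ordered pairs in the table therefore counts unordered
  pairs.\<close>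

lemma card_pairs_table:
  assumes "skew_list es"
  shows "card {{x, y} | x y. x \<in> vv ` {1..q} \<and> y \<in> vv ` {1..q} \<and>
            lie_bracket (lie_of (pres_of q S es)) x y = unit_vec t}
       = length (filter (\<lambda>(i, j). table es i j = Some (True, t)) (List.product [1..<Suc q] [1..<Suc q]))"
proof -
  let ?P = "filter (\<lambda>(i, j). table es i j = Some (True, t)) (List.product [1..<Suc q] [1..<Suc q])"
  have eq: "{{x, y} | x y. x \<in> vv ` {1..q} \<and> y \<in> vv ` {1..q} \<and>
      lie_bracket (lie_of (pres_of q S es)) x y = unit_vec t} = (\<lambda>(i, j). {vv i, vv j}) ` set ?P"
    (is "?A = ?B")
  proof
    show "?A \<subseteq> ?B"
    proof
      fix a assume "a \<in> ?A"
      then obtain i j where "a = {vv i, vv j}" "i \<in> {1..q}" "j \<in> {1..q}"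
        "lie_bracket (lie_of (pres_of q S es)) (vv i) (vv j) = unit_vec t" by blast
      then have "(i, j) \<in> set ?P" "a = (\<lambda>(i, j). {vv i, vv j}) (i, j)"
        using lie_bracket_pres_vv[OF assms] opt_signed_unit_vec by auto
      then show "a \<in> ?B" by (rule rev_image_eqI)
    qed
    show "?B \<subseteq> ?A"
    proof
      fix a assume "a \<in> ?B"
      then obtain i j where "a = {vv i, vv j}" "i \<in> {1..q}" "j \<in> {1..q}"
        "table es i j = Some (True, t)" by auto
      moreover from this(4) have "lie_bracket (lie_of (pres_of q S es)) (vv i) (vv j) = unit_vec t"
        unfolding lie_bracket_pres_vv[OF assms] opt_signed_unit_vec .
      ultimately show "a \<in> ?A" by blast
    qed
  qed
  have "inj_on (\<lambda>(i, j). {vv i, vv j}) (set ?P)"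
  proof (rule inj_onI, clarify)
    fix i j k l
    assume mem: "(i, j) \<in> set ?P" "(k, l) \<in> set ?P" and "{vv i, vv j} = {vv k, vv l}"
    then have "i = k \<and> j = l \<or> i = l \<and> j = k"
      by (simp add: doubleton_eq_iff vv_unit_vec)
    moreover have "\<not> (i = l \<and> j = k)"
    proof
      assume "i = l \<and> j = k"
      with mem have "table es i j = Some (True, t)" "table es j i = Some (True, t)" by auto
      with table_swap[OF assms, of j i] show False by simp
    qed
    ultimately show "i = k \<and> j = l" by blast
  qed
  then have "card ?B = card (set ?P)"
    by (rule card_image)
  also have "\<dots> = length ?P"
    by (intro distinct_card distinct_filter distinct_product) simp_all
  finally show ?thesis using eq by simp
qed

lemma card_neighbours_table:
  assumes "skew_list es"
  shows "card {x \<in> vv ` {1..q}. lie_bracket (lie_of (pres_of q S es)) x (vv j) \<noteq> 0}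
       = length (filter (\<lambda>i. table es i j \<noteq> None) [1..<Suc q])"
proof -
  let ?P = "filter (\<lambda>i. table es i j \<noteq> None) [1..<Suc q]"
  have "lie_bracket (lie_of (pres_of q S es)) (vv i) (vv j) \<noteq> 0 \<longleftrightarrow> table es i j \<noteq> None" for i
    unfolding lie_bracket_pres_vv[OF assms] opt_signed_unit_vec_0 ..
  then have "{x \<in> vv ` {1..q}. lie_bracket (lie_of (pres_of q S es)) x (vv j) \<noteq> 0}
      = vv ` {i \<in> {1..q}. table es i j \<noteq> None}"
    by blast
  also have "{i \<in> {1..q}. table es i j \<noteq> None} = set ?P"
    unfolding set_filter set_upt atLeastLessThanSuc_atLeastAtMost ..
  finally have "{x \<in> vv ` {1..q}. lie_bracket (lie_of (pres_of q S es)) x (vv j) \<noteq> 0} = vv ` set ?P" .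
  moreover have "card (vv ` set ?P) = card (set ?P)"
    by (intro card_image inj_onI) (simp add: vv_unit_vec)
  moreover have "card (set ?P) = length ?P"
    by (intro distinct_card distinct_filter) simp
  ultimately show ?thesis by simp
qed

lemma displays_pres:
  assumes chk: "uniform_check q S es r s" and p: "p = length S"
    and pos: "p > 0" "q > 0" "r > 0" "s > 0"
  shows "displays_type (pres_of q S es) (p, q, r)"
proof -
  let ?P = "pres_of q S es"
  let ?L = "lie_of ?P"
  let ?V = "vv ` {1..q}" and ?Z = "unit_vec ` set S"
  have proper: "proper_pres S es" using chk by (simp add: uniform_check_def Let_def)
  have skew: "skew_list es" and dist: "distinct S" and noVS: "\<And>s. s \<in> set S \<Longrightarrow> \<not> is_VS s"
    using proper by (auto simp: proper_pres_def list_all_iff)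
  note br = lie_bracket_pres_vv[OF skew, of q S]
  have V: "?V = unit_vec ` (VS ` {1..q})" by (auto simp: vv_unit_vec image_image)
  have central: "lie_bracket ?L x z = 0" if "z \<in> ?Z" for x z
    using lookup_span_central[OF proper span_base[OF that]] by (intro lie_bracket_pres_eq_0) blast
  have table_cases: "opt_signed unit_vec (table es i j) \<in> {0} \<union> ?Z \<union> uminus ` ?Z" for i j
  proof (cases "table es i j")
    case (Some w)
    then show ?thesis using table_in_symbols[OF proper Some] by (cases w) auto
  qed simp
  have i: "lie_bracket ?L x c = 0" if "x \<in> ?V \<union> ?Z" "c \<in> ?Z" for x c
    using central that by blast
  have i': "lie_bracket ?L x y \<in> {0} \<union> ?Z \<union> uminus ` ?Z" if "x \<in> ?V" "y \<in> ?V" for x y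
  proof -
    from that obtain i j where x: "x = vv i" and y: "y = vv j" by (elim imageE)
    show ?thesis unfolding x y br by (rule table_cases[of i j])
  qed
  have ii: "y = y'" if "x \<in> ?V" "y \<in> ?V" "y' \<in> ?V" and n0: "lie_bracket ?L x y \<noteq> 0"
    and par: "lie_bracket ?L x y = lie_bracket ?L x y' \<or> lie_bracket ?L x y = - lie_bracket ?L x y'"
    for x y y'
  proof -
    from that(1-3) obtain i j j' where x: "x = vv i" and y: "y = vv j" and y': "y' = vv j'"
      and ij: "i \<in> {1..q}" "j \<in> {1..q}" "j' \<in> {1..q}" by (elim imageE)
    have "i \<in> set [1..<Suc q]" "j \<in> set [1..<Suc q]" "j' \<in> set [1..<Suc q]"
      using ij unfolding set_upt atLeastLessThanSuc_atLeastAtMost .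
    then have "j = j' \<or> table es i j = None \<or> table es i j' = None \<or>
        snd (the (table es i j)) \<noteq> snd (the (table es i j'))"
      using chk unfolding uniform_check_def Let_def list_all_iff by (elim conjE) (drule (1) bspec)+
    then show ?thesis
      using opt_signed_unit_vec_parallel[OF par[unfolded x y y' br] n0[unfolded x y br]] y y' by metis
  qed
  have iii: "card {{x, y} | x y. x \<in> ?V \<and> y \<in> ?V \<and> lie_bracket ?L x y = c} = r" if "c \<in> ?Z" for c
  proof -
    from that obtain t where c: "c = unit_vec t" and t: "t \<in> set S" by (elim imageE)
    show ?thesis
      unfolding c card_pairs_table[OF skew]
      using chk t unfolding uniform_check_def Let_def list_all_iff by blast
  qed
  have iv: "card {x \<in> ?V. lie_bracket ?L x y \<noteq> 0} = s" if "y \<in> ?V" for y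
  proof -
    from that obtain j where y: "y = vv j" and j: "j \<in> {1..q}" by (elim imageE)
    have "j \<in> set [1..<Suc q]"
      using j unfolding set_upt atLeastLessThanSuc_atLeastAtMost .
    then show ?thesis
      unfolding y card_neighbours_table[OF skew]
      using chk unfolding uniform_check_def Let_def list_all_iff by blast
  qed
  have "uniform_basis_deg ?L ?V ?Z r s"
    unfolding uniform_basis_deg_def Let_def
    by (intro conjI ballI impI; (elim conjE)?) (rule i i' ii iii iv; (assumption | erule UnI1 UnI2)+)+
  moreover have "card ?V = q"
    by (subst card_image) (auto intro!: inj_onI simp: vv_unit_vec)
  moreover have "card ?Z = p"
    by (subst card_image) (auto intro!: inj_onI simp: p distinct_card[OF dist])
  moreover have "?V \<inter> ?Z = {}"
    using noVS by (force simp: vv_unit_vec is_VS_def)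
  moreover have "?V \<union> ?Z = unit_vec ` (VS ` {1..q} \<union> set S)"
    by (simp only: V image_Un)
  ultimately have "uniform_basis ?L ?V ?Z p q r"
    unfolding uniform_basis_def lie_space_pres using pos independent_unit_vec by auto
  then show ?thesis
    unfolding displays_type_def using pos nilpotent_pres[OF proper]
    by (simp add: pres_of_def)
qed

definition zs :: "nat \<Rightarrow> basis_symbol list" where
  "zs n = map ZS [1..<Suc n]"

lemma zz_image: "zz ` {1..n} = unit_vec ` set (zs n)"
  unfolding zs_def set_map set_upt atLeastLessThanSuc_atLeastAtMost image_image zz_def ..

definition free_symbols :: "nat \<Rightarrow> basis_symbol list" where
  "free_symbols q = [ZZS i j. i \<leftarrow> [1..<q+1], j \<leftarrow> [i+1..<q+1]]"

definition free_brackets :: "nat \<Rightarrow> bracket_list" where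
  "free_brackets q = [((i, j), (True, ZZS i j)). i \<leftarrow> [1..<q+1], j \<leftarrow> [i+1..<q+1]]"

lemma free_pres_eq: "free_pres q = pres_of q (free_symbols q) (free_brackets q)"
proof -
  have "set (free_symbols q) = {ZZS i j | i j. 1 \<le> i \<and> i < j \<and> j \<le> q}"
  proof -
    have "set (free_symbols q) = (\<Union>i\<in>{1..<q+1}. ZZS i ` {i+1..<q+1})"
      by (simp add: free_symbols_def del: upt_Suc)
    moreover have "ZZS i j \<in> (\<Union>i\<in>{1..<q+1}. ZZS i ` {i+1..<q+1})"
      if "1 \<le> i" "i < j" "j \<le> q" for i j
      using that by (intro UN_I[of i] imageI) auto
    ultimately show ?thesis by auto
  qed
  then have "{zz2 i j | i j. 1 \<le> i \<and> i < j \<and> j \<le> q} = unit_vec ` set (free_symbols q)"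
    by (auto simp: zz2_def)
  moreover have "[((i, j), zz2 i j). i \<leftarrow> [1..<q+1], j \<leftarrow> [i+1..<q+1]]
      = map (\<lambda>(e, w). (e, signed unit_vec w)) (free_brackets q)"
    by (simp add: free_brackets_def zz2_def map_concat comp_def del: upt_Suc)
  ultimately show ?thesis
    unfolding free_pres_def pres_of_def by (simp only:)
qed

abbreviation pos_bracket :: "nat \<Rightarrow> nat \<Rightarrow> nat \<Rightarrow> (nat \<times> nat) \<times> signed_symbol" where
  "pos_bracket i j l \<equiv> ((i, j), (True, ZS l))"

abbreviation neg_bracket :: "nat \<Rightarrow> nat \<Rightarrow> nat \<Rightarrow> (nat \<times> nat) \<times> signed_symbol" where
  "neg_bracket i j l \<equiv> ((i, j), (False, ZS l))"

lemma listed_pres_eq: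
  "listed_pres 1 = pres_of 2 (zs 1) [pos_bracket 1 2 1]"
  "listed_pres 2 = pres_of 4 (zs 1) [pos_bracket 1 2 1, pos_bracket 3 4 1]"
  "listed_pres 3 = pres_of 4 (zs 2) [pos_bracket 1 2 1, pos_bracket 3 4 2]"
  "listed_pres 4 = pres_of 3 (free_symbols 3) (free_brackets 3)"
  "listed_pres 5 = pres_of 4 (zs 4) [pos_bracket 1 2 1, pos_bracket 2 3 2, pos_bracket 3 4 3, pos_bracket 4 1 4]"
  "listed_pres 6 = pres_of 4 (zs 2) [pos_bracket 1 2 1, pos_bracket 3 4 1, pos_bracket 2 3 2, pos_bracket 1 4 2]"
  "listed_pres 7 = pres_of 5 (zs 5) [pos_bracket 1 2 1, pos_bracket 2 3 2, pos_bracket 3 4 3, pos_bracket 4 5 4,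
     pos_bracket 5 1 5]"
  "listed_pres 8 = pres_of 4 (zs 3) [pos_bracket 1 2 1, pos_bracket 3 4 1, pos_bracket 1 3 2, neg_bracket 2 4 2,
     pos_bracket 1 4 3, pos_bracket 2 3 3]"
  "listed_pres 9 = pres_of 4 (zs 3) [pos_bracket 1 2 1, pos_bracket 3 4 1, pos_bracket 1 3 2, pos_bracket 2 4 2,
     pos_bracket 1 4 3, neg_bracket 2 3 3]"
  "listed_pres 10 = pres_of 4 (free_symbols 4) (free_brackets 4)"
  "listed_pres 11 = pres_of 5 (zs 5) [pos_bracket 1 5 1, pos_bracket 2 4 1, pos_bracket 2 5 2, pos_bracket 3 4 2,
     pos_bracket 1 3 3, pos_bracket 4 5 3, pos_bracket 3 5 4, pos_bracket 1 2 4, pos_bracket 1 4 5, pos_bracket 2 3 5]"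
  "listed_pres 12 = pres_of 5 (free_symbols 5) (free_brackets 5)"
  "alt_pres_3 = pres_of 4 (zs 2) [pos_bracket 1 3 1, pos_bracket 2 4 1, pos_bracket 1 4 2, pos_bracket 2 3 2]"
  by (simp_all only: listed_pres_def listed_algebras_def alt_pres_3_def zz_image free_pres_eq)
     (simp_all add: pres_of_def zz_def)

lemma displays_listed:
  assumes "k \<in> {1..12}"
  shows "displays_type (listed_pres k) (listed_type k)"
proof -
  have "k \<in> {1, 2, 3, 4, 5, 6, 7, 8, 9, 10, 11, 12}"
    using assms unfolding atLeastAtMost_iff insert_iff empty_iff by presburger
  then show ?thesis
    unfolding insert_iff empty_iff
  proof (elim disjE FalseE; hypsubst)
    show "displays_type (listed_pres 1) (listed_type 1)"
      unfolding listed_pres_eq by (simp add: listed_type_def listed_algebras_def, rule displays_pres[where s = 1]; code_simp)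
    show "displays_type (listed_pres 2) (listed_type 2)"
      unfolding listed_pres_eq by (simp add: listed_type_def listed_algebras_def, rule displays_pres[where s = 1]; code_simp)
    show "displays_type (listed_pres 3) (listed_type 3)"
      unfolding listed_pres_eq by (simp add: listed_type_def listed_algebras_def, rule displays_pres[where s = 1]; code_simp)
    show "displays_type (listed_pres 4) (listed_type 4)"
      unfolding listed_pres_eq by (simp add: listed_type_def listed_algebras_def, rule displays_pres[where s = 2]; code_simp)
    show "displays_type (listed_pres 5) (listed_type 5)"
      unfolding listed_pres_eq by (simp add: listed_type_def listed_algebras_def, rule displays_pres[where s = 2]; code_simp)
    show "displays_type (listed_pres 6) (listed_type 6)"
      unfolding listed_pres_eq by (simp add: listed_type_def listed_algebras_def, rule displays_pres[where s = 2]; code_simp)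
    show "displays_type (listed_pres 7) (listed_type 7)"
      unfolding listed_pres_eq by (simp add: listed_type_def listed_algebras_def, rule displays_pres[where s = 2]; code_simp)
    show "displays_type (listed_pres 8) (listed_type 8)"
      unfolding listed_pres_eq by (simp add: listed_type_def listed_algebras_def, rule displays_pres[where s = 3]; code_simp)
    show "displays_type (listed_pres 9) (listed_type 9)"
      unfolding listed_pres_eq by (simp add: listed_type_def listed_algebras_def, rule displays_pres[where s = 3]; code_simp)
    show "displays_type (listed_pres 10) (listed_type 10)"
      unfolding listed_pres_eq by (simp add: listed_type_def listed_algebras_def, rule displays_pres[where s = 3]; code_simp)
    show "displays_type (listed_pres 11) (listed_type 11)"
      unfolding listed_pres_eq by (simp add: listed_type_def listed_algebras_def, rule displays_pres[where s = 4]; code_simp)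
    show "displays_type (listed_pres 12) (listed_type 12)"
      unfolding listed_pres_eq by (simp add: listed_type_def listed_algebras_def, rule displays_pres[where s = 4]; code_simp)
  qed
qed

lemma displays_alt: "displays_type alt_pres_3 (2, 4, 2)"
  unfolding listed_pres_eq by (rule displays_pres[where s = 2]; code_simp)

section \<open>Uniform bases\<close>

text \<open>A maximal independent subset of \<open>B\<close> has \<open>dim B\<close> elements; if
  this is already as many as \<open>B\<close> has, the subset is all of \<open>B\<close>.\<close>

lemma independent_if_card_le_dim:
  fixes B :: "'a::real_vector set"
  assumes fin: "finite B" and card: "card B \<le> dim B"
  shows "independent B"
proof -
  obtain C where C: "C \<subseteq> B" "independent C" "B \<subseteq> span C"
    using maximal_independent_subset[of B] by blast
  have "dim B = card C"
    by (rule dim_eq_card[OF _ C(2)]) (metis C(1,3) span_mono span_span subset_antisym)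
  then have "C = B"
    using card C(1) fin by (intro card_subset_eq) (auto intro: le_antisym card_mono)
  with C(2) show ?thesis by simp
qed

lemma lie_bracket_linear:
  assumes L: "lie_algebra L" and x: "x \<in> lie_space L"
  obtains g where "linear g" "\<And>y. y \<in> lie_space L \<Longrightarrow> g y = lie_bracket L x y"
  using additive_on_extend_linear[of "lie_space L" "lie_bracket L x"]
    lie_algebraD(1)[OF L] lie_algebraD(5)[OF L _ _ x] lie_algebraD(7)[OF L x]
  by metis

locale uniform_algebra =
  fixes L :: "('a::real_vector) lie" and V Z :: "'a set" and p q r s :: nat
  assumes lie: "lie_algebra L"
    and pos: "p > 0" "q > 0" "r > 0" "s > 0"
    and finite_V: "finite V" and card_V: "card V = q"
    and finite_Z: "finite Z" and card_Z: "card Z = p"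
    and disjoint: "V \<inter> Z = {}"
    and indep: "independent (V \<union> Z)" and span_VZ: "span (V \<union> Z) = lie_space L"
    and deg: "uniform_basis_deg L V Z r s"
begin

abbreviation br :: "'a \<Rightarrow> 'a \<Rightarrow> 'a" where "br \<equiv> lie_bracket L"

lemma V_space: "x \<in> V \<Longrightarrow> x \<in> lie_space L" and Z_space: "z \<in> Z \<Longrightarrow> z \<in> lie_space L"
  unfolding span_VZ[symmetric] by (simp_all add: span_base)

lemma br_VZ: "x \<in> V \<Longrightarrow> z \<in> Z \<Longrightarrow> br x z = 0"
  and br_ZZ: "z \<in> Z \<Longrightarrow> z' \<in> Z \<Longrightarrow> br z z' = 0"
  and br_VV: "x \<in> V \<Longrightarrow> y \<in> V \<Longrightarrow> br x y \<in> {0} \<union> Z \<union> uminus ` Z"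
  and br_unique: "x \<in> V \<Longrightarrow> y \<in> V \<Longrightarrow> y' \<in> V \<Longrightarrow> br x y \<noteq> 0 \<Longrightarrow>
      br x y = br x y' \<or> br x y = - br x y' \<Longrightarrow> y = y'"
  and card_colour_class: "z \<in> Z \<Longrightarrow> card {{x, y} | x y. x \<in> V \<and> y \<in> V \<and> br x y = z} = r"
  and card_neighbours: "y \<in> V \<Longrightarrow> card {x \<in> V. br x y \<noteq> 0} = s"
proof -
  note D = deg[unfolded uniform_basis_deg_def Let_def]
  note D1 = D[THEN conjunct1] and D2 = D[THEN conjunct2]
  show "x \<in> V \<Longrightarrow> z \<in> Z \<Longrightarrow> br x z = 0" using D1[THEN conjunct1] by simp
  show "z \<in> Z \<Longrightarrow> z' \<in> Z \<Longrightarrow> br z z' = 0" using D1[THEN conjunct2, THEN conjunct1] by simp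
  show "x \<in> V \<Longrightarrow> y \<in> V \<Longrightarrow> br x y \<in> {0} \<union> Z \<union> uminus ` Z"
    by (rule D1[THEN conjunct2, THEN conjunct2, rule_format])
  show "x \<in> V \<Longrightarrow> y \<in> V \<Longrightarrow> y' \<in> V \<Longrightarrow> br x y \<noteq> 0 \<Longrightarrow>
      br x y = br x y' \<or> br x y = - br x y' \<Longrightarrow> y = y'"
    by (rule D2[THEN conjunct1, rule_format]) simp_all
  show "z \<in> Z \<Longrightarrow> card {{x, y} | x y. x \<in> V \<and> y \<in> V \<and> br x y = z} = r"
    by (rule D2[THEN conjunct2, THEN conjunct1, rule_format])
  show "y \<in> V \<Longrightarrow> card {x \<in> V. br x y \<noteq> 0} = s"
    by (rule D2[THEN conjunct2, THEN conjunct2, rule_format])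
qed

section \<open>The coloured graph of the generators\<close>

lemma br_skew: "x \<in> V \<Longrightarrow> y \<in> V \<Longrightarrow> br y x = - br x y"
  by (rule lie_bracket_skew[OF lie V_space V_space])

lemma br_self: "x \<in> V \<Longrightarrow> br x x = 0"
  by (simp add: lie_algebraD(8)[OF lie] V_space)

lemma Z_nonzero: "z \<in> Z \<Longrightarrow> z \<noteq> 0"
  using indep dependent_zero by blast

text \<open>Separates each colour from the negatives of all colours, its own included. The classes
  of directed edges for \<open>z\<close> and \<open>- z\<close> are therefore disjoint, and a colour
  with its sign can be read off from a bracket.\<close>

lemma Z_neq_minus: "z \<in> Z \<Longrightarrow> z' \<in> Z \<Longrightarrow> z \<noteq> - z'"
proof
  assume z: "z \<in> Z" "z' \<in> Z" "z = - z'"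
  show False
  proof (cases "z = z'")
    case True
    with z have "2 *\<^sub>R z = 0" by (simp add: scaleR_2 eq_neg_iff_add_eq_0)
    with Z_nonzero[OF z(1)] show False by simp
  next
    case False
    have "z \<in> span {z'}" unfolding z(3) by (simp add: span_neg span_base)
    moreover have "span {z'} \<subseteq> span (V \<union> Z - {z})" using False z(2) by (intro span_mono) auto
    ultimately have "dependent (V \<union> Z)" using z(1) unfolding dependent_def by blast
    with indep show False by simp
  qed
qed

text \<open>Directed edges: an edge of colour \<open>z\<close> up to sign occurs once in the class
  of \<open>z\<close> and, reversed, once in the class of \<open>- z\<close>.\<close>

definition ordered_class :: "'a \<Rightarrow> ('a \<times> 'a) set" where
  "ordered_class z = {(x, y). x \<in> V \<and> y \<in> V \<and> br x y = z}"

lemma finite_ordered_class: "finite (ordered_class z)"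
  by (rule finite_subset[of _ "V \<times> V"]) (auto simp: ordered_class_def finite_V)

lemma card_ordered_class:
  assumes z: "z \<in> Z"
  shows "card (ordered_class z) = r" "card (ordered_class (- z)) = r"
proof -
  have "inj_on (\<lambda>(x, y). {x, y}) (ordered_class z)"
  proof (rule inj_onI, clarify)
    fix x y x' y' assume xy: "(x, y) \<in> ordered_class z" "(x', y') \<in> ordered_class z" and "{x, y} = {x', y'}"
    then have "x = x' \<and> y = y' \<or> x = y' \<and> y = x'" by (simp add: doubleton_eq_iff)
    moreover have "\<not> (x = y' \<and> y = x')"
    proof
      assume "x = y' \<and> y = x'"
      with xy have "x \<in> V" "y \<in> V" "br x y = z" "br y x = z" by (auto simp: ordered_class_def)
      then have "z = - z" using br_skew by metis
      with Z_neq_minus[OF z z] show False by simp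
    qed
    ultimately show "x = x' \<and> y = y'" by blast
  qed
  then have "card ((\<lambda>(x, y). {x, y}) ` ordered_class z) = card (ordered_class z)"
    by (rule card_image)
  moreover have "(\<lambda>(x, y). {x, y}) ` ordered_class z = {{x, y} | x y. x \<in> V \<and> y \<in> V \<and> br x y = z}"
    by (auto simp: ordered_class_def image_def)
  ultimately show 1: "card (ordered_class z) = r"
    using card_colour_class[OF z] by simp
  have "ordered_class (- z) = prod.swap ` ordered_class z"
  proof
    show "ordered_class (- z) \<subseteq> prod.swap ` ordered_class z"
    proof
      fix e assume e: "e \<in> ordered_class (- z)"
      then have "prod.swap e \<in> ordered_class z"
        using br_skew[of "fst e" "snd e"] by (auto simp: ordered_class_def)
      then show "e \<in> prod.swap ` ordered_class z" by (metis image_eqI swap_swap)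
    qed
    show "prod.swap ` ordered_class z \<subseteq> ordered_class (- z)"
    proof (rule image_subsetI)
      fix e assume "e \<in> ordered_class z"
      then show "prod.swap e \<in> ordered_class (- z)"
        using br_skew[of "fst e" "snd e"] by (auto simp: ordered_class_def)
    qed
  qed
  then show "card (ordered_class (- z)) = r"
    using 1 by (simp add: card_image)
qed

lemma card_signed_class:
  assumes z: "z \<in> Z"
  shows "card (ordered_class z \<union> ordered_class (- z)) = 2 * r"
proof -
  have "ordered_class z \<inter> ordered_class (- z) = {}"
    using Z_neq_minus[OF z z] by (auto simp: ordered_class_def)
  then show ?thesis
    by (simp add: card_Un_disjoint finite_ordered_class card_ordered_class[OF z])
qed

text \<open>Double counting of ordered pairs with nonzero bracket. Sorted by an endpoint there are
  \<open>s\<close> for each of the \<open>q\<close> generators; sorted by colour there are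
  \<open>2 * r\<close> for each of the \<open>p\<close> colours.\<close>

lemma handshake: "q * s = 2 * p * r"
proof -
  let ?A = "{(y, x). y \<in> V \<and> x \<in> V \<and> br x y \<noteq> 0}"
  let ?B = "\<Union>z\<in>Z. ordered_class z \<union> ordered_class (- z)"
  have "?A = (SIGMA y:V. {x \<in> V. br x y \<noteq> 0})" by auto
  then have "card ?A = (\<Sum>y\<in>V. card {x \<in> V. br x y \<noteq> 0})"
    using finite_V by simp
  also have "\<dots> = q * s" by (simp add: card_neighbours card_V)
  finally have A: "card ?A = q * s" .
  have "?B \<subseteq> prod.swap ` ?A"
    using Z_nonzero by (force simp: ordered_class_def)
  moreover have "prod.swap ` ?A \<subseteq> ?B"
  proof
    fix e assume "e \<in> prod.swap ` ?A"
    then obtain x y where e: "e = (x, y)" "x \<in> V" "y \<in> V" "br x y \<noteq> 0" by auto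
    from br_VV[OF e(2,3)] e(4) obtain z where "z \<in> Z" "br x y = z \<or> br x y = - z" by auto
    then show "e \<in> ?B" using e by (auto simp: ordered_class_def)
  qed
  ultimately have "card ?B = card (prod.swap ` ?A)" by (intro arg_cong[where f = card] subset_antisym)
  also have "\<dots> = q * s" using A by (subst card_image) auto
  finally have "card ?B = q * s" .
  moreover have "card ?B = (\<Sum>z\<in>Z. card (ordered_class z \<union> ordered_class (- z)))"
  proof (rule card_UN_disjoint[OF finite_Z])
    show "\<forall>z\<in>Z. finite (ordered_class z \<union> ordered_class (- z))"
      by (simp add: finite_ordered_class)
    show "\<forall>z\<in>Z. \<forall>z'\<in>Z. z \<noteq> z' \<longrightarrow>
        (ordered_class z \<union> ordered_class (- z)) \<inter> (ordered_class z' \<union> ordered_class (- z')) = {}"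
    proof (intro ballI impI equals0I)
      fix z z' e assume z: "z \<in> Z" "z' \<in> Z" "z \<noteq> z'"
        and "e \<in> (ordered_class z \<union> ordered_class (- z)) \<inter> (ordered_class z' \<union> ordered_class (- z'))"
      then have "z = z' \<or> z = - z' \<or> - z = z' \<or> - z = - z'"
        by (auto simp: ordered_class_def)
      with z Z_neq_minus[OF z(1,2)] Z_neq_minus[OF z(2,1)] show False by auto
    qed
  qed
  ultimately show ?thesis by (simp add: card_signed_class card_Z)
qed

text \<open>Edges of one colour never share a vertex, so the \<open>2 * r\<close> directed edges of
  that colour have distinct starting points in \<open>V\<close>.\<close>

lemma colour_class_matching: "2 * r \<le> q"
proof -
  obtain z where z: "z \<in> Z" using pos(1) card_Z by fastforce
  let ?C = "ordered_class z \<union> ordered_class (- z)"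
  have "inj_on fst ?C"
  proof (rule inj_onI)
    fix e e' assume e: "e \<in> ?C" "e' \<in> ?C" "fst e = fst e'"
    obtain x y x' y' where xy: "e = (x, y)" "e' = (x', y')" by (metis surj_pair)
    have *: "x \<in> V" "y \<in> V" "y' \<in> V" "x' = x" "br x y = z \<or> br x y = - z" "br x y' = z \<or> br x y' = - z"
      using e unfolding xy by (auto simp: ordered_class_def)
    have "br x y \<noteq> 0" using *(5) Z_nonzero[OF z] by auto
    moreover have "br x y = br x y' \<or> br x y = - br x y'" using *(5,6) by auto
    ultimately have "y = y'" using br_unique *(1-3) by blast
    then show "e = e'" using xy * by simp
  qed
  then have "card (fst ` ?C) = 2 * r"
    using card_signed_class[OF z] by (simp add: card_image)
  moreover have "fst ` ?C \<subseteq> V" by (auto simp: ordered_class_def)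
  ultimately show ?thesis using card_mono[OF finite_V] card_V by metis
qed

lemma degree_less: "s < q"
proof -
  obtain y where y: "y \<in> V" using pos(2) card_V by fastforce
  have "{x \<in> V. br x y \<noteq> 0} \<subset> V" using y br_self by blast
  then show ?thesis using psubset_card_mono[OF finite_V] card_neighbours[OF y] card_V by metis
qed

lemma Z_is_bracket:
  assumes z: "z \<in> Z"
  obtains x y where "x \<in> V" "y \<in> V" "br x y = z"
proof -
  have "ordered_class z \<noteq> {}" using card_ordered_class(1)[OF z] pos(3) by auto
  then show thesis using that by (auto simp: ordered_class_def)
qed

section \<open>Brackets of spans, the derived algebra and dimensions\<close>

lemma br_VZ_VZ: "x \<in> V \<union> Z \<Longrightarrow> y \<in> V \<union> Z \<Longrightarrow> br x y \<in> span Z"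
proof -
  assume xy: "x \<in> V \<union> Z" "y \<in> V \<union> Z"
  have ZV: "br z v = 0" if "z \<in> Z" "v \<in> V" for z v
    using lie_bracket_skew[OF lie V_space[OF that(2)] Z_space[OF that(1)]] br_VZ[OF that(2,1)] by simp
  show "br x y \<in> span Z"
  proof (cases "x \<in> V \<and> y \<in> V")
    case True
    then show ?thesis using br_VV[of x y] by (auto simp: span_zero span_neg span_base)
  next
    case False
    then have "br x y = 0" using xy br_VZ br_ZZ ZV by blast
    then show ?thesis by (simp add: span_zero)
  qed
qed

text \<open>Bilinear extension in two rounds. Linearity is available in the second argument of the
  bracket, so the first argument is treated by swapping the two at the cost of a sign, which a
  subspace absorbs.\<close>

lemma br_in_span:
  assumes XY: "X \<subseteq> lie_space L" "Y \<subseteq> lie_space L" and T: "subspace T"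
    and br: "\<And>x y. x \<in> X \<Longrightarrow> y \<in> Y \<Longrightarrow> br x y \<in> T"
    and xy: "x \<in> span X" "y \<in> span Y"
  shows "br x y \<in> T"
proof -
  note S = lie_algebraD(1)[OF lie]
  have sX: "span X \<subseteq> lie_space L" and sY: "span Y \<subseteq> lie_space L"
    using XY span_minimal[OF _ S] by blast+
  have 1: "br v y \<in> T" if v: "v \<in> X" for v
  proof -
    have vS: "v \<in> lie_space L" using v XY by blast
    obtain g where g: "linear g" "\<And>y. y \<in> lie_space L \<Longrightarrow> g y = br v y"
      using lie_bracket_linear[OF lie vS] by metis
    have "subspace {y. g y \<in> T}" by (rule linear_subspace_vimage[OF g(1) T, unfolded vimage_def])
    moreover have "Y \<subseteq> {y. g y \<in> T}" using br v XY(2) g(2) by auto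
    ultimately have "span Y \<subseteq> {y. g y \<in> T}" by (intro span_minimal)
    then show ?thesis using g(2) sY xy(2) by force
  qed
  have yS: "y \<in> lie_space L" using sY xy(2) by blast
  obtain g where g: "linear g" "\<And>x. x \<in> lie_space L \<Longrightarrow> g x = br y x"
    using lie_bracket_linear[OF lie yS] by metis
  have gv: "g v = - br v y" if "v \<in> lie_space L" for v
    using lie_bracket_skew[OF lie that yS] g(2)[OF that] by simp
  have "subspace {x. g x \<in> T}" by (rule linear_subspace_vimage[OF g(1) T, unfolded vimage_def])
  moreover have "X \<subseteq> {x. g x \<in> T}" using 1 gv XY(1) T by (auto simp: subspace_neg)
  ultimately have "span X \<subseteq> {x. g x \<in> T}" by (intro span_minimal)
  then have "- br x y \<in> T" using gv sX xy(1) by force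
  then show ?thesis using subspace_neg[OF T] by fastforce
qed

lemma br_central:
  assumes "x \<in> lie_space L" and "z \<in> span Z"
  shows "br x z = 0"
proof -
  have "br v c \<in> {0}" if "v \<in> V \<union> Z" "c \<in> Z" for v c
    using that(1) br_VZ[OF _ that(2)] br_ZZ[OF _ that(2)] by auto
  then have "br x z \<in> {0}"
  proof (rule br_in_span[where X = "V \<union> Z" and Y = Z, rotated 3])
    show "x \<in> span (V \<union> Z)" "z \<in> span Z" using assms span_VZ by simp_all
  qed (use V_space Z_space in auto)
  then show ?thesis by simp
qed

lemma derived_subset: "derived L \<subseteq> span Z"
proof -
  have "V \<union> Z \<subseteq> lie_space L" using V_space Z_space by blast
  then have "br x y \<in> span Z" if "x \<in> lie_space L" "y \<in> lie_space L" for x y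
    using br_in_span[of "V \<union> Z" "V \<union> Z" "span Z" x y] br_VZ_VZ that by (simp add: span_VZ)
  then show ?thesis by (auto simp: derived_def)
qed

lemma dim_space: "dim (lie_space L) = p + q"
proof -
  have "dim (lie_space L) = card (V \<union> Z)"
    using dim_span_eq_card_independent[OF indep] by (simp only: span_VZ)
  also have "\<dots> = p + q"
    by (simp add: card_Un_disjoint finite_V finite_Z disjoint card_V card_Z)
  finally show ?thesis .
qed

text \<open>Since r > 0, every central basis vector occurs as a bracket, so the derived algebra
  spans exactly \<open>span Z\<close>.\<close>

lemma dim_derived: "dim (derived L) = p"
proof -
  have "Z \<subseteq> derived L"
    unfolding derived_def using Z_is_bracket V_space by blast
  then have "span (derived L) = span Z"
    using derived_subset by (metis span_mono span_span subset_antisym)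
  moreover have "independent Z" using indep by (rule independent_mono) simp
  ultimately show ?thesis
    using dim_eq_card[of Z "derived L"] card_Z by simp
qed

text \<open>Recognition principle for presentations. The generators may be replaced by any
  \<open>a i\<close> spanning the same space, which admits sign changes as well as mixtures of
  generators. The \<open>c t\<close> are asked only to lie in \<open>span Z\<close>: that they span
  it follows from surjectivity.\<close>

lemma lie_isomorphic_pres:
  assumes proper: "proper_pres S es" and S: "length S = p"
    and a: "\<And>i. i \<in> {1..q} \<Longrightarrow> a i \<in> span V" and Va: "V \<subseteq> span (a ` {1..q})"
    and c: "\<And>t. t \<in> set S \<Longrightarrow> c t \<in> span Z"
    and tab: "\<And>i j. 1 \<le> i \<Longrightarrow> i < j \<Longrightarrow> j \<le> q \<Longrightarrow> br (a i) (a j) = opt_signed c (table es i j)"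
  shows "lie_isomorphic L (lie_of (pres_of q S es))"
proof -
  let ?P = "lie_of (pres_of q S es)"
  let ?B = "unit_vec ` (VS ` {1..q} \<union> set S)"
  note sub = lie_algebraD(1)[OF lie]
  have skew: "skew_list es" and dist: "distinct S" and noVS: "\<And>s. s \<in> set S \<Longrightarrow> \<not> is_VS s"
    using proper by (auto simp: proper_pres_def list_all_iff)
  have aS: "a i \<in> lie_space L" if "i \<in> {1..q}" for i
    using a[OF that] span_mono[of V "V \<union> Z"] by (auto simp: span_VZ)
  have cS: "c t \<in> lie_space L" if "t \<in> set S" for t
    using c[OF that] span_mono[of Z "V \<union> Z"] by (auto simp: span_VZ)
  \<comment> \<open>Reading coordinates makes \<open>G\<close> linear on all symbol vectors, inside
    the carrier of the presentation and outside it.\<close>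
  define G where "G f = (\<Sum>i\<in>{1..q}. Poly_Mapping.lookup f (VS i) *\<^sub>R a i)
      + (\<Sum>t\<in>set S. Poly_Mapping.lookup f t *\<^sub>R c t)" for f :: symbol_vec
  have G: "linear G"
    by (rule linearI) (simp_all add: G_def lookup_add algebra_simps sum.distrib scaleR_sum_right)
  have GS: "G f \<in> lie_space L" for f
    unfolding G_def using sub aS cS
    by (intro subspace_add subspace_sum subspace_scale) auto
  have Ga: "G (unit_vec (VS i)) = a i" if i: "i \<in> {1..q}" for i
  proof -
    have "(\<Sum>j\<in>{1..q}. Poly_Mapping.lookup (unit_vec (VS i)) (VS j) *\<^sub>R a j)
        = (\<Sum>j\<in>{1..q}. if i = j then a j else 0)"
      by (intro sum.cong) (auto simp: lookup_single)
    moreover have "Poly_Mapping.lookup (unit_vec (VS i)) t = 0" if "t \<in> set S" for t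
      using noVS[OF that] by (auto simp: lookup_single when_def is_VS_def)
    ultimately show ?thesis using i by (simp add: G_def)
  qed
  have Gc: "G (unit_vec t) = c t" if t: "t \<in> set S" for t
  proof -
    have "(\<Sum>u\<in>set S. Poly_Mapping.lookup (unit_vec t) u *\<^sub>R c u) = (\<Sum>u\<in>set S. if t = u then c u else 0)"
      by (intro sum.cong) (auto simp: lookup_single)
    moreover have "Poly_Mapping.lookup (unit_vec t) (VS i) = 0" for i
      using noVS[OF t] by (auto simp: lookup_single when_def is_VS_def)
    ultimately show ?thesis using t by (simp add: G_def)
  qed
  have Gt: "G (opt_signed unit_vec (table es i j)) = opt_signed c (table es i j)" for i j
  proof (cases "table es i j")
    case (Some w)
    obtain b t where w: "w = (b, t)" by (cases w)
    show ?thesis using table_in_symbols[OF proper Some] Gc[of t] linear_neg[OF G]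
      by (simp add: Some w)
  qed (simp add: linear_0[OF G])
  have tab': "br (a i) (a j) = opt_signed c (table es i j)" if ij: "i \<in> {1..q}" "j \<in> {1..q}" for i j
  proof (cases i j rule: linorder_cases)
    case less
    with ij tab show ?thesis by simp
  next
    case equal
    have "table es i i = None" using table_swap[OF skew, of i i] by (cases "table es i i") auto
    then show ?thesis using equal lie_algebraD(8)[OF lie aS[OF ij(1)]] by simp
  next
    case greater
    have "br (a i) (a j) = - br (a j) (a i)"
      by (rule lie_bracket_skew[OF lie aS[OF ij(2)] aS[OF ij(1)]])
    also have "br (a j) (a i) = opt_signed c (table es j i)"
      using greater ij by (intro tab) simp_all
    also have "- opt_signed c (table es j i) = opt_signed c (table es i j)"
      unfolding table_swap[OF skew, of i j] by (cases "table es j i") simp_all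
    finally show ?thesis .
  qed
  have bil1: "bilinear (\<lambda>f h. G (lie_bracket ?P f h))"
    unfolding bilinear_def
    using linear_compose[OF linear_lie_bracket_pres(1) G] linear_compose[OF linear_lie_bracket_pres(2) G]
    by (simp add: comp_def)
  have bil2: "bilinear (\<lambda>f h. br (G f) (G h))"
    unfolding bilinear_def
    using lie_algebraD(4-7)[OF lie] GS linear_add[OF G] linear_scale[OF G]
    by (intro conjI allI linearI) simp_all
  have basis_eq: "G (lie_bracket ?P f h) = br (G f) (G h)" if fh: "f \<in> ?B" "h \<in> ?B" for f h
  proof -
    have central: "lie_bracket ?P f h = 0" if "f \<in> unit_vec ` set S \<or> h \<in> unit_vec ` set S" for f h
      using that lookup_span_central[OF proper span_base] by (intro lie_bracket_pres_eq_0) blast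
    have Z1: "br x (G (unit_vec t)) = 0" "br (G (unit_vec t)) x = 0"
      if "t \<in> set S" "x \<in> lie_space L" for x t
      using br_central[OF that(2) c[OF that(1)]] lie_bracket_skew[OF lie that(2) cS[OF that(1)]]
        Gc[OF that(1)] by simp_all
    consider i j where "f = unit_vec (VS i)" "h = unit_vec (VS j)" "i \<in> {1..q}" "j \<in> {1..q}"
      | t where "t \<in> set S" "f = unit_vec t" | t where "t \<in> set S" "h = unit_vec t"
      using fh by blast
    then show ?thesis
    proof cases
      case 1
      show ?thesis
        unfolding 1(1,2) Ga[OF 1(3)] Ga[OF 1(4)] tab'[OF 1(3,4)] Gt[symmetric]
        by (simp only: lie_bracket_pres_vv[OF skew, of q S i j, unfolded vv_unit_vec])
    next
      case 2
      then show ?thesis using central[of f h] Z1(2)[OF 2(1) GS] linear_0[OF G] by simp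
    next
      case 3
      then show ?thesis using central[of f h] Z1(1)[OF 3(1) GS] linear_0[OF G] by simp
    qed
  qed
  have hom: "G (lie_bracket ?P f h) = br (G f) (G h)" if "f \<in> span ?B" "h \<in> span ?B" for f h
    by (rule bilinear_eq[OF bil1 bil2 order_refl order_refl that basis_eq])
  have image: "G ` span ?B = lie_space L"
  proof
    show "G ` span ?B \<subseteq> lie_space L" using GS by blast
    have sG: "subspace (G ` span ?B)" by (intro linear_subspace_image[OF G] subspace_span)
    have "a ` {1..q} \<subseteq> G ` span ?B"
      using Ga by (intro image_subsetI) (metis UnI1 imageI image_eqI span_base)
    then have VG: "V \<subseteq> G ` span ?B"
      using Va span_minimal[OF _ sG] by blast
    \<comment> \<open>Each central basis vector is a bracket of generators, and these are already in
      the image; the homomorphism property puts the bracket there too.\<close>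
    moreover have "Z \<subseteq> G ` span ?B"
    proof
      fix z assume "z \<in> Z"
      then obtain x y where xy: "x \<in> V" "y \<in> V" "br x y = z" by (rule Z_is_bracket)
      then obtain f h where fh: "f \<in> span ?B" "h \<in> span ?B" "x = G f" "y = G h" using VG by blast
      have "lie_bracket ?P f h \<in> span ?B"
        using lie_bracket_pres_central[OF proper] span_mono[of "unit_vec ` set S" ?B] by auto
      then show "z \<in> G ` span ?B" using hom[OF fh(1,2)] xy fh by auto
    qed
    ultimately show "lie_space L \<subseteq> G ` span ?B"
      unfolding span_VZ[symmetric] by (intro span_minimal sG) blast
  qed
  have finB: "finite ?B" by simp
  have VS: "VS i \<notin> set S" for i using noVS[of "VS i"] by (auto simp: is_VS_def)
  have "card ?B = card (VS ` {1..q} \<union> set S)" by (intro card_image) (auto intro: inj_onI)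
  also have "\<dots> = card (VS ` {1..q}) + card (set S)"
    using VS by (intro card_Un_disjoint) auto
  also have "card (VS ` {1..q}) = q" by (subst card_image) (auto intro: inj_onI)
  finally have cardB: "card ?B = p + q" using distinct_card[OF dist] S by simp
  have span_GB: "span (G ` ?B) = lie_space L"
    using linear_span_image[OF G] image by simp
  \<comment> \<open>The images of the \<open>p + q\<close> basis vectors span a space of dimension
    \<open>p + q\<close>. Hence they are pairwise distinct and independent, and \<open>G\<close> is
    injective.\<close>
  have "p + q \<le> card (G ` ?B)"
    using dim_le_card[of "lie_space L" "G ` ?B"] span_GB dim_space finB by simp
  then have card_GB: "card (G ` ?B) = card ?B"
    using card_image_le[OF finB, of G] cardB by simp
  then have "inj_on G ?B" using finB by (intro eq_card_imp_inj_on)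
  moreover have "independent (G ` ?B)"
  proof (rule independent_if_card_le_dim)
    show "card (G ` ?B) \<le> dim (G ` ?B)"
      unfolding card_GB cardB dim_span[of "G ` ?B", symmetric] span_GB dim_space ..
  qed simp
  ultimately have "inj_on G (span ?B)"
    using linear_inj_on_span_independent_image[OF G] by blast
  then have "lie_isomorphic ?P L"
    unfolding lie_isomorphic_def lie_space_pres
    using image hom linear_add[OF G] linear_scale[OF G]
    by (intro exI[of _ G]) (simp add: bij_betw_def)
  then show ?thesis
    by (rule lie_isomorphic_sym[OF lie_algebra_pres[OF proper]])
qed

end

section \<open>The listed algebras are pairwise non-isomorphic\<close>

lemma uniform_lie_uniform_algebra:
  assumes "uniform_lie L p q r"
  obtains V Z s where "uniform_algebra L V Z p q r s"
  using assms unfolding uniform_lie_def uniform_basis_def nilpotent_lie_def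
  by (auto intro: that uniform_algebra.intro)

lemma displays_type_uniform_algebra:
  assumes "displays_type P (p, q, r)"
  obtains s where "uniform_algebra (lie_of P) (pres_V P) (pres_Z P) p q r s"
  using assms unfolding displays_type_def uniform_basis_def nilpotent_lie_def
  by (auto intro: that uniform_algebra.intro)

lemma listed_type_eq:
  assumes "k \<in> {1..12}"
  shows "listed_type k = [(1, 2, 1), (1, 4, 2), (2, 4, 1), (3, 3, 1), (4, 4, 1), (2, 4, 2), (5, 5, 1),
     (3, 4, 2), (3, 4, 2), (6, 4, 1), (5, 5, 2), (10, 5, 1)] ! (k - 1)"
proof -
  have "k - 1 < length listed_algebras"
    using assms unfolding atLeastAtMost_iff by (simp add: listed_algebras_def) linarith
  then have "listed_type k = map fst listed_algebras ! (k - 1)"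
    unfolding listed_type_def by (rule nth_map[symmetric])
  then show ?thesis by (simp add: listed_algebras_def)
qed

lemma lie_algebra_listed: "k \<in> {1..12} \<Longrightarrow> lie_algebra (lie_of (listed_pres k))"
  using displays_listed[of k] by (auto simp: displays_type_def nilpotent_lie_def split: prod.splits)

lemma listed_isomorphic_type:
  assumes k: "k \<in> {1..12}" and l: "l \<in> {1..12}"
    and iso: "lie_isomorphic (lie_of (listed_pres k)) (lie_of (listed_pres l))"
  shows "fst (listed_type k) = fst (listed_type l)" "fst (snd (listed_type k)) = fst (snd (listed_type l))"
proof -
  obtain p q r p' q' r' where t: "listed_type k = (p, q, r)" "listed_type l = (p', q', r')"
    by (metis surj_pair)
  obtain s s' where
      K: "uniform_algebra (lie_of (listed_pres k)) (pres_V (listed_pres k)) (pres_Z (listed_pres k)) p q r s"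
    and L: "uniform_algebra (lie_of (listed_pres l)) (pres_V (listed_pres l)) (pres_Z (listed_pres l)) p' q' r' s'"
    using displays_listed[OF k] displays_listed[OF l] unfolding t
    by (elim displays_type_uniform_algebra)
  have "p + q = p' + q'" "p = p'"
    using lie_isomorphic_invariants(1,2)[OF lie_algebra_listed[OF k] iso]
      uniform_algebra.dim_space[OF K] uniform_algebra.dim_space[OF L]
      uniform_algebra.dim_derived[OF K] uniform_algebra.dim_derived[OF L] by simp_all
  then show "fst (listed_type k) = fst (listed_type l)" "fst (snd (listed_type k)) = fst (snd (listed_type l))"
    unfolding t by simp_all
qed

lemma listed_type_coincidences:
  assumes "k \<in> {1..12}" "l \<in> {1..12}" "k < l"
    and "fst (listed_type k) = fst (listed_type l)" "fst (snd (listed_type k)) = fst (snd (listed_type l))"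
  shows "k = 3 \<and> l = 6 \<or> k = 8 \<and> l = 9 \<or> k = 7 \<and> l = 11"
proof -
  let ?T = "[(1, 2, 1), (1, 4, 2), (2, 4, 1), (3, 3, 1), (4, 4, 1), (2, 4, 2), (5, 5, 1),
     (3, 4, 2), (3, 4, 2), (6, 4, 1), (5, 5, 2), (10, 5, 1)] :: (nat \<times> nat \<times> nat) list"
  have "\<forall>k\<in>set [1..<13]. \<forall>l\<in>set [1..<13]. k < l \<longrightarrow> fst (?T ! (k - 1)) = fst (?T ! (l - 1)) \<longrightarrow>
      fst (snd (?T ! (k - 1))) = fst (snd (?T ! (l - 1))) \<longrightarrow>
      k = 3 \<and> l = 6 \<or> k = 8 \<and> l = 9 \<or> k = 7 \<and> l = 11"
    by code_simp
  moreover have "k \<in> set [1..<13]" "l \<in> set [1..<13]" using assms(1,2) by (auto simp del: upt_rec_numeral)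
  ultimately show ?thesis
    using assms(3-5) unfolding listed_type_eq[OF assms(1)] listed_type_eq[OF assms(2)] by blast
qed

section \<open>Adjoint ranks of the listed algebras through minors\<close>

lemma has_ad_rank_leI:
  assumes "x \<in> lie_space L" "y \<in> lie_space L" "lie_bracket L x y \<noteq> 0"
    and "\<And>y. lie_bracket L x y \<in> span W" and "finite W" "card W \<le> k"
  shows "has_ad_rank_le k L"
proof -
  have "dim (ad_image L x) \<le> card W"
    using assms(4,5) by (intro dim_le_card) (auto simp: ad_image_def)
  moreover have "\<not> ad_image L x \<subseteq> {0}"
    using assms(2,3) by (auto simp: ad_image_def)
  ultimately show ?thesis
    unfolding has_ad_rank_le_def using assms(1,6) by (meson order_trans)
qed

lemma finite_dim_basis:
  fixes A T :: "'a::real_vector set"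
  assumes "finite T" "A \<subseteq> span T"
  obtains C where "A \<subseteq> span C" "finite C" "card C = dim A"
proof -
  obtain C where C: "C \<subseteq> A" "independent C" "A \<subseteq> span C" "card C = dim A"
    by (rule basis_exists)
  then show thesis
    using that independent_span_bound[OF assms(1) C(2)] assms(2) by blast
qed

text \<open>Turns a small dimension into a small finite spanning set. The finite dimension of the
  carrier enters here: \<open>card\<close> and \<open>dim\<close> return 0 in infinite cases, so a
  bound alone would carry no information.\<close>

lemma has_ad_rank_leD:
  assumes L: "lie_algebra L" and rank: "has_ad_rank_le k L"
  obtains x C where "x \<in> lie_space L" "\<exists>y\<in>lie_space L. lie_bracket L x y \<noteq> 0" "finite C" "card C \<le> k"
    "\<And>y. y \<in> lie_space L \<Longrightarrow> lie_bracket L x y \<in> span C"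
proof -
  obtain x where x: "x \<in> lie_space L" "\<not> ad_image L x \<subseteq> {0}" "dim (ad_image L x) \<le> k"
    using rank unfolding has_ad_rank_le_def by blast
  obtain T where T: "finite T" "lie_space L = span T"
    using lie_algebraD(2)[OF L] by blast
  have "ad_image L x \<subseteq> span T"
    unfolding ad_image_def T(2)[symmetric] using lie_algebraD(3)[OF L x(1)] by blast
  then obtain C where C: "ad_image L x \<subseteq> span C" "finite C" "card C = dim (ad_image L x)"
    using finite_dim_basis[OF T(1)] by metis
  show thesis
  proof (rule that[OF x(1) _ C(2)])
    show "\<exists>y\<in>lie_space L. lie_bracket L x y \<noteq> 0" using x(2) by (auto simp: ad_image_def)
    show "card C \<le> k" using C(3) x(3) by simp
    show "lie_bracket L x y \<in> span C" if "y \<in> lie_space L" for y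
      using C(1) that by (auto simp: ad_image_def)
  qed
qed

definition det2 :: "real \<Rightarrow> real \<Rightarrow> real \<Rightarrow> real \<Rightarrow> real" where
  "det2 a b c d = a * d - b * c"

definition det3 :: "real \<Rightarrow> real \<Rightarrow> real \<Rightarrow> real \<Rightarrow> real \<Rightarrow> real \<Rightarrow> real \<Rightarrow> real \<Rightarrow> real \<Rightarrow> real" where
  "det3 a b c d e f g h i = a * (e * i - f * h) - b * (d * i - f * g) + c * (d * h - e * g)"

lemma card_le_1_subset: "finite C \<Longrightarrow> card C \<le> 1 \<Longrightarrow> \<exists>a. C \<subseteq> {a}"
  by (metis One_nat_def card_le_Suc0_iff_eq empty_subsetI insertCI subsetI)

lemma card_le_2_subset:
  assumes "finite C" "card C \<le> 2"
  shows "\<exists>a b. C \<subseteq> {a, b}"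
proof (cases "C = {}")
  case False
  then obtain a where a: "a \<in> C" by blast
  then have "card (C - {a}) \<le> 1" using assms by simp
  then obtain b where "C - {a} \<subseteq> {b}" using card_le_1_subset assms(1) by blast
  then show ?thesis by blast
qed simp

text \<open>Vectors on one line have proportional coordinate rows. With its 3 by 3 analogue this
  translates a rank bound into polynomial equations in the coordinates of \<open>x\<close>.\<close>

lemma minor2_zero:
  fixes u :: "nat \<Rightarrow> symbol_vec"
  assumes "finite C" "card C \<le> 1" and u: "\<And>i. u i \<in> span C"
  shows "det2 (Poly_Mapping.lookup (u i) s) (Poly_Mapping.lookup (u i) t)
              (Poly_Mapping.lookup (u j) s) (Poly_Mapping.lookup (u j) t) = 0"
proof -
  obtain A where "C \<subseteq> {A}" using card_le_1_subset assms by blast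
  then have "u i \<in> span {A}" for i using u span_mono by blast
  then have "\<exists>a. u i = a *\<^sub>R A" for i by (auto simp: span_singleton)
  then obtain a where "\<And>i. u i = a i *\<^sub>R A" by metis
  then show ?thesis by (simp add: det2_def)
qed

lemma minor3_zero:
  fixes u :: "nat \<Rightarrow> symbol_vec"
  assumes "finite C" "card C \<le> 2" and u: "\<And>i. u i \<in> span C"
  shows "det3 (Poly_Mapping.lookup (u i) s) (Poly_Mapping.lookup (u i) t) (Poly_Mapping.lookup (u i) w)
              (Poly_Mapping.lookup (u j) s) (Poly_Mapping.lookup (u j) t) (Poly_Mapping.lookup (u j) w)
              (Poly_Mapping.lookup (u k) s) (Poly_Mapping.lookup (u k) t) (Poly_Mapping.lookup (u k) w) = 0"
proof -
  obtain A B where "C \<subseteq> {A, B}" using card_le_2_subset assms by blast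
  then have "u i \<in> span {A, B}" for i using u span_mono by blast
  then have "\<exists>a b. u i = a *\<^sub>R A + b *\<^sub>R B" for i
    by (auto simp: span_insert span_singleton algebra_simps)
  then obtain a b where "\<And>i. u i = a i *\<^sub>R A + b i *\<^sub>R B" by metis
  then show ?thesis by (simp add: det3_def lookup_add algebra_simps)
qed

lemma lie_bracket_pres_eq_0_coords:
  assumes x: "x \<in> lie_space (lie_of (pres_of q S es))" and S: "proper_pres S es"
    and 0: "\<And>i. i \<in> {1..q} \<Longrightarrow> Poly_Mapping.lookup x (VS i) = 0"
  shows "lie_bracket (lie_of (pres_of q S es)) x y = 0"
proof (rule lie_bracket_pres_eq_0, intro disjI1 allI)
  fix k
  have "VS k \<notin> set S" using S by (auto simp: proper_pres_def list_all_iff is_VS_def)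
  then show "Poly_Mapping.lookup x (VS k) = 0"
    using x 0[of k] by (cases "k \<in> {1..q}") (auto simp: lie_space_pres span_unit_vec in_keys_iff)
qed

lemma vv_in_pres: "i \<in> {1..q} \<Longrightarrow> vv i \<in> lie_space (lie_of (pres_of q S es))"
  by (auto simp: lie_space_pres vv_unit_vec intro: span_base)

lemmas bracket_eval = lie_bracket_pres vv_def lookup_add lookup_minus lookup_single when_def

text \<open>The image of \<open>ad\<close> at a basis generator is spanned by the colours of its
  edges, so its rank is the degree of the graph: 1 here, and 2 for the five-cycle of algebra
  (7).\<close>

lemma has_ad_rank_listed_3: "has_ad_rank_le 1 (lie_of (listed_pres 3))"
  unfolding listed_pres_eq
proof (rule has_ad_rank_leI[of "vv 1" _ "vv 2" "{unit_vec (ZS 1)}"])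
  let ?L = "lie_of (pres_of 4 (zs 2) [pos_bracket 1 2 1, pos_bracket 3 4 2])"
  show "vv 1 \<in> lie_space ?L" "vv 2 \<in> lie_space ?L" by (rule vv_in_pres; simp)+
  show "lie_bracket ?L (vv 1) (vv 2) \<noteq> 0" by (simp add: bracket_eval)
  fix y
  have "lie_bracket ?L (vv 1) y = Poly_Mapping.lookup y (VS 2) *\<^sub>R unit_vec (ZS 1)"
    by (simp add: bracket_eval)
  then show "lie_bracket ?L (vv 1) y \<in> span {unit_vec (ZS 1)}"
    by (simp only:) (intro span_scale span_base insertI1)
qed simp_all

lemma has_ad_rank_listed_7: "has_ad_rank_le 2 (lie_of (listed_pres 7))"
  unfolding listed_pres_eq
proof (rule has_ad_rank_leI[of "vv 1" _ "vv 2" "{unit_vec (ZS 1), unit_vec (ZS 5)}"])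
  let ?L = "lie_of (pres_of 5 (zs 5) [pos_bracket 1 2 1, pos_bracket 2 3 2, pos_bracket 3 4 3,
     pos_bracket 4 5 4, pos_bracket 5 1 5])"
  show "vv 1 \<in> lie_space ?L" "vv 2 \<in> lie_space ?L" by (rule vv_in_pres; simp)+
  show "lie_bracket ?L (vv 1) (vv 2) \<noteq> 0" by (simp add: bracket_eval)
  fix y
  have "lie_bracket ?L (vv 1) y = Poly_Mapping.lookup y (VS 2) *\<^sub>R unit_vec (ZS 1)
      - Poly_Mapping.lookup y (VS 5) *\<^sub>R unit_vec (ZS 5)"
    by (simp add: bracket_eval)
  then show "lie_bracket ?L (vv 1) y \<in> span {unit_vec (ZS 1), unit_vec (ZS 5)}"
    by (simp only:) (intro span_diff span_scale span_base insertI1 insertI2)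
qed (simp_all add: card_insert_if)

text \<open>In the split quaternion picture the norm form is c1^2 + c2^2 - c3^2 - c4^2 in the
  generator coordinates, and \<open>vv 1 + vv 4\<close> is one of its null vectors.\<close>

lemma has_ad_rank_listed_9: "has_ad_rank_le 2 (lie_of (listed_pres 9))"
  unfolding listed_pres_eq
proof (rule has_ad_rank_leI[of "vv 1 + vv 4" _ "vv 4" "{unit_vec (ZS 1) - unit_vec (ZS 2), unit_vec (ZS 3)}"])
  let ?L = "lie_of (pres_of 4 (zs 3) [pos_bracket 1 2 1, pos_bracket 3 4 1, pos_bracket 1 3 2, pos_bracket 2 4 2,
     pos_bracket 1 4 3, neg_bracket 2 3 3])"
  show "vv 1 + vv 4 \<in> lie_space ?L"
    unfolding lie_space_pres by (intro span_add; auto simp: vv_unit_vec intro: span_base)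
  show "vv 4 \<in> lie_space ?L" by (rule vv_in_pres) simp
  show "lie_bracket ?L (vv 1 + vv 4) (vv 4) \<noteq> 0" by (simp add: bracket_eval)
  fix y
  have "lie_bracket ?L (vv 1 + vv 4) y
      = (Poly_Mapping.lookup y (VS 2) - Poly_Mapping.lookup y (VS 3)) *\<^sub>R (unit_vec (ZS 1) - unit_vec (ZS 2))
        + (Poly_Mapping.lookup y (VS 4) - Poly_Mapping.lookup y (VS 1)) *\<^sub>R unit_vec (ZS 3)"
    by (simp add: bracket_eval algebra_simps)
  then show "lie_bracket ?L (vv 1 + vv 4) y \<in> span {unit_vec (ZS 1) - unit_vec (ZS 2), unit_vec (ZS 3)}"
    by (simp only:) (intro span_add span_scale span_base insertI1 insertI2)
qed (simp_all add: card_insert_if)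

text \<open>This is the complex Heisenberg algebra: with \<open>v4\<close> = i \<open>v2\<close> and
  \<open>v3\<close> = - i \<open>v1\<close> the bracket is complex bilinear. A nonzero
  \<open>ad x\<close> then has a complex line as image, of real dimension 2.\<close>

lemma not_has_ad_rank_listed_6: "\<not> has_ad_rank_le 1 (lie_of (listed_pres 6))"
proof
  let ?es = "[pos_bracket 1 2 1, pos_bracket 3 4 1, pos_bracket 2 3 2, pos_bracket 1 4 2]"
  let ?L = "lie_of (pres_of 4 (zs 2) ?es)"
  have proper: "proper_pres (zs 2) ?es" by code_simp
  assume rank: "has_ad_rank_le 1 (lie_of (listed_pres 6))"
  obtain x C where x: "x \<in> lie_space ?L" and ne: "\<exists>y\<in>lie_space ?L. lie_bracket ?L x y \<noteq> 0"
    and C: "finite C" "card C \<le> 1" and span: "\<And>y. y \<in> lie_space ?L \<Longrightarrow> lie_bracket ?L x y \<in> span C"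
    by (rule has_ad_rank_leD[OF lie_algebra_pres[OF proper] rank[unfolded listed_pres_eq]], rule that)
  define c where "c i = Poly_Mapping.lookup x (VS i)" for i
  \<comment> \<open>Row \<open>i\<close> lists the coordinates of the bracket of \<open>x\<close>
    with the \<open>i\<close>-th generator. Other indices fall back to the first generator, so that
    every row comes from an element of the carrier and the lemma on minors applies to all
    indices.\<close>
  define R where "R i l = Poly_Mapping.lookup (lie_bracket ?L x (vv (if i \<in> {1..4} then i else 1))) (ZS l)" for i l
  have M: "det2 (R i l) (R i m) (R j l) (R j m) = 0" for i j l m
    unfolding R_def by (rule minor2_zero[OF C]) (intro span vv_in_pres, auto)
  have "R 1 1 = - c 2" "R 1 2 = - c 4" "R 3 1 = - c 4" "R 3 2 = c 2"
    "R 2 1 = c 1" "R 2 2 = - c 3" "R 4 1 = c 3" "R 4 2 = c 1"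
    by (simp_all add: R_def c_def bracket_eval)
  note R = this
  \<comment> \<open>Up to sign these two minors are sums of two squares, the squared moduli of the
    two complex coordinates of \<open>x\<close>.\<close>
  have "c 2 * c 2 + c 4 * c 4 = 0" "c 1 * c 1 + c 3 * c 3 = 0"
    using M[of 1 1 2 3] M[of 2 1 2 4] unfolding R det2_def by algebra+
  then have "c 1 = 0" "c 2 = 0" "c 3 = 0" "c 4 = 0"
    unfolding sum_squares_eq_zero_iff by blast+
  moreover have "i = 1 \<or> i = 2 \<or> i = 3 \<or> i = 4" if "i \<in> {1..4}" for i :: nat
    using that unfolding atLeastAtMost_iff by presburger
  ultimately have "Poly_Mapping.lookup x (VS i) = 0" if "i \<in> {1..4}" for i
    using that unfolding c_def by metis
  with lie_bracket_pres_eq_0_coords[OF x proper] ne show False by blast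
qed

text \<open>With 1, i, j, k for the generators the bracket of x and y is Im(y conj(x)).
  Multiplication by conj(x) is invertible unless x = 0, so \<open>ad x\<close> is onto the
  three-dimensional centre for every noncentral \<open>x\<close>.\<close>

lemma not_has_ad_rank_listed_8: "\<not> has_ad_rank_le 2 (lie_of (listed_pres 8))"
proof
  let ?es = "[pos_bracket 1 2 1, pos_bracket 3 4 1, pos_bracket 1 3 2, neg_bracket 2 4 2,
     pos_bracket 1 4 3, pos_bracket 2 3 3]"
  let ?L = "lie_of (pres_of 4 (zs 3) ?es)"
  have proper: "proper_pres (zs 3) ?es" by code_simp
  assume rank: "has_ad_rank_le 2 (lie_of (listed_pres 8))"
  obtain x C where x: "x \<in> lie_space ?L" and ne: "\<exists>y\<in>lie_space ?L. lie_bracket ?L x y \<noteq> 0"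
    and C: "finite C" "card C \<le> 2" and span: "\<And>y. y \<in> lie_space ?L \<Longrightarrow> lie_bracket ?L x y \<in> span C"
    by (rule has_ad_rank_leD[OF lie_algebra_pres[OF proper] rank[unfolded listed_pres_eq]], rule that)
  define c where "c i = Poly_Mapping.lookup x (VS i)" for i
  define R where "R i l = Poly_Mapping.lookup (lie_bracket ?L x (vv (if i \<in> {1..4} then i else 1))) (ZS l)" for i l
  have M: "det3 (R i 1) (R i 2) (R i 3) (R j 1) (R j 2) (R j 3) (R k 1) (R k 2) (R k 3) = 0" for i j k
    unfolding R_def by (rule minor3_zero[OF C]) (intro span vv_in_pres, auto)
  define N where "N = c 1 * c 1 + c 2 * c 2 + (c 3 * c 3 + c 4 * c 4)"
  have R: "R 1 1 = - c 2" "R 1 2 = - c 3" "R 1 3 = - c 4" "R 2 1 = c 1" "R 2 2 = c 4" "R 2 3 = - c 3"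
    "R 3 1 = - c 4" "R 3 2 = c 1" "R 3 3 = c 2" "R 4 1 = c 3" "R 4 2 = - c 2" "R 4 3 = c 1"
    by (simp_all add: R_def c_def bracket_eval)
  \<comment> \<open>Omitting the row of one generator leaves a minor equal, up to sign, to the
    coordinate of that generator times the quaternion norm \<open>N\<close>.\<close>
  have "c 1 * N = 0" "c 2 * N = 0" "c 3 * N = 0" "c 4 * N = 0"
    using M[of 2 3 4] M[of 1 3 4] M[of 1 2 4] M[of 1 2 3] unfolding R det3_def N_def by algebra+
  moreover have "c 1 = 0 \<and> c 2 = 0 \<and> c 3 = 0 \<and> c 4 = 0" if "N = 0"
  proof -
    have "c 1 * c 1 + c 2 * c 2 = 0" "c 3 * c 3 + c 4 * c 4 = 0"
      using that sum_squares_ge_zero[of "c 1" "c 2"] sum_squares_ge_zero[of "c 3" "c 4"]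
      unfolding N_def by linarith+
    then show ?thesis unfolding sum_squares_eq_zero_iff by blast
  qed
  ultimately have "c 1 = 0" "c 2 = 0" "c 3 = 0" "c 4 = 0"
    by (cases "N = 0"; simp)+
  moreover have "i = 1 \<or> i = 2 \<or> i = 3 \<or> i = 4" if "i \<in> {1..4}" for i :: nat
    using that unfolding atLeastAtMost_iff by presburger
  ultimately have "Poly_Mapping.lookup x (VS i) = 0" if "i \<in> {1..4}" for i
    using that unfolding c_def by metis
  with lie_bracket_pres_eq_0_coords[OF x proper] ne show False by blast
qed

text \<open>At rank at most two all 3 by 3 minors of the coordinate matrix vanish. An integer
  multiple of the cube of each generator coordinate is a combination of such minors, so all of these
  coordinates are 0 and \<open>x\<close> is central.\<close>

lemma not_has_ad_rank_listed_11: "\<not> has_ad_rank_le 2 (lie_of (listed_pres 11))"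
proof
  let ?es = "[pos_bracket 1 5 1, pos_bracket 2 4 1, pos_bracket 2 5 2, pos_bracket 3 4 2,
     pos_bracket 1 3 3, pos_bracket 4 5 3, pos_bracket 3 5 4, pos_bracket 1 2 4, pos_bracket 1 4 5, pos_bracket 2 3 5]"
  let ?L = "lie_of (pres_of 5 (zs 5) ?es)"
  have proper: "proper_pres (zs 5) ?es" by code_simp
  assume rank: "has_ad_rank_le 2 (lie_of (listed_pres 11))"
  obtain x C where x: "x \<in> lie_space ?L" and ne: "\<exists>y\<in>lie_space ?L. lie_bracket ?L x y \<noteq> 0"
    and C: "finite C" "card C \<le> 2" and span: "\<And>y. y \<in> lie_space ?L \<Longrightarrow> lie_bracket ?L x y \<in> span C"
    by (rule has_ad_rank_leD[OF lie_algebra_pres[OF proper] rank[unfolded listed_pres_eq]], rule that)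
  define x1 where "x1 = Poly_Mapping.lookup x (VS 1)"
  define x2 where "x2 = Poly_Mapping.lookup x (VS 2)"
  define x3 where "x3 = Poly_Mapping.lookup x (VS 3)"
  define x4 where "x4 = Poly_Mapping.lookup x (VS 4)"
  define x5 where "x5 = Poly_Mapping.lookup x (VS 5)"
  define R where "R i l = Poly_Mapping.lookup (lie_bracket ?L x (vv (if i \<in> {1..5} then i else 1))) (ZS l)" for i l
  have M: "det3 (R i a) (R i b) (R i c) (R j a) (R j b) (R j c) (R k a) (R k b) (R k c) = 0" for i j k a b c
    unfolding R_def by (rule minor3_zero[OF C]) (intro span vv_in_pres, auto)
  \<comment> \<open>The minors of size 3 of the matrix \<open>R\<close> span all cubic forms in \<open>x1, \<dots>, x5\<close>; the
    coefficients below come from Gaussian elimination.\<close>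
  have R: "R 1 1 = - x5" "R 1 2 = 0" "R 1 3 = - x3" "R 1 4 = - x2" "R 1 5 = - x4"
    "R 2 1 = - x4" "R 2 2 = - x5" "R 2 3 = 0" "R 2 4 = x1" "R 2 5 = - x3"
    "R 3 1 = 0" "R 3 2 = - x4" "R 3 3 = x1" "R 3 4 = - x5" "R 3 5 = x2"
    "R 4 1 = x2" "R 4 2 = x3" "R 4 3 = - x5" "R 4 4 = 0" "R 4 5 = x1"
    "R 5 1 = x1" "R 5 2 = x2" "R 5 3 = x4" "R 5 4 = x3" "R 5 5 = 0"
    by (simp_all add: R_def x1_def x2_def x3_def x4_def x5_def bracket_eval)
  have "11 * x1 ^ 3 = (5) * det3 (R 1 1) (R 1 3) (R 1 5) (R 2 1) (R 2 3) (R 2 5) (R 4 1) (R 4 3) (R 4 5)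
      + (-2) * det3 (R 2 3) (R 2 4) (R 2 5) (R 3 3) (R 3 4) (R 3 5) (R 4 3) (R 4 4) (R 4 5)
      + (9) * det3 (R 2 1) (R 2 4) (R 2 5) (R 4 1) (R 4 4) (R 4 5) (R 5 1) (R 5 4) (R 5 5)
      + (-3) * det3 (R 1 2) (R 1 3) (R 1 4) (R 2 2) (R 2 3) (R 2 4) (R 3 2) (R 3 3) (R 3 4)
      + (4) * det3 (R 1 2) (R 1 3) (R 1 5) (R 2 2) (R 2 3) (R 2 5) (R 5 2) (R 5 3) (R 5 5)
      + (-1) * det3 (R 2 1) (R 2 2) (R 2 3) (R 3 1) (R 3 2) (R 3 3) (R 4 1) (R 4 2) (R 4 3)"
    unfolding R det3_def by algebra
  then have X1: "x1 = 0" by (simp add: M)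
  have "11 * x2 ^ 3 = (5) * det3 (R 2 1) (R 2 2) (R 2 4) (R 3 1) (R 3 2) (R 3 4) (R 5 1) (R 5 2) (R 5 4)
      + (-9) * det3 (R 1 1) (R 1 4) (R 1 5) (R 3 1) (R 3 4) (R 3 5) (R 4 1) (R 4 4) (R 4 5)
      + (5) * det3 (R 2 1) (R 2 2) (R 2 3) (R 4 1) (R 4 2) (R 4 3) (R 5 1) (R 5 2) (R 5 3)
      + (3) * det3 (R 2 1) (R 2 3) (R 2 5) (R 3 1) (R 3 3) (R 3 5) (R 4 1) (R 4 3) (R 4 5)
      + (1) * det3 (R 1 1) (R 1 3) (R 1 4) (R 2 1) (R 2 3) (R 2 4) (R 4 1) (R 4 3) (R 4 4)
      + (2) * det3 (R 3 1) (R 3 2) (R 3 5) (R 4 1) (R 4 2) (R 4 5) (R 5 1) (R 5 2) (R 5 5)"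
    unfolding R det3_def by algebra
  then have X2: "x2 = 0" by (simp add: M)
  have "11 * x3 ^ 3 = (5) * det3 (R 1 3) (R 1 4) (R 1 5) (R 3 3) (R 3 4) (R 3 5) (R 4 3) (R 4 4) (R 4 5)
      + (-9) * det3 (R 2 2) (R 2 4) (R 2 5) (R 4 2) (R 4 4) (R 4 5) (R 5 2) (R 5 4) (R 5 5)
      + (3) * det3 (R 1 1) (R 1 2) (R 1 4) (R 2 1) (R 2 2) (R 2 4) (R 4 1) (R 4 2) (R 4 4)
      + (-4) * det3 (R 2 1) (R 2 3) (R 2 4) (R 3 1) (R 3 3) (R 3 4) (R 4 1) (R 4 3) (R 4 4)
      + (1) * det3 (R 1 1) (R 1 2) (R 1 3) (R 3 1) (R 3 2) (R 3 3) (R 4 1) (R 4 2) (R 4 3)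
      + (2) * det3 (R 1 2) (R 1 3) (R 1 4) (R 4 2) (R 4 3) (R 4 4) (R 5 2) (R 5 3) (R 5 4)"
    unfolding R det3_def by algebra
  then have X3: "x3 = 0" by (simp add: M)
  have "11 * x4 ^ 3 = (-5) * det3 (R 2 2) (R 2 3) (R 2 5) (R 3 2) (R 3 3) (R 3 5) (R 4 2) (R 4 3) (R 4 5)
      + (2) * det3 (R 1 1) (R 1 3) (R 1 5) (R 2 1) (R 2 3) (R 2 5) (R 5 1) (R 5 3) (R 5 5)
      + (4) * det3 (R 2 1) (R 2 2) (R 2 3) (R 3 1) (R 3 2) (R 3 3) (R 5 1) (R 5 2) (R 5 3)
      + (-1) * det3 (R 2 1) (R 2 3) (R 2 4) (R 4 1) (R 4 3) (R 4 4) (R 5 1) (R 5 3) (R 5 4)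
      + (-3) * det3 (R 2 3) (R 2 4) (R 2 5) (R 3 3) (R 3 4) (R 3 5) (R 5 3) (R 5 4) (R 5 5)
      + (-5) * det3 (R 1 1) (R 1 2) (R 1 5) (R 2 1) (R 2 2) (R 2 5) (R 3 1) (R 3 2) (R 3 5)"
    unfolding R det3_def by algebra
  then have X4: "x4 = 0" by (simp add: M)
  have "11 * x5 ^ 3 = (-5) * det3 (R 2 1) (R 2 2) (R 2 4) (R 4 1) (R 4 2) (R 4 4) (R 5 1) (R 5 2) (R 5 4)
      + (-4) * det3 (R 2 2) (R 2 4) (R 2 5) (R 3 2) (R 3 4) (R 3 5) (R 5 2) (R 5 4) (R 5 5)
      + (9) * det3 (R 1 1) (R 1 3) (R 1 4) (R 3 1) (R 3 3) (R 3 4) (R 4 1) (R 4 3) (R 4 4)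
      + (2) * det3 (R 2 2) (R 2 3) (R 2 4) (R 3 2) (R 3 3) (R 3 4) (R 4 2) (R 4 3) (R 4 4)
      + (1) * det3 (R 2 2) (R 2 3) (R 2 5) (R 4 2) (R 4 3) (R 4 5) (R 5 2) (R 5 3) (R 5 5)
      + (3) * det3 (R 1 3) (R 1 4) (R 1 5) (R 2 3) (R 2 4) (R 2 5) (R 4 3) (R 4 4) (R 4 5)"
    unfolding R det3_def by algebra
  then have X5: "x5 = 0" by (simp add: M)
  have "i = 1 \<or> i = 2 \<or> i = 3 \<or> i = 4 \<or> i = 5" if "i \<in> {1..5}" for i :: nat
    using that unfolding atLeastAtMost_iff by presburger
  then have "Poly_Mapping.lookup x (VS i) = 0" if "i \<in> {1..5}" for i
    using that X1 X2 X3 X4 X5 unfolding x1_def x2_def x3_def x4_def x5_def by metis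
  with lie_bracket_pres_eq_0_coords[OF x proper] ne show False by blast
qed

lemma listed_isomorphic_unique:
  assumes k: "k \<in> {1..12}" and l: "l \<in> {1..12}"
    and iso: "lie_isomorphic (lie_of (listed_pres k)) (lie_of (listed_pres l))"
  shows "k = l"
proof -
  have less: False if k: "k \<in> {1..12}" and l: "l \<in> {1..12}" and "k < l"
    and iso: "lie_isomorphic (lie_of (listed_pres k)) (lie_of (listed_pres l))" for k l
  proof -
    \<comment> \<open>Both directions are used: the algebra of small rank comes first in the pairs
      (3,6) and (7,11), but second in (8,9).\<close>
    have iso': "lie_isomorphic (lie_of (listed_pres l)) (lie_of (listed_pres k))"
      by (rule lie_isomorphic_sym[OF lie_algebra_listed[OF k] iso])
    have "k = 3 \<and> l = 6 \<or> k = 8 \<and> l = 9 \<or> k = 7 \<and> l = 11"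
      by (rule listed_type_coincidences[OF k l \<open>k < l\<close> listed_isomorphic_type[OF k l iso]])
    then show False
      using lie_isomorphic_invariants(3)[OF lie_algebra_listed[OF k] iso]
        lie_isomorphic_invariants(3)[OF lie_algebra_listed[OF l] iso']
        has_ad_rank_listed_3 has_ad_rank_listed_7 has_ad_rank_listed_9 not_has_ad_rank_listed_6 not_has_ad_rank_listed_8 not_has_ad_rank_listed_11 by blast
  qed
  show ?thesis
    using less[OF k l _ iso] less[OF l k _ lie_isomorphic_sym[OF lie_algebra_listed[OF k] iso]]
    by (cases k l rule: linorder_cases) auto
qed

section \<open>Classification for at most five generators\<close>

lemma sign_square: "e \<in> {1, -1 :: real} \<Longrightarrow> e * e = 1"
  by auto

text \<open>Colours are numbered from 1, list positions from 0. The value 0 at all other symbols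
  keeps every value in the span of the list, whatever the symbol.\<close>

definition colour_vec :: "'a::real_vector list \<Rightarrow> basis_symbol \<Rightarrow> 'a" where
  "colour_vec As t = (case t of ZS l \<Rightarrow> if 1 \<le> l \<and> l \<le> length As then As ! (l - 1) else 0 | _ \<Rightarrow> 0)"

lemma colour_vec_span:
  assumes "set As \<subseteq> span B"
  shows "colour_vec As t \<in> span B"
proof (cases t)
  case (ZS l)
  then show ?thesis
    using assms nth_mem[of "l - 1" As] by (auto simp: colour_vec_def span_zero)
qed (simp_all add: colour_vec_def span_zero)

context uniform_algebra
begin

section \<open>Recognising a presentation after relabelling and sign changes\<close>

lemma br_scale:
  assumes "x \<in> V" "y \<in> V"
  shows "br (a *\<^sub>R x) (b *\<^sub>R y) = (a * b) *\<^sub>R br x y"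
proof -
  note S = lie_algebraD(1)[OF lie]
  have "br (a *\<^sub>R x) (b *\<^sub>R y) = a *\<^sub>R br x (b *\<^sub>R y)"
    using assms V_space S by (intro lie_algebraD(6)[OF lie]) (auto intro: subspace_scale)
  also have "br x (b *\<^sub>R y) = b *\<^sub>R br x y"
    using assms V_space by (intro lie_algebraD(7)[OF lie]) auto
  finally show ?thesis by simp
qed

text \<open>Generators are replaced by \<open>e i *\<^sub>R v i\<close>. As
  \<open>e i * e i = 1\<close>, scaling twice returns the old generator, so the span is
  unchanged.\<close>

lemma lie_isomorphic_signed:
  assumes proper: "proper_pres S es" and S: "length S = p"
    and V: "V = v ` {1..q}" and e: "\<And>i. e i \<in> {1, -1 :: real}"
    and c: "\<And>t. c t \<in> span Z"
    and tab: "\<And>i j. 1 \<le> i \<Longrightarrow> i < j \<Longrightarrow> j \<le> q \<Longrightarrow>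
      (e i * e j) *\<^sub>R br (v i) (v j) = opt_signed c (table es i j)"
  shows "lie_isomorphic L (lie_of (pres_of q S es))"
proof (rule lie_isomorphic_pres[OF proper S])
  show "e i *\<^sub>R v i \<in> span V" if "i \<in> {1..q}" for i
    using that by (intro span_scale span_base) (simp add: V)
  show "V \<subseteq> span ((\<lambda>i. e i *\<^sub>R v i) ` {1..q})"
  proof
    fix x assume "x \<in> V"
    then obtain i where i: "i \<in> {1..q}" "x = v i" by (auto simp: V)
    have "e i *\<^sub>R (e i *\<^sub>R v i) \<in> span ((\<lambda>i. e i *\<^sub>R v i) ` {1..q})"
      using i(1) by (intro span_scale[OF span_base]) simp
    then show "x \<in> span ((\<lambda>i. e i *\<^sub>R v i) ` {1..q})"
      by (simp add: i(2) sign_square[OF e])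
  qed
  show "br (e i *\<^sub>R v i) (e j *\<^sub>R v j) = opt_signed c (table es i j)" if "1 \<le> i" "i < j" "j \<le> q" for i j
  proof -
    have "v i \<in> V" "v j \<in> V" using that by (auto simp: V)
    then show ?thesis using tab[OF that] by (simp only: br_scale)
  qed
qed (rule c)

lemma set_eq_nth_image:
  assumes "length vs = n"
  shows "set vs = (\<lambda>i. vs ! (i - 1)) ` {1..n}"
proof -
  have "{1..n} = Suc ` {0..<n}" by (simp only: image_Suc_atLeastLessThan) auto
  then have "(\<lambda>i. vs ! (i - 1)) ` {1..n} = (!) vs ` {0..<n}"
    by (simp only: image_image diff_Suc_1)
  then show ?thesis
    using assms by (auto simp: set_conv_nth)
qed

lemma lie_isomorphic_list:
  assumes proper: "proper_pres S es" and S: "length S = p"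
    and V: "V = set vs" and lens: "length vs = q" "length e = q" and e: "set e \<subseteq> {1, -1 :: real}"
    and c: "\<And>t. c t \<in> span Z"
    and tab: "\<And>i j. 1 \<le> i \<Longrightarrow> i < j \<Longrightarrow> j \<le> q \<Longrightarrow>
      (e ! (i - 1) * e ! (j - 1)) *\<^sub>R br (vs ! (i - 1)) (vs ! (j - 1)) = opt_signed c (table es i j)"
  shows "lie_isomorphic L (lie_of (pres_of q S es))"
proof (rule lie_isomorphic_signed[OF proper S])
  show "V = (\<lambda>i. vs ! (i - 1)) ` {1..q}"
    using V set_eq_nth_image[OF lens(1)] by simp
  \<comment> \<open>Outside the range the sign is set to 1, because the signs must be admissible at
    every natural number.\<close>
  show "(if i \<in> {1..q} then e ! (i - 1) else 1) \<in> {1, -1 :: real}" for i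
  proof (cases "i \<in> {1..q}")
    case True
    then have "e ! (i - 1) \<in> set e" using lens(2) by (intro nth_mem) auto
    then show ?thesis unfolding if_P[OF True] using e by blast
  next
    case False
    then show ?thesis unfolding if_not_P[OF False] by simp
  qed
  show "((if i \<in> {1..q} then e ! (i - 1) else 1) * (if j \<in> {1..q} then e ! (j - 1) else 1)) *\<^sub>R
      br (vs ! (i - 1)) (vs ! (j - 1)) = opt_signed c (table es i j)" if "1 \<le> i" "i < j" "j \<le> q" for i j
    using tab[OF that] that by simp
qed (rule c)

lemma lie_isomorphic_pres_3:
  assumes "q = 3" and V: "V = {v1, v2, v3}" and "proper_pres S es" "length S = p"
    and "\<And>t. c t \<in> span Z"
    and 12: "br v1 v2 = opt_signed c (table es 1 2)"
    and 13: "br v1 v3 = opt_signed c (table es 1 3)"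
    and 23: "br v2 v3 = opt_signed c (table es 2 3)"
  shows "lie_isomorphic L (lie_of (pres_of 3 S es))"
proof -
  have "(([1, 1, 1] :: real list) ! (i - 1) * [1, 1, 1] ! (j - 1)) *\<^sub>R br ([v1, v2, v3] ! (i - 1)) ([v1, v2, v3] ! (j - 1))
      = opt_signed c (table es i j)" if ij: "1 \<le> i" "i < j" "j \<le> 3" for i j
  proof -
    have "i = 1 \<and> j = 2 \<or> i = 1 \<and> j = 3 \<or> i = 2 \<and> j = 3" using ij by presburger
    then show ?thesis
      by (elim disjE conjE; hypsubst; simp add: 12 13 23 del: One_nat_def)
  qed
  then show ?thesis
    using assms(1-5) lie_isomorphic_list[of S es "[v1, v2, v3]" "[1, 1, 1]" c] by simp
qed

lemma lie_isomorphic_pres_4: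
  assumes "q = 4" and V: "V = {v1, v2, v3, v4}" and "proper_pres S es" "length S = p"
    and "\<And>t. c t \<in> span Z" and e: "{e1, e2, e3, e4} \<subseteq> {1, -1 :: real}"
    and 12: "(e1 * e2) *\<^sub>R br v1 v2 = opt_signed c (table es 1 2)"
    and 13: "(e1 * e3) *\<^sub>R br v1 v3 = opt_signed c (table es 1 3)"
    and 14: "(e1 * e4) *\<^sub>R br v1 v4 = opt_signed c (table es 1 4)"
    and 23: "(e2 * e3) *\<^sub>R br v2 v3 = opt_signed c (table es 2 3)"
    and 24: "(e2 * e4) *\<^sub>R br v2 v4 = opt_signed c (table es 2 4)"
    and 34: "(e3 * e4) *\<^sub>R br v3 v4 = opt_signed c (table es 3 4)"
  shows "lie_isomorphic L (lie_of (pres_of 4 S es))"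
proof -
  have "([e1, e2, e3, e4] ! (i - 1) * [e1, e2, e3, e4] ! (j - 1)) *\<^sub>R
      br ([v1, v2, v3, v4] ! (i - 1)) ([v1, v2, v3, v4] ! (j - 1))
      = opt_signed c (table es i j)" if ij: "1 \<le> i" "i < j" "j \<le> 4" for i j
  proof -
    have "i = 1 \<and> j = 2 \<or> i = 1 \<and> j = 3 \<or> i = 1 \<and> j = 4 \<or> i = 2 \<and> j = 3 \<or> i = 2 \<and> j = 4 \<or> i = 3 \<and> j = 4"
      using ij by presburger
    then show ?thesis
      by (elim disjE conjE; hypsubst; simp add: 12 13 14 23 24 34 del: One_nat_def)
  qed
  then show ?thesis
    using assms(1-6) lie_isomorphic_list[of S es "[v1, v2, v3, v4]" "[e1, e2, e3, e4]" c] by simp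
qed

lemma lie_isomorphic_pres_5:
  assumes "q = 5" and V: "V = {v1, v2, v3, v4, v5}" and "proper_pres S es" "length S = p"
    and "\<And>t. c t \<in> span Z" and e: "{e1, e2, e3, e4, e5} \<subseteq> {1, -1 :: real}"
    and 12: "(e1 * e2) *\<^sub>R br v1 v2 = opt_signed c (table es 1 2)"
    and 13: "(e1 * e3) *\<^sub>R br v1 v3 = opt_signed c (table es 1 3)"
    and 14: "(e1 * e4) *\<^sub>R br v1 v4 = opt_signed c (table es 1 4)"
    and 15: "(e1 * e5) *\<^sub>R br v1 v5 = opt_signed c (table es 1 5)"
    and 23: "(e2 * e3) *\<^sub>R br v2 v3 = opt_signed c (table es 2 3)"
    and 24: "(e2 * e4) *\<^sub>R br v2 v4 = opt_signed c (table es 2 4)"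
    and 25: "(e2 * e5) *\<^sub>R br v2 v5 = opt_signed c (table es 2 5)"
    and 34: "(e3 * e4) *\<^sub>R br v3 v4 = opt_signed c (table es 3 4)"
    and 35: "(e3 * e5) *\<^sub>R br v3 v5 = opt_signed c (table es 3 5)"
    and 45: "(e4 * e5) *\<^sub>R br v4 v5 = opt_signed c (table es 4 5)"
  shows "lie_isomorphic L (lie_of (pres_of 5 S es))"
proof -
  have "([e1, e2, e3, e4, e5] ! (i - 1) * [e1, e2, e3, e4, e5] ! (j - 1)) *\<^sub>R
      br ([v1, v2, v3, v4, v5] ! (i - 1)) ([v1, v2, v3, v4, v5] ! (j - 1))
      = opt_signed c (table es i j)" if ij: "1 \<le> i" "i < j" "j \<le> 5" for i j
  proof -
    have "i = 1 \<and> j = 2 \<or> i = 1 \<and> j = 3 \<or> i = 1 \<and> j = 4 \<or> i = 1 \<and> j = 5 \<or> i = 2 \<and> j = 3 \<or>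
        i = 2 \<and> j = 4 \<or> i = 2 \<and> j = 5 \<or> i = 3 \<and> j = 4 \<or> i = 3 \<and> j = 5 \<or> i = 4 \<and> j = 5"
      using ij by presburger
    then show ?thesis
      by (elim disjE conjE; hypsubst; simp add: 12 13 14 15 23 24 25 34 35 45 del: One_nat_def)
  qed
  then show ?thesis
    using assms(1-6) lie_isomorphic_list[of S es "[v1, v2, v3, v4, v5]" "[e1, e2, e3, e4, e5]" c] by simp
qed

text \<open>Equality of colours irrespective of sign and orientation. Two vanishing brackets are
  related as well, so it means a common colour only for pairs with nonzero bracket.\<close>

definition sim :: "'a \<Rightarrow> 'a \<Rightarrow> 'a \<Rightarrow> 'a \<Rightarrow> bool" where
  "sim x y u w \<longleftrightarrow> br x y = br u w \<or> br x y = - br u w"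

lemma sim_sym: "sim x y u w \<Longrightarrow> sim u w x y"
  unfolding sim_def by (elim disjE) simp_all

lemma sim_trans: "sim x y u w \<Longrightarrow> sim u w u' w' \<Longrightarrow> sim x y u' w'"
  unfolding sim_def by (elim disjE) simp_all

lemma sim_swap: "x \<in> V \<Longrightarrow> y \<in> V \<Longrightarrow> sim x y y x"
  unfolding sim_def using br_skew[of y x] by simp

lemma sim_sign:
  assumes "sim x y u w"
  obtains e where "e \<in> {1, -1 :: real}" "br u w = e *\<^sub>R br x y"
  using assms that[of 1] that[of "-1"] unfolding sim_def by auto

lemma sim_unique:
  assumes "x \<in> V" "y \<in> V" "y' \<in> V" "br x y \<noteq> 0" "sim x y x y'"
  shows "y = y'"
  using br_unique[OF assms(1-4)] assms(5) unfolding sim_def .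

text \<open>The colouring is proper: swapping endpoints moves a shared vertex to the first position
  of both pairs, where the uniqueness condition identifies the other endpoints.\<close>

lemma sim_disjoint:
  assumes V: "x \<in> V" "y \<in> V" "u \<in> V" "w \<in> V" and n0: "br x y \<noteq> 0" and sim: "sim x y u w"
    and "{x, y} \<inter> {u, w} \<noteq> {}"
  shows "{x, y} = {u, w}"
proof -
  have n0': "br y x \<noteq> 0" using br_skew[OF V(1,2)] n0 by simp
  have yx: "sim y x u w" using sim_trans[OF sim_swap[OF V(2,1)] sim] .
  have xw: "sim x y w u" using sim_trans[OF sim sim_swap[OF V(3,4)]] .
  have yw: "sim y x w u" using sim_trans[OF yx sim_swap[OF V(3,4)]] .
  from assms(7) consider "x = u" | "x = w" | "y = u" | "y = w" by blast
  then show ?thesis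
  proof cases
    case 1
    then show ?thesis using sim_unique[OF V(1,2,4) n0] sim by simp
  next
    case 2
    then show ?thesis using sim_unique[OF V(1,2,3) n0] xw by (simp add: insert_commute)
  next
    case 3
    then show ?thesis using sim_unique[OF V(2,1,4) n0'] yx by (simp add: insert_commute)
  next
    case 4
    then show ?thesis using sim_unique[OF V(2,1,3) n0'] yw by simp
  qed
qed

text \<open>With r = 2 the directed class of \<open>br x y\<close> has exactly one further member.
  It is not the reversal of \<open>(x, y)\<close>, which carries the opposite sign, and so by
  properness it avoids both endpoints.\<close>

lemma partner_edge:
  assumes r: "r = 2" and xy: "x \<in> V" "y \<in> V" "br x y \<noteq> 0"
  obtains u w where "u \<in> V" "w \<in> V" "{u, w} \<inter> {x, y} = {}" "u \<noteq> w" "sim x y u w"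
proof -
  have "card (ordered_class (br x y)) = 2"
    using br_VV[OF xy(1,2)] xy(3) card_ordered_class r by auto
  moreover have "(x, y) \<in> ordered_class (br x y)" using xy by (simp add: ordered_class_def)
  ultimately have "card (ordered_class (br x y) - {(x, y)}) = 1"
    by (simp add: finite_ordered_class)
  then obtain f where "f \<in> ordered_class (br x y)" "f \<noteq> (x, y)"
    by (metis Diff_iff card_1_singletonE insertI1)
  then obtain u w where f: "u \<in> V" "w \<in> V" "br u w = br x y" "(u, w) \<noteq> (x, y)"
    by (auto simp: ordered_class_def)
  have sim: "sim x y u w" using f(3) by (simp add: sim_def)
  have uw: "u \<noteq> w" using br_self[OF f(1)] f(3) xy(3) by auto
  have "{u, w} \<inter> {x, y} = {}"
  proof (rule ccontr)
    assume "{u, w} \<inter> {x, y} \<noteq> {}"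
    then have "{x, y} = {u, w}"
      using sim_disjoint[OF xy(1,2) f(1,2) xy(3) sim] by (simp add: Int_commute)
    then have "u = y" "w = x" using f(4) by (auto simp: doubleton_eq_iff)
    then have "br x y = - br x y" using br_skew[OF xy(1,2)] f(3) by simp
    moreover obtain z where "z \<in> Z" "br x y = z \<or> br x y = - z"
      using br_VV[OF xy(1,2)] xy(3) by auto
    ultimately have "z = - z" by auto
    with Z_neq_minus[OF \<open>z \<in> Z\<close> \<open>z \<in> Z\<close>] show False by simp
  qed
  then show thesis using that f(1,2) uw sim by blast
qed

lemma partner_4:
  assumes r: "r = 2" and V: "V = {x, y, a, b}" and n0: "br x y \<noteq> 0"
  shows "sim x y a b"
proof -
  obtain u w where uw: "u \<in> V" "w \<in> V" "{u, w} \<inter> {x, y} = {}" "u \<noteq> w" "sim x y u w"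
    using partner_edge[OF r _ _ n0] V by blast
  then have "u = a \<and> w = b \<or> u = b \<and> w = a" using V by auto
  then show ?thesis using uw(5) sim_trans[OF uw(5) sim_swap[OF uw(1,2)]] by auto
qed

text \<open>The partner is a pair inside the three remaining vertices. On four vertices the
  complement is itself a pair, which is why \<open>partner_4\<close> leaves no choice.\<close>

lemma partner_5:
  assumes r: "r = 2" and V: "V = {x, y, a, b, c}" and n0: "br x y \<noteq> 0"
  shows "sim x y a b \<or> sim x y a c \<or> sim x y b c"
proof -
  obtain u w where uw: "u \<in> V" "w \<in> V" "{u, w} \<inter> {x, y} = {}" "u \<noteq> w" "sim x y u w"
    using partner_edge[OF r _ _ n0] V by blast
  then have "u = a \<and> w = b \<or> u = b \<and> w = a \<or> u = a \<and> w = c \<or> u = c \<and> w = a \<or> u = b \<and> w = c \<or> u = c \<and> w = b"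
    using V by auto
  then show ?thesis using uw(5) sim_trans[OF uw(5) sim_swap[OF uw(1,2)]] by auto
qed

lemma degree_list:
  assumes "V = set vs" "distinct vs" "y \<in> V"
  shows "length (filter (\<lambda>x. br x y \<noteq> 0) vs) = s"
proof -
  have "card (set (filter (\<lambda>x. br x y \<noteq> 0) vs)) = length (filter (\<lambda>x. br x y \<noteq> 0) vs)"
    using assms(2) by (intro distinct_card distinct_filter)
  then show ?thesis using card_neighbours[OF assms(3)] assms(1) by simp
qed

lemma complete_graph:
  assumes s: "s = q - 1" and xy: "x \<in> V" "y \<in> V" "x \<noteq> y"
  shows "br x y \<noteq> 0"
proof -
  have "{x \<in> V. br x y \<noteq> 0} \<subseteq> V - {y}" using br_self[OF xy(2)] by auto
  moreover have "card (V - {y}) = s" using s card_V finite_V xy(2) by simp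
  ultimately have "{x \<in> V. br x y \<noteq> 0} = V - {y}"
    using card_neighbours[OF xy(2)] finite_V by (intro card_subset_eq) simp_all
  then show ?thesis using xy by blast
qed

lemma br_in_span_Z: "x \<in> V \<Longrightarrow> y \<in> V \<Longrightarrow> br x y \<in> span Z"
  by (rule br_VZ_VZ) simp_all

text \<open>Numerical values turn the degree conditions into linear equations with bounded
  variables, from which the shape of the graph follows by arithmetic.\<close>

definition adj :: "'a \<Rightarrow> 'a \<Rightarrow> nat" where
  "adj x y = (if br x y = 0 then 0 else 1)"

lemma adj_sym: "x \<in> V \<Longrightarrow> y \<in> V \<Longrightarrow> adj y x = adj x y"
  unfolding adj_def using br_skew[of x y] by simp

lemma adj_self: "x \<in> V \<Longrightarrow> adj x x = 0"
  by (simp add: adj_def br_self)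

lemma degree_adj:
  assumes "V = set vs" "distinct vs" "y \<in> V"
  shows "(\<Sum>x\<leftarrow>vs. adj x y) = s"
proof -
  have "length (filter (\<lambda>x. br x y \<noteq> 0) vs) = (\<Sum>x\<leftarrow>vs. adj x y)"
    by (induction vs) (simp_all add: adj_def)
  then show ?thesis using degree_list[OF assms] by simp
qed

section \<open>Algebras without a sign obstruction\<close>

lemma iso_listed_1:
  assumes q: "q = 2" and V: "V = {v1, v2}" and p: "p = 1"
  shows "lie_isomorphic L (lie_of (listed_pres 1))"
proof -
  let ?es = "[pos_bracket 1 2 1]"
  have c: "colour_vec [br v1 v2] t \<in> span Z" for t
    using br_in_span_Z V by (intro colour_vec_span) auto
  have "([1, 1] ! (i - 1) * [1, 1] ! (j - 1) :: real) *\<^sub>R br ([v1, v2] ! (i - 1)) ([v1, v2] ! (j - 1))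
      = opt_signed (colour_vec [br v1 v2]) (table ?es i j)" if ij: "1 \<le> i" "i < j" "j \<le> q" for i j
  proof -
    have "i = 1 \<and> j = 2" using ij q by presburger
    then show ?thesis by (elim conjE; hypsubst; simp add: colour_vec_def del: One_nat_def)
  qed
  moreover have "proper_pres (zs 1) ?es" by code_simp
  ultimately show ?thesis
    unfolding listed_pres_eq
    using lie_isomorphic_list[of "zs 1" ?es "[v1, v2]" "[1, 1]" "colour_vec [br v1 v2]"] c q V p
    by (simp add: zs_def del: One_nat_def)
qed

lemma iso_listed_2:
  assumes q: "q = 4" and V: "V = {v1, v2, v3, v4}" and p: "p = 1" and r: "r = 2" and n0: "br v1 v2 \<noteq> 0"
    and 0: "br v1 v3 = 0" "br v1 v4 = 0" "br v2 v3 = 0" "br v2 v4 = 0"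
  shows "lie_isomorphic L (lie_of (listed_pres 2))"
proof -
  obtain e where e: "e \<in> {1, -1 :: real}" "br v3 v4 = e *\<^sub>R br v1 v2"
    using sim_sign[OF partner_4[OF r V n0]] .
  let ?es = "[pos_bracket 1 2 1, pos_bracket 3 4 1]"
  \<comment> \<open>Scaling \<open>v1\<close> by \<open>e\<close> turns \<open>br v1 v2\<close> into
    \<open>br v3 v4\<close>, so the latter serves as the common colour.\<close>
  let ?c = "colour_vec [br v3 v4]"
  have c: "?c t \<in> span Z" for t
    using br_in_span_Z V by (intro colour_vec_span) auto
  have proper: "proper_pres (zs 1) ?es" by code_simp
  show ?thesis
    unfolding listed_pres_eq
    by (rule lie_isomorphic_pres_4[of v1 v2 v3 v4 "zs 1" ?es ?c e 1 1 1, OF q V proper _ c])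
       (use e in \<open>simp_all add: p 0 zs_def colour_vec_def del: One_nat_def\<close>)
qed

lemma iso_listed_3:
  assumes q: "q = 4" and V: "V = {v1, v2, v3, v4}" and p: "p = 2"
    and 0: "br v1 v3 = 0" "br v1 v4 = 0" "br v2 v3 = 0" "br v2 v4 = 0"
  shows "lie_isomorphic L (lie_of (listed_pres 3))"
proof -
  let ?es = "[pos_bracket 1 2 1, pos_bracket 3 4 2]"
  let ?c = "colour_vec [br v1 v2, br v3 v4]"
  have c: "?c t \<in> span Z" for t
    using br_in_span_Z V by (intro colour_vec_span) auto
  have proper: "proper_pres (zs 2) ?es" by code_simp
  show ?thesis
    unfolding listed_pres_eq
    by (rule lie_isomorphic_pres_4[of v1 v2 v3 v4 "zs 2" ?es ?c 1 1 1 1, OF q V proper _ c])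
       (simp_all add: p 0 zs_def colour_vec_def del: One_nat_def)
qed

text \<open>In a free algebra each symbol names its own pair of generators, so its image is the
  bracket of that pair; the value 0 elsewhere keeps all values in \<open>span Z\<close>.\<close>

definition free_vec :: "'a list \<Rightarrow> basis_symbol \<Rightarrow> 'a" where
  "free_vec vs t = (case t of ZZS i j \<Rightarrow>
     if i \<in> {1..length vs} \<and> j \<in> {1..length vs} then br (vs ! (i - 1)) (vs ! (j - 1)) else 0 | _ \<Rightarrow> 0)"

lemma free_vec_span:
  assumes "set vs \<subseteq> V"
  shows "free_vec vs t \<in> span Z"
proof (cases t)
  case (ZZS i j)
  show ?thesis
  proof (cases "i \<in> {1..length vs} \<and> j \<in> {1..length vs}")
    case True
    then have "vs ! (i - 1) \<in> set vs" "vs ! (j - 1) \<in> set vs" by (auto intro!: nth_mem)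
    then show ?thesis using True assms by (simp add: free_vec_def ZZS br_in_span_Z subset_iff)
  next
    case False
    then show ?thesis by (auto simp: free_vec_def ZZS span_zero)
  qed
qed (simp_all add: free_vec_def span_zero)

lemma free_brackets_3: "free_brackets 3 = [((1, 2), (True, ZZS 1 2)), ((1, 3), (True, ZZS 1 3)), ((2, 3), (True, ZZS 2 3))]"
  and free_symbols_3: "free_symbols 3 = [ZZS 1 2, ZZS 1 3, ZZS 2 3]"
  by code_simp+

lemma iso_listed_4:
  assumes q: "q = 3" and V: "V = {v1, v2, v3}" and p: "p = 3"
  shows "lie_isomorphic L (lie_of (listed_pres 4))"
proof -
  let ?c = "free_vec [v1, v2, v3]"
  have c: "?c t \<in> span Z" for t using V by (intro free_vec_span) simp
  have proper: "proper_pres (free_symbols 3) (free_brackets 3)" by code_simp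
  show ?thesis
    unfolding listed_pres_eq
    by (rule lie_isomorphic_pres_3[of v1 v2 v3 "free_symbols 3" "free_brackets 3" ?c, OF q V proper _ c])
       (simp_all add: p free_symbols_3 free_brackets_3 free_vec_def del: One_nat_def)
qed

lemma iso_listed_5:
  assumes q: "q = 4" and V: "V = {v1, v2, v3, v4}" and p: "p = 4"
    and 0: "br v1 v3 = 0" "br v2 v4 = 0"
  shows "lie_isomorphic L (lie_of (listed_pres 5))"
proof -
  let ?es = "[pos_bracket 1 2 1, pos_bracket 2 3 2, pos_bracket 3 4 3, pos_bracket 4 1 4]"
  let ?c = "colour_vec [br v1 v2, br v2 v3, br v3 v4, br v4 v1]"
  have c: "?c t \<in> span Z" for t
    using br_in_span_Z V by (intro colour_vec_span) auto
  have proper: "proper_pres (zs 4) ?es" by code_simp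
  have "br v1 v4 = - br v4 v1" using V by (intro br_skew) auto
  then show ?thesis
    unfolding listed_pres_eq
    by (intro lie_isomorphic_pres_4[of v1 v2 v3 v4 "zs 4" ?es ?c 1 1 1 1, OF q V proper _ c])
       (simp_all add: p 0 zs_def colour_vec_def del: One_nat_def)
qed

lemma iso_listed_7:
  assumes q: "q = 5" and V: "V = {v1, v2, v3, v4, v5}" and p: "p = 5"
    and 0: "br v1 v3 = 0" "br v1 v4 = 0" "br v2 v4 = 0" "br v2 v5 = 0" "br v3 v5 = 0"
  shows "lie_isomorphic L (lie_of (listed_pres 7))"
proof -
  let ?es = "[pos_bracket 1 2 1, pos_bracket 2 3 2, pos_bracket 3 4 3, pos_bracket 4 5 4, pos_bracket 5 1 5]"
  let ?c = "colour_vec [br v1 v2, br v2 v3, br v3 v4, br v4 v5, br v5 v1]"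
  have c: "?c t \<in> span Z" for t
    using br_in_span_Z V by (intro colour_vec_span) auto
  have proper: "proper_pres (zs 5) ?es" by code_simp
  have "br v1 v5 = - br v5 v1" using V by (intro br_skew) auto
  then show ?thesis
    unfolding listed_pres_eq
    by (intro lie_isomorphic_pres_5[of v1 v2 v3 v4 v5 "zs 5" ?es ?c 1 1 1 1 1, OF q V proper _ c])
       (simp_all add: p 0 zs_def colour_vec_def del: One_nat_def)
qed

lemma free_brackets_4: "free_brackets 4 = [((1, 2), (True, ZZS 1 2)), ((1, 3), (True, ZZS 1 3)), ((1, 4), (True, ZZS 1 4)),
    ((2, 3), (True, ZZS 2 3)), ((2, 4), (True, ZZS 2 4)), ((3, 4), (True, ZZS 3 4))]"
  and length_free_symbols_4: "length (free_symbols 4) = 6"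
  by code_simp+

lemma iso_listed_10:
  assumes q: "q = 4" and V: "V = {v1, v2, v3, v4}" and p: "p = 6"
  shows "lie_isomorphic L (lie_of (listed_pres 10))"
proof -
  let ?c = "free_vec [v1, v2, v3, v4]"
  have c: "?c t \<in> span Z" for t using V by (intro free_vec_span) simp
  have proper: "proper_pres (free_symbols 4) (free_brackets 4)" by code_simp
  show ?thesis
    unfolding listed_pres_eq
    by (rule lie_isomorphic_pres_4[of v1 v2 v3 v4 "free_symbols 4" "free_brackets 4" ?c 1 1 1 1, OF q V proper _ c])
       (simp_all add: p length_free_symbols_4 free_brackets_4 free_vec_def del: One_nat_def)
qed

lemma free_brackets_5: "free_brackets 5 = [((1, 2), (True, ZZS 1 2)), ((1, 3), (True, ZZS 1 3)), ((1, 4), (True, ZZS 1 4)),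
    ((1, 5), (True, ZZS 1 5)), ((2, 3), (True, ZZS 2 3)), ((2, 4), (True, ZZS 2 4)), ((2, 5), (True, ZZS 2 5)),
    ((3, 4), (True, ZZS 3 4)), ((3, 5), (True, ZZS 3 5)), ((4, 5), (True, ZZS 4 5))]"
  and length_free_symbols_5: "length (free_symbols 5) = 10"
  by code_simp+

lemma iso_listed_12:
  assumes q: "q = 5" and V: "V = {v1, v2, v3, v4, v5}" and p: "p = 10"
  shows "lie_isomorphic L (lie_of (listed_pres 12))"
proof -
  let ?c = "free_vec [v1, v2, v3, v4, v5]"
  have c: "?c t \<in> span Z" for t using V by (intro free_vec_span) simp
  have proper: "proper_pres (free_symbols 5) (free_brackets 5)" by code_simp
  show ?thesis
    unfolding listed_pres_eq
    by (rule lie_isomorphic_pres_5[of v1 v2 v3 v4 v5 "free_symbols 5" "free_brackets 5" ?c 1 1 1 1 1, OF q V proper _ c])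
       (simp_all add: p length_free_symbols_5 free_brackets_5 free_vec_def del: One_nat_def)
qed

end

text \<open>The second presentation is a Heisenberg algebra over the split-complex numbers, whose
  idempotents split it in two. Sums and differences of generators realise this: the mixed brackets
  cancel, and the two remaining ones are 2(z1 + z2) and 2(z1 - z2). The list \<open>?as\<close>
  places the sums in positions 1, 2 and the differences in positions 3, 4.\<close>

lemma alt_pres_isomorphic_3: "lie_isomorphic (lie_of alt_pres_3) (lie_of (listed_pres 3))"
proof -
  let ?alt = "[pos_bracket 1 3 1, pos_bracket 2 4 1, pos_bracket 1 4 2, pos_bracket 2 3 2]"
  let ?L = "lie_of (pres_of 4 (zs 2) ?alt)"
  let ?es = "[pos_bracket 1 2 1, pos_bracket 3 4 2]"
  let ?as = "[vv 1 + vv 2, vv 3 + vv 4, vv 1 - vv 2, vv 3 - vv 4]"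
  let ?b = "lie_bracket ?L"
  obtain s where "uniform_algebra (lie_of alt_pres_3) (pres_V alt_pres_3) (pres_Z alt_pres_3) 2 4 2 s"
    by (rule displays_type_uniform_algebra[OF displays_alt])
  then have "uniform_algebra ?L (vv ` {1..4}) (unit_vec ` set (zs 2)) 2 4 2 s"
    unfolding listed_pres_eq by (simp add: pres_of_def)
  then interpret A: uniform_algebra ?L "vv ` {1..4}" "unit_vec ` set (zs 2)" 2 4 2 s .
  have four: "{1..4::nat} = {1, 2, 3, 4}" by code_simp
  have sV: "vv i \<in> span (vv ` {1..4})" if "i \<in> {1..4}" for i
    using that by (intro span_base) simp
  have asV: "?as ! (i - 1) \<in> span (vv ` {1..4})" if "i \<in> {1..4}" for i
  proof -
    have "i = 1 \<or> i = 2 \<or> i = 3 \<or> i = 4" using that unfolding atLeastAtMost_iff by presburger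
    then show ?thesis
      using sV[of 1] sV[of 2] sV[of 3] sV[of 4]
      by (elim disjE; hypsubst; simp add: span_add span_diff del: One_nat_def)
  qed
  have asL: "?as ! (i - 1) \<in> lie_space ?L" if "i \<in> {1..4}" for i
    using asV[OF that] A.span_VZ span_mono[of "vv ` {1..4}" "vv ` {1..4} \<union> unit_vec ` set (zs 2)"] by blast
  let ?c = "colour_vec [?b (vv 1 + vv 2) (vv 3 + vv 4), ?b (vv 1 - vv 2) (vv 3 - vv 4)]"
  have "lie_isomorphic ?L (lie_of (pres_of 4 (zs 2) ?es))"
  proof (rule A.lie_isomorphic_pres[where a = "\<lambda>i. ?as ! (i - 1)" and c = ?c])
    show "proper_pres (zs 2) ?es" by code_simp
    show "length (zs 2) = 2" by (simp add: zs_def)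
    show "?as ! (i - 1) \<in> span (vv ` {1..4})" if "i \<in> {1..4}" for i by (rule asV[OF that])
    show "vv ` {1..4} \<subseteq> span ((\<lambda>i. ?as ! (i - 1)) ` {1..4})"
    proof -
      let ?S = "span (set ?as)"
      have mem: "vv 1 + vv 2 \<in> ?S" "vv 3 + vv 4 \<in> ?S" "vv 1 - vv 2 \<in> ?S" "vv 3 - vv 4 \<in> ?S"
        by (intro span_base; simp)+
      have half: "x \<in> ?S" "y \<in> ?S" if "x + y \<in> ?S" "x - y \<in> ?S" for x y
      proof -
        have "x = (1/2) *\<^sub>R ((x + y) + (x - y))" "y = (1/2) *\<^sub>R ((x + y) - (x - y))"
          by (simp_all add: scaleR_2[symmetric])
        then show "x \<in> ?S" "y \<in> ?S" using that by (metis span_add span_diff span_scale)+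
      qed
      have "vv ` {1..4} \<subseteq> ?S"
        unfolding four using half[OF mem(1,3)] half[OF mem(2,4)] by simp
      moreover have "set ?as = (\<lambda>i. ?as ! (i - 1)) ` {1..4}" by (rule A.set_eq_nth_image) simp
      ultimately show ?thesis by simp
    qed
    show "?c t \<in> span (unit_vec ` set (zs 2))" for t
    proof (rule colour_vec_span)
      have "?b (?as ! (i - 1)) (?as ! (j - 1)) \<in> span (unit_vec ` set (zs 2))"
        if "i \<in> {1..4}" "j \<in> {1..4}" for i j
        using A.derived_subset asL[OF that(1)] asL[OF that(2)] by (auto simp: derived_def)
      from this[of 1 2] this[of 3 4]
      show "set [?b (vv 1 + vv 2) (vv 3 + vv 4), ?b (vv 1 - vv 2) (vv 3 - vv 4)]
          \<subseteq> span (unit_vec ` set (zs 2))" by (simp del: One_nat_def)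
    qed
    show "?b (?as ! (i - 1)) (?as ! (j - 1)) = opt_signed ?c (table ?es i j)"
      if ij: "1 \<le> i" "i < j" "j \<le> 4" for i j
    proof -
      have 0: "?b (vv 1 + vv 2) (vv 1 - vv 2) = 0" "?b (vv 1 + vv 2) (vv 3 - vv 4) = 0"
        "?b (vv 3 + vv 4) (vv 1 - vv 2) = 0" "?b (vv 3 + vv 4) (vv 3 - vv 4) = 0"
        by (simp_all add: bracket_eval)
      have "i = 1 \<and> j = 2 \<or> i = 1 \<and> j = 3 \<or> i = 1 \<and> j = 4 \<or> i = 2 \<and> j = 3 \<or> i = 2 \<and> j = 4 \<or> i = 3 \<and> j = 4"
        using ij by presburger
      then show ?thesis
        by (elim disjE conjE; hypsubst; simp add: 0 colour_vec_def del: One_nat_def lie_of.simps)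
    qed
  qed
  then show ?thesis unfolding listed_pres_eq .
qed

context uniform_algebra
begin

section \<open>Relative signs when each colour has two edges\<close>

lemma adj_le_1: "adj x y \<le> 1" and adj_eq_0: "adj x y = 0 \<longleftrightarrow> br x y = 0"
  and adj_eq_1: "adj x y = 1 \<longleftrightarrow> br x y \<noteq> 0"
  by (simp_all add: adj_def)

text \<open>On the four-cycle every vertex meets one edge of each colour, so negating a generator
  changes \<open>a\<close> and \<open>b\<close> together. The product of the two signs survives: 1
  gives the complex form (6), -1 the split form (3).\<close>

lemma iso_listed_6_or_3:
  assumes q: "q = 4" and V: "V = {v1, v2, v3, v4}" and p: "p = 2" and r: "r = 2"
    and n0: "br v1 v2 \<noteq> 0" "br v2 v3 \<noteq> 0" and 0: "br v1 v3 = 0" "br v2 v4 = 0"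
  shows "lie_isomorphic L (lie_of (listed_pres 6)) \<or> lie_isomorphic L (lie_of (listed_pres 3))"
proof -
  have V': "V = {v2, v3, v1, v4}" using V by auto
  obtain a where a: "a \<in> {1, -1 :: real}" "br v3 v4 = a *\<^sub>R br v1 v2"
    using sim_sign[OF partner_4[OF r V n0(1)]] .
  obtain b where b: "b \<in> {1, -1 :: real}" "br v1 v4 = b *\<^sub>R br v2 v3"
    using sim_sign[OF partner_4[OF r V' n0(2)]] .
  have skew: "br v3 v2 = - br v2 v3" using V by (intro br_skew) auto
  show ?thesis
  proof (cases "a = b")
    case True
    let ?es = "[pos_bracket 1 2 1, pos_bracket 3 4 1, pos_bracket 2 3 2, pos_bracket 1 4 2]"
    let ?c = "colour_vec [br v3 v4, br v2 v3]"
    have c: "?c t \<in> span Z" for t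
      using br_in_span_Z V by (intro colour_vec_span) auto
    have proper: "proper_pres (zs 2) ?es" by code_simp
    have "lie_isomorphic L (lie_of (listed_pres 6))"
      unfolding listed_pres_eq
      by (rule lie_isomorphic_pres_4[of v1 v2 v3 v4 "zs 2" ?es ?c a 1 1 1, OF q V proper _ c])
         (use a b True sign_square[OF a(1)] in \<open>simp_all add: p 0 zs_def colour_vec_def del: One_nat_def\<close>)
    then show ?thesis ..
  next
    case False
    then have ab: "b = - a" using a(1) b(1) by auto
    let ?es = "[pos_bracket 1 3 1, pos_bracket 2 4 1, pos_bracket 1 4 2, pos_bracket 2 3 2]"
    let ?c = "colour_vec [br v3 v4, br v3 v2]"
    \<comment> \<open>Exchanging the middle generators moves the cycle into the layout of the second
      presentation, where \<open>v1\<close> and \<open>v2\<close> are not adjacent.\<close>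
    have V'': "V = {v1, v3, v2, v4}" using V by auto
    have c: "?c t \<in> span Z" for t
      using br_in_span_Z V by (intro colour_vec_span) auto
    have proper: "proper_pres (zs 2) ?es" by code_simp
    have "lie_isomorphic L (lie_of alt_pres_3)"
      unfolding listed_pres_eq
      by (rule lie_isomorphic_pres_4[of v1 v3 v2 v4 "zs 2" ?es ?c a 1 1 1, OF q V'' proper _ c])
         (use a b ab sign_square[OF a(1)] skew in \<open>simp_all add: p 0 zs_def colour_vec_def del: One_nat_def\<close>)
    then show ?thesis using lie_isomorphic_trans alt_pres_isomorphic_3 by blast
  qed
qed

text \<open>Negating \<open>v1\<close> changes its three brackets and leaves the other three alone,
  so one factor \<open>e\<close> common to all relations can be removed at once. The same holds in
  the split case below.\<close>

lemma iso_listed_8: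
  assumes q: "q = 4" and V: "V = {v1, v2, v3, v4}" and p: "p = 3" and e: "e \<in> {1, -1 :: real}"
    and br: "br v3 v4 = e *\<^sub>R br v1 v2" "br v2 v4 = (- e) *\<^sub>R br v1 v3" "br v2 v3 = e *\<^sub>R br v1 v4"
  shows "lie_isomorphic L (lie_of (listed_pres 8))"
proof -
  let ?es = "[pos_bracket 1 2 1, pos_bracket 3 4 1, pos_bracket 1 3 2, neg_bracket 2 4 2,
     pos_bracket 1 4 3, pos_bracket 2 3 3]"
  let ?c = "colour_vec [e *\<^sub>R br v1 v2, e *\<^sub>R br v1 v3, e *\<^sub>R br v1 v4]"
  have c: "?c t \<in> span Z" for t
    using br_in_span_Z V by (intro colour_vec_span) (auto intro: span_scale)
  have proper: "proper_pres (zs 3) ?es" by code_simp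
  show ?thesis
    unfolding listed_pres_eq
    by (rule lie_isomorphic_pres_4[of v1 v2 v3 v4 "zs 3" ?es ?c e 1 1 1, OF q V proper _ c])
       (use e br in \<open>simp_all add: p zs_def colour_vec_def del: One_nat_def\<close>)
qed

lemma iso_listed_9:
  assumes q: "q = 4" and V: "V = {v1, v2, v3, v4}" and p: "p = 3" and e: "e \<in> {1, -1 :: real}"
    and br: "br v3 v4 = e *\<^sub>R br v1 v2" "br v2 v4 = e *\<^sub>R br v1 v3" "br v2 v3 = (- e) *\<^sub>R br v1 v4"
  shows "lie_isomorphic L (lie_of (listed_pres 9))"
proof -
  let ?es = "[pos_bracket 1 2 1, pos_bracket 3 4 1, pos_bracket 1 3 2, pos_bracket 2 4 2,
     pos_bracket 1 4 3, neg_bracket 2 3 3]"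
  let ?c = "colour_vec [e *\<^sub>R br v1 v2, e *\<^sub>R br v1 v3, e *\<^sub>R br v1 v4]"
  have c: "?c t \<in> span Z" for t
    using br_in_span_Z V by (intro colour_vec_span) (auto intro: span_scale)
  have proper: "proper_pres (zs 3) ?es" by code_simp
  show ?thesis
    unfolding listed_pres_eq
    by (rule lie_isomorphic_pres_4[of v1 v2 v3 v4 "zs 3" ?es ?c e 1 1 1, OF q V proper _ c])
       (use e br in \<open>simp_all add: p zs_def colour_vec_def del: One_nat_def\<close>)
qed

text \<open>Up to a common factor, the relative signs of the three perfect matchings form four
  patterns. One is quaternionic; exchanging \<open>v2\<close> with \<open>v3\<close> or with
  \<open>v4\<close> carries two of the other patterns into the standard split one, the swapped
  orientations supplying the missing minus signs.\<close>

lemma iso_listed_8_or_9: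
  assumes q: "q = 4" and V: "V = {v1, v2, v3, v4}" and p: "p = 3" and r: "r = 2"
    and n0: "br v1 v2 \<noteq> 0" "br v1 v3 \<noteq> 0" "br v1 v4 \<noteq> 0"
  shows "lie_isomorphic L (lie_of (listed_pres 8)) \<or> lie_isomorphic L (lie_of (listed_pres 9))"
proof -
  have V': "V = {v1, v3, v2, v4}" and V'': "V = {v1, v4, v2, v3}" and V3: "V = {v1, v4, v3, v2}"
    using V by auto
  obtain a where a: "a \<in> {1, -1 :: real}" "br v3 v4 = a *\<^sub>R br v1 v2"
    using sim_sign[OF partner_4[OF r V n0(1)]] .
  obtain b where b: "b \<in> {1, -1 :: real}" "br v2 v4 = b *\<^sub>R br v1 v3"
    using sim_sign[OF partner_4[OF r V' n0(2)]] .
  obtain d where d: "d \<in> {1, -1 :: real}" "br v2 v3 = d *\<^sub>R br v1 v4"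
    using sim_sign[OF partner_4[OF r V'' n0(3)]] .
  have skew: "br v3 v2 = - br v2 v3" "br v4 v2 = - br v2 v4" "br v4 v3 = - br v3 v4"
    using V by (auto intro!: br_skew)
  consider "b = - a" "d = a" | "b = a" "d = - a" | "b = a" "d = a" | "b = - a" "d = - a"
    using a(1) b(1) d(1) by auto
  then show ?thesis
  proof cases
    case 1
    show ?thesis by (rule disjI1, rule iso_listed_8[OF q V p a(1)]) (use a b d 1 in simp_all)
  next
    case 2
    show ?thesis by (rule disjI2, rule iso_listed_9[OF q V p a(1)]) (use a b d 2 in simp_all)
  next
    case 3
    show ?thesis by (rule disjI2, rule iso_listed_9[OF q V' p a(1)]) (use a b d 3 skew in simp_all)
  next
    case 4
    show ?thesis by (rule disjI2, rule iso_listed_9[OF q V3 p a(1)]) (use a b d 4 skew in simp_all)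
  qed
qed

text \<open>Flipping \<open>v\<^sub>i\<close> changes the signs of all colours except the one that misses \<open>v\<^sub>i\<close>; this is
  where the scaling factors come from.\<close>

lemma iso_listed_11_even:
  assumes q: "q = 5" and V: "V = {v1, v2, v3, v4, v5}" and p: "p = 5"
    and e: "e1 \<in> {1, -1 :: real}" "e2 \<in> {1, -1 :: real}" "e3 \<in> {1, -1 :: real}"
      "e4 \<in> {1, -1 :: real}" "e5 \<in> {1, -1 :: real}" and even: "e1 * e2 * e3 * e4 * e5 = 1"
    and br: "br v2 v4 = e1 *\<^sub>R br v1 v5" "br v3 v4 = e2 *\<^sub>R br v2 v5" "br v4 v5 = e3 *\<^sub>R br v1 v3"
      "br v3 v5 = e4 *\<^sub>R br v1 v2" "br v2 v3 = e5 *\<^sub>R br v1 v4"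
  shows "lie_isomorphic L (lie_of (listed_pres 11))"
proof -
  let ?es = "[pos_bracket 1 5 1, pos_bracket 2 4 1, pos_bracket 2 5 2, pos_bracket 3 4 2,
     pos_bracket 1 3 3, pos_bracket 4 5 3, pos_bracket 3 5 4, pos_bracket 1 2 4, pos_bracket 1 4 5, pos_bracket 2 3 5]"
  let ?c = "colour_vec [(e2 * e5) *\<^sub>R br v1 v5, (e3 * e5) *\<^sub>R br v2 v5, (e2 * e1) *\<^sub>R br v1 v3,
     (e2 * e3) *\<^sub>R br v1 v2, (e2 * e4) *\<^sub>R br v1 v4]"
  have c: "?c t \<in> span Z" for t
    using br_in_span_Z V by (intro colour_vec_span) (auto intro: span_scale)
  have proper: "proper_pres (zs 5) ?es" by code_simp
  \<comment> \<open>The product of all five signs is 1 and each sign is its own inverse, so the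
    product of any three equals that of the other two.\<close>
  have prods: "e3 * e4 * e1 = e2 * e5" "e1 * e4 * e2 = e3 * e5" "e4 * e5 * e3 = e2 * e1"
    "e1 * e5 * e4 = e2 * e3" "e3 * e1 * e5 = e2 * e4"
    using e even by auto
  \<comment> \<open>Each generator is scaled by the relative sign of the colour that misses it:
    \<open>e2\<close>, \<open>e3\<close>, \<open>e1\<close>, \<open>e4\<close>, \<open>e5\<close> in
    turn. The relative sign of a colour is thereby multiplied by the other four signs and becomes
    the total product, which is 1.\<close>
  show ?thesis
    unfolding listed_pres_eq
    by (rule lie_isomorphic_pres_5[of v1 v2 v3 v4 v5 "zs 5" ?es ?c e2 e3 e1 e4 e5, OF q V proper _ c])
       (use e in \<open>simp_all add: p br prods zs_def colour_vec_def del: One_nat_def\<close>)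
qed

lemma iso_listed_11_signed:
  assumes q: "q = 5" and V: "V = {v1, v2, v3, v4, v5}" and p: "p = 5"
    and sim: "sim v1 v5 v2 v4" "sim v2 v5 v3 v4" "sim v1 v3 v4 v5" "sim v1 v2 v3 v5" "sim v1 v4 v2 v3"
  shows "lie_isomorphic L (lie_of (listed_pres 11))"
proof -
  obtain e1 where 1: "e1 \<in> {1, -1 :: real}" "br v2 v4 = e1 *\<^sub>R br v1 v5" using sim_sign[OF sim(1)] .
  obtain e2 where 2: "e2 \<in> {1, -1 :: real}" "br v3 v4 = e2 *\<^sub>R br v2 v5" using sim_sign[OF sim(2)] .
  obtain e3 where 3: "e3 \<in> {1, -1 :: real}" "br v4 v5 = e3 *\<^sub>R br v1 v3" using sim_sign[OF sim(3)] .
  obtain e4 where 4: "e4 \<in> {1, -1 :: real}" "br v3 v5 = e4 *\<^sub>R br v1 v2" using sim_sign[OF sim(4)] .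
  obtain e5 where 5: "e5 \<in> {1, -1 :: real}" "br v2 v3 = e5 *\<^sub>R br v1 v4" using sim_sign[OF sim(5)] .
  show ?thesis
  proof (cases "e1 * e2 * e3 * e4 * e5 = 1")
    case True
    show ?thesis
      by (rule iso_listed_11_even[OF q V p 1(1) 2(1) 3(1) 4(1) 5(1) True 1(2) 2(2) 3(2) 4(2) 5(2)])
  next
    case False
    \<comment> \<open>This relabelling preserves the colouring and changes the parity of the signs.\<close>
    have V': "V = {v1, v3, v5, v2, v4}" using V by auto
    have skew: "br v3 v2 = - br v2 v3" "br v5 v2 = - br v2 v5" "br v5 v4 = - br v4 v5"
      using V by (auto intro!: br_skew)
    \<comment> \<open>The relabelling permutes the five relations and reverses the orientation in
      three of them; an odd number of minus signs makes the product 1.\<close>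
    have "(- e5) * (- e2) * e1 * (- e3) * e4 = 1"
      using False 1(1) 2(1) 3(1) 4(1) 5(1) by auto
    then show ?thesis
      by (rule iso_listed_11_even[OF q V' p, rotated 5])
         (use 1 2 3 4 5 skew sign_square[OF 2(1)] in auto)
  qed
qed

text \<open>Two colours determine the whole colouring. Each remaining edge at \<open>v1\<close> has
  three possible partners, and properness excludes two of them because their colour already occurs
  at a common vertex.\<close>

lemma iso_listed_11:
  assumes q: "q = 5" and V: "V = {v1, v2, v3, v4, v5}" and dist: "distinct [v1, v2, v3, v4, v5]"
    and p: "p = 5" and r: "r = 2" and s: "s = 4"
    and sim: "sim v2 v5 v3 v4" "sim v1 v2 v3 v5"
  shows "lie_isomorphic L (lie_of (listed_pres 11))"
proof -
  have mem: "v1 \<in> V" "v2 \<in> V" "v3 \<in> V" "v4 \<in> V" "v5 \<in> V" using V by auto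
  have n0: "br x y \<noteq> 0" if "x \<in> V" "y \<in> V" "x \<noteq> y" for x y
    using complete_graph that s q by simp
  \<comment> \<open>Two distinct edges that meet cannot share a partner, for they would then have
    the same colour.\<close>
  have clash: False if "sim x y a b" "sim x' y' a b" "{x, y} \<inter> {x', y'} \<noteq> {}" "{x, y} \<noteq> {x', y'}"
    "x \<in> V" "y \<in> V" "x' \<in> V" "y' \<in> V" "x \<noteq> y" for x y x' y' a b
    using sim_disjoint[OF that(5-8) n0[OF that(5,6,9)] sim_trans[OF that(1) sim_sym[OF that(2)]]] that(3,4)
    by blast
  have ne: "v1 \<noteq> v2" "v1 \<noteq> v3" "v1 \<noteq> v4" "v1 \<noteq> v5" "v2 \<noteq> v3" "v2 \<noteq> v4" "v2 \<noteq> v5" "v3 \<noteq> v4" "v3 \<noteq> v5" "v4 \<noteq> v5"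
    using dist by auto
  have P14: "sim v1 v4 v2 v3 \<or> sim v1 v4 v2 v5 \<or> sim v1 v4 v3 v5"
    using V ne(3) mem by (intro partner_5[OF r _ n0]) auto
  have "\<not> sim v1 v4 v2 v5"
    using clash[of v1 v4 v2 v5 v3 v4] sim_sym[OF sim(1)] mem ne by (auto simp: doubleton_eq_iff)
  moreover have "\<not> sim v1 v4 v3 v5"
    using clash[of v1 v4 v3 v5 v1 v2] sim(2) mem ne by (auto simp: doubleton_eq_iff)
  ultimately have 14: "sim v1 v4 v2 v3" using P14 by blast
  have P15: "sim v1 v5 v2 v3 \<or> sim v1 v5 v2 v4 \<or> sim v1 v5 v3 v4"
    using V ne(4) mem by (intro partner_5[OF r _ n0]) auto
  have "\<not> sim v1 v5 v2 v3"
    using clash[of v1 v5 v2 v3 v1 v4] 14 mem ne by (auto simp: doubleton_eq_iff)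
  moreover have "\<not> sim v1 v5 v3 v4"
    using clash[of v1 v5 v3 v4 v2 v5] sim(1) mem ne by (auto simp: doubleton_eq_iff)
  ultimately have 15: "sim v1 v5 v2 v4" using P15 by blast
  have P13: "sim v1 v3 v2 v4 \<or> sim v1 v3 v2 v5 \<or> sim v1 v3 v4 v5"
    using V ne(2) mem by (intro partner_5[OF r _ n0]) auto
  have "\<not> sim v1 v3 v2 v4"
    using clash[of v1 v3 v2 v4 v1 v5] 15 mem ne by (auto simp: doubleton_eq_iff)
  moreover have "\<not> sim v1 v3 v2 v5"
    using clash[of v1 v3 v2 v5 v3 v4] sim_sym[OF sim(1)] mem ne by (auto simp: doubleton_eq_iff)
  ultimately have 13: "sim v1 v3 v4 v5" using P13 by blast
  show ?thesis by (rule iso_listed_11_signed[OF q V p 15 sim(1) 13 sim(2) 14])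
qed

section \<open>Case analysis by the number of generators\<close>

lemma enumerate_V:
  obtains vs where "V = set vs" "distinct vs" "length vs = q"
  using finite_distinct_list[OF finite_V] distinct_card card_V by metis

lemma p_value:
  assumes "q * s = 2 * (k * r)"
  shows "p = k"
proof -
  have "2 * (p * r) = 2 * (k * r)" using handshake assms by (simp only: mult.assoc)
  then show ?thesis using pos(3) by auto
qed

text \<open>A regular graph of degree 1, 2 or 3 on four vertices is a perfect matching, a four-cycle
  or complete. With r equal to 1 or 2 this gives six cases, and the counting identity supplies
  \<open>p\<close> in each.\<close>

lemma classify_4:
  assumes q: "q = 4"
  shows "\<exists>k\<in>{1..12}. lie_isomorphic L (lie_of (listed_pres k))"
proof -
  obtain vs where vs: "V = set vs" "distinct vs" "length vs = 4" using enumerate_V q by metis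
  then obtain v1 v2 v3 v4 where v: "vs = [v1, v2, v3, v4]"
    by (auto simp: numeral_eq_Suc length_Suc_conv)
  have V: "V = {v1, v2, v3, v4}" using vs v by simp
  have mem: "v1 \<in> V" "v2 \<in> V" "v3 \<in> V" "v4 \<in> V" using V by auto
  have ne: "v1 \<noteq> v2" "v1 \<noteq> v3" "v1 \<noteq> v4" using vs(2) v by auto
  have deg: "adj v1 v2 + adj v1 v3 + adj v1 v4 = s" "adj v1 v2 + adj v2 v3 + adj v2 v4 = s"
    "adj v1 v3 + adj v2 v3 + adj v3 v4 = s" "adj v1 v4 + adj v2 v4 + adj v3 v4 = s"
    using degree_adj[OF vs(1,2) mem(1)] degree_adj[OF vs(1,2) mem(2)] degree_adj[OF vs(1,2) mem(3)]
      degree_adj[OF vs(1,2) mem(4)] adj_sym[OF mem(1,2)] adj_sym[OF mem(1,3)] adj_sym[OF mem(1,4)]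
      adj_sym[OF mem(2,3)] adj_sym[OF mem(2,4)] adj_sym[OF mem(3,4)] adj_self[OF mem(1)]
      adj_self[OF mem(2)] adj_self[OF mem(3)] adj_self[OF mem(4)]
    by (simp_all add: v)
  have s: "s = 1 \<or> s = 2 \<or> s = 3" using degree_less pos(4) q by auto
  have r: "r = 1 \<or> r = 2" using colour_class_matching pos(3) q by auto
  \<comment> \<open>The cases are prepared for an arbitrary naming of the vertices, since the degree
    equations determine the graph only up to relabelling.\<close>
  have one: ?thesis if s: "s = 1" and V: "V = {x1, x2, x3, x4}" and n0: "br x1 x2 \<noteq> 0"
    and 0: "br x1 x3 = 0" "br x1 x4 = 0" "br x2 x3 = 0" "br x2 x4 = 0" for x1 x2 x3 x4
    using r
  proof
    assume r: "r = 1"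
    have "lie_isomorphic L (lie_of (listed_pres 3))"
      by (rule iso_listed_3[OF q V p_value 0]) (simp add: q s r)
    then show ?thesis by (intro bexI[of _ 3]) simp_all
  next
    assume r: "r = 2"
    have "lie_isomorphic L (lie_of (listed_pres 2))"
      by (rule iso_listed_2[OF q V p_value r n0 0]) (simp add: q s r)
    then show ?thesis by (intro bexI[of _ 2]) simp_all
  qed
  have two: ?thesis if s: "s = 2" and V: "V = {x1, x2, x3, x4}" and n0: "br x1 x2 \<noteq> 0" "br x2 x3 \<noteq> 0"
    and 0: "br x1 x3 = 0" "br x2 x4 = 0" for x1 x2 x3 x4
    using r
  proof
    assume r: "r = 1"
    have "lie_isomorphic L (lie_of (listed_pres 5))"
      by (rule iso_listed_5[OF q V p_value 0]) (simp add: q s r)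
    then show ?thesis by (intro bexI[of _ 5]) simp_all
  next
    assume r: "r = 2"
    have "lie_isomorphic L (lie_of (listed_pres 6)) \<or> lie_isomorphic L (lie_of (listed_pres 3))"
      by (rule iso_listed_6_or_3[OF q V p_value r n0 0]) (simp add: q s r)
    then show ?thesis
    proof
      assume "lie_isomorphic L (lie_of (listed_pres 6))"
      then show ?thesis by (intro bexI[of _ 6]) simp_all
    next
      assume "lie_isomorphic L (lie_of (listed_pres 3))"
      then show ?thesis by (intro bexI[of _ 3]) simp_all
    qed
  qed
  have three: ?thesis if s: "s = 3"
    using r
  proof
    assume r: "r = 1"
    have "lie_isomorphic L (lie_of (listed_pres 10))"
      by (rule iso_listed_10[OF q V p_value]) (simp add: q s r)
    then show ?thesis by (intro bexI[of _ 10]) simp_all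
  next
    assume r: "r = 2"
    have n0: "br v1 v2 \<noteq> 0" "br v1 v3 \<noteq> 0" "br v1 v4 \<noteq> 0"
      using complete_graph mem ne s q by simp_all
    have "lie_isomorphic L (lie_of (listed_pres 8)) \<or> lie_isomorphic L (lie_of (listed_pres 9))"
      by (rule iso_listed_8_or_9[OF q V p_value r n0]) (simp add: q s r)
    then show ?thesis
    proof
      assume "lie_isomorphic L (lie_of (listed_pres 8))"
      then show ?thesis by (intro bexI[of _ 8]) simp_all
    next
      assume "lie_isomorphic L (lie_of (listed_pres 9))"
      then show ?thesis by (intro bexI[of _ 9]) simp_all
    qed
  qed
  have V': "V = {v1, v3, v2, v4}" "V = {v1, v4, v2, v3}" "V = {v1, v3, v4, v2}" "V = {v1, v2, v4, v3}"
    using V by auto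
  have skew: "br v3 v2 = 0 \<longleftrightarrow> br v2 v3 = 0" "br v4 v2 = 0 \<longleftrightarrow> br v2 v4 = 0" "br v4 v3 = 0 \<longleftrightarrow> br v3 v4 = 0"
    using br_skew[OF mem(2,3)] br_skew[OF mem(2,4)] br_skew[OF mem(3,4)] by simp_all
  note le = adj_le_1[of v1 v2] adj_le_1[of v1 v3] adj_le_1[of v1 v4] adj_le_1[of v2 v3] adj_le_1[of v2 v4]
    adj_le_1[of v3 v4]
  from s show ?thesis
  proof (elim disjE)
    assume s: "s = 1"
    consider "adj v1 v2 = 1" | "adj v1 v3 = 1" | "adj v1 v4 = 1" using deg(1) le s by linarith
    then show ?thesis
    proof cases
      case 1
      then have "adj v1 v3 = 0" "adj v1 v4 = 0" "adj v2 v3 = 0" "adj v2 v4 = 0" using deg s by linarith+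
      with 1 show ?thesis by (intro one[OF s V]) (simp_all only: adj_eq_0 adj_eq_1 not_False_eq_True)
    next
      case 2
      then have "adj v1 v2 = 0" "adj v1 v4 = 0" "adj v2 v3 = 0" "adj v3 v4 = 0" using deg s by linarith+
      with 2 show ?thesis by (intro one[OF s V'(1)]) (simp_all only: adj_eq_0 adj_eq_1 skew not_False_eq_True)
    next
      case 3
      then have "adj v1 v2 = 0" "adj v1 v3 = 0" "adj v2 v4 = 0" "adj v3 v4 = 0" using deg s by linarith+
      with 3 show ?thesis by (intro one[OF s V'(2)]) (simp_all only: adj_eq_0 adj_eq_1 skew not_False_eq_True)
    qed
  next
    assume s: "s = 2"
    \<comment> \<open>The only non-neighbour of \<open>v1\<close> is its opposite vertex, and this
      choice determines the four-cycle.\<close>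
    consider "adj v1 v2 = 0" | "adj v1 v3 = 0" | "adj v1 v4 = 0" using deg(1) le s by linarith
    then show ?thesis
    proof cases
      case 1
      then have "adj v1 v3 = 1" "adj v2 v3 = 1" "adj v3 v4 = 0" using deg le s by linarith+
      with 1 show ?thesis by (intro two[OF s V'(1)]) (simp_all only: adj_eq_0 adj_eq_1 skew not_False_eq_True)
    next
      case 2
      then have "adj v1 v2 = 1" "adj v2 v3 = 1" "adj v2 v4 = 0" using deg le s by linarith+
      with 2 show ?thesis by (intro two[OF s V]) (simp_all only: adj_eq_0 adj_eq_1 not_False_eq_True)
    next
      case 3
      then have "adj v1 v2 = 1" "adj v2 v4 = 1" "adj v2 v3 = 0" using deg le s by linarith+
      with 3 show ?thesis by (intro two[OF s V'(4)]) (simp_all only: adj_eq_0 adj_eq_1 not_False_eq_True)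
    qed
  next
    assume "s = 3"
    then show ?thesis by (rule three)
  qed
qed

text \<open>A 2-regular graph on five vertices is a single cycle, because two disjoint cycles would
  need at least six. Fixing the two non-neighbours of \<open>v1\<close> leaves one choice, resolved
  by exchanging \<open>v3\<close> and \<open>v4\<close>.\<close>

lemma classify_5_cycle:
  assumes q: "q = 5" and s: "s = 2" and r: "r = 1"
    and V: "V = {v1, v2, v3, v4, v5}" and dist: "distinct [v1, v2, v3, v4, v5]"
    and 0: "br v1 v3 = 0" "br v1 v4 = 0"
  shows "lie_isomorphic L (lie_of (listed_pres 7))"
proof -
  have p: "p = 5" by (rule p_value) (simp add: q s r)
  have vs: "V = set [v1, v2, v3, v4, v5]" using V by simp
  have mem: "v1 \<in> V" "v2 \<in> V" "v3 \<in> V" "v4 \<in> V" "v5 \<in> V" using V by auto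
  have adj0: "adj v1 v3 = 0" "adj v1 v4 = 0" using 0 by (simp_all add: adj_def)
  have deg: "adj v1 v2 + adj v1 v5 = 2" "adj v1 v2 + adj v2 v3 + adj v2 v4 + adj v2 v5 = 2"
    "adj v2 v3 + adj v3 v4 + adj v3 v5 = 2" "adj v2 v4 + adj v3 v4 + adj v4 v5 = 2"
    "adj v1 v5 + adj v2 v5 + adj v3 v5 + adj v4 v5 = 2"
    using degree_adj[OF vs dist mem(1)] degree_adj[OF vs dist mem(2)] degree_adj[OF vs dist mem(3)]
      degree_adj[OF vs dist mem(4)] degree_adj[OF vs dist mem(5)]
      adj_sym[OF mem(1,2)] adj_sym[OF mem(1,3)] adj_sym[OF mem(1,4)] adj_sym[OF mem(1,5)]
      adj_sym[OF mem(2,3)] adj_sym[OF mem(2,4)] adj_sym[OF mem(2,5)] adj_sym[OF mem(3,4)]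
      adj_sym[OF mem(3,5)] adj_sym[OF mem(4,5)]
      adj_self[OF mem(1)] adj_self[OF mem(2)] adj_self[OF mem(3)] adj_self[OF mem(4)] adj_self[OF mem(5)]
      adj0 s
    by simp_all
  have V': "V = {v1, v2, v4, v3, v5}" using V by auto
  note le = adj_le_1[of v1 v2] adj_le_1[of v1 v5] adj_le_1[of v2 v3] adj_le_1[of v2 v4] adj_le_1[of v2 v5]
    adj_le_1[of v3 v4] adj_le_1[of v3 v5] adj_le_1[of v4 v5]
  \<comment> \<open>An edge between \<open>v2\<close> and \<open>v5\<close> would close a triangle
    through \<open>v1\<close>, leaving \<open>v3\<close> and \<open>v4\<close> with only each
    other.\<close>
  have 25: "adj v2 v5 = 0" using deg le by linarith
  consider "adj v2 v3 = 0" | "adj v2 v3 = 1" using le by linarith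
  then consider "br v2 v4 = 0" "br v2 v5 = 0" "br v3 v5 = 0" | "br v2 v3 = 0" "br v2 v5 = 0" "br v4 v5 = 0"
  proof cases
    case 1
    then have "adj v4 v5 = 0" using deg le 25 by linarith
    with 1 25 that(2) show thesis unfolding adj_eq_0 by blast
  next
    case 2
    then have "adj v2 v4 = 0" "adj v3 v5 = 0" using deg le 25 by linarith+
    with 25 that(1) show thesis unfolding adj_eq_0 by blast
  qed
  then show ?thesis
  proof cases
    case 1
    show ?thesis by (rule iso_listed_7[OF q V p 0 1])
  next
    case 2
    show ?thesis by (rule iso_listed_7[OF q V' p 0(2,1) 2])
  qed
qed

text \<open>On an odd number of vertices the degree is even, so it is 2 or 4. Degree 2 with r = 2 is
  impossible, since the counting identity would read 10 = 4 p; degree 4 leaves the free algebra and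
  the five two-edge matchings of the complete graph.\<close>

lemma classify_5:
  assumes q: "q = 5"
  shows "\<exists>k\<in>{1..12}. lie_isomorphic L (lie_of (listed_pres k))"
proof -
  obtain vs where vs: "V = set vs" "distinct vs" "length vs = 5" using enumerate_V q by metis
  then obtain v1 v2 v3 v4 v5 where v: "vs = [v1, v2, v3, v4, v5]"
    by (auto simp: numeral_eq_Suc length_Suc_conv)
  have V: "V = {v1, v2, v3, v4, v5}" using vs v by simp
  have dist: "distinct [v1, v2, v3, v4, v5]" using vs(2) v by simp
  have mem: "v1 \<in> V" "v2 \<in> V" "v3 \<in> V" "v4 \<in> V" "v5 \<in> V" using V by auto
  have r: "r = 1 \<or> r = 2" using colour_class_matching pos(3) q by auto
  have "even (5 * s)" using handshake q by simp
  then have s: "s = 2 \<or> s = 4" using degree_less pos(4) q by presburger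
  show ?thesis
  proof (cases "s = 2")
    case s: True
    have r: "r = 1"
    proof (rule ccontr)
      assume "r \<noteq> 1"
      then have "5 * 2 = 2 * p * 2" using r handshake q s by simp
      then show False by presburger
    qed
    have deg: "adj v1 v2 + adj v1 v3 + adj v1 v4 + adj v1 v5 = 2"
      using degree_adj[OF vs(1,2) mem(1)] adj_sym[OF mem(1,2)] adj_sym[OF mem(1,3)] adj_sym[OF mem(1,4)]
        adj_sym[OF mem(1,5)] adj_self[OF mem(1)] s by (simp add: v)
    have cyc: ?thesis if "{x2, x3, x4, x5} = {v2, v3, v4, v5}" "distinct [v1, x2, x3, x4, x5]"
      "br v1 x3 = 0" "br v1 x4 = 0" for x2 x3 x4 x5
    proof -
      have "lie_isomorphic L (lie_of (listed_pres 7))"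
        by (rule classify_5_cycle[OF q s r _ that(2-4)]) (simp only: V that(1))
      then show ?thesis by (intro bexI[of _ 7]) simp_all
    qed
    from deg consider "br v1 v2 = 0 \<and> br v1 v3 = 0" | "br v1 v2 = 0 \<and> br v1 v4 = 0" | "br v1 v2 = 0 \<and> br v1 v5 = 0"
      | "br v1 v3 = 0 \<and> br v1 v4 = 0" | "br v1 v3 = 0 \<and> br v1 v5 = 0" | "br v1 v4 = 0 \<and> br v1 v5 = 0"
      unfolding adj_def by (auto split: if_splits)
    then show ?thesis
    proof cases
      case 1 then show ?thesis using dist by (intro cyc[of v4 v2 v3 v5]) auto
    next
      case 2 then show ?thesis using dist by (intro cyc[of v3 v2 v4 v5]) auto
    next
      case 3 then show ?thesis using dist by (intro cyc[of v3 v2 v5 v4]) auto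
    next
      case 4 then show ?thesis using dist by (intro cyc[of v2 v3 v4 v5]) auto
    next
      case 5 then show ?thesis using dist by (intro cyc[of v2 v3 v5 v4]) auto
    next
      case 6 then show ?thesis using dist by (intro cyc[of v2 v4 v5 v3]) auto
    qed
  next
    case False
    then have s: "s = 4" using s by simp
    from r show ?thesis
    proof
      assume r: "r = 1"
      have "lie_isomorphic L (lie_of (listed_pres 12))"
        by (rule iso_listed_12[OF q V p_value]) (simp add: q s r)
      then show ?thesis by (intro bexI[of _ 12]) simp_all
    next
      assume r: "r = 2"
      have p: "p = 5" by (rule p_value) (simp add: q s r)
      have n0: "br x y \<noteq> 0" if "x \<in> V" "y \<in> V" "x \<noteq> y" for x y
        using complete_graph that s q by simp
      have core: ?thesis if "V = {x1, x2, x3, x4, x5}" "distinct [x1, x2, x3, x4, x5]"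
        "sim x2 x5 x3 x4" "sim x1 x2 x3 x5" for x1 x2 x3 x4 x5
        using iso_listed_11[OF q that(1,2) p r s that(3,4)] by (intro bexI[of _ 11]) simp_all
      \<comment> \<open>Here \<open>x1\<close> is the vertex missed by the given colour. The partner
        of the edge from \<open>x1\<close> to \<open>x2\<close> must contain \<open>x5\<close>, and
        exchanging \<open>x3\<close> with \<open>x4\<close> makes it the pair of \<open>x3\<close>
        and \<open>x5\<close>.\<close>
      have mid: ?thesis if V: "V = {x1, x2, x3, x4, x5}" and dist: "distinct [x1, x2, x3, x4, x5]"
        and sim: "sim x2 x5 x3 x4" for x1 x2 x3 x4 x5
      proof -
        have mem: "x1 \<in> V" "x2 \<in> V" "x3 \<in> V" "x4 \<in> V" "x5 \<in> V" using V by auto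
        have "sim x1 x2 x3 x4 \<or> sim x1 x2 x3 x5 \<or> sim x1 x2 x4 x5"
          using V mem dist by (intro partner_5[OF r _ n0]) auto
        moreover have "\<not> sim x1 x2 x3 x4"
        proof
          assume "sim x1 x2 x3 x4"
          then have "sim x1 x2 x2 x5" using sim sim_trans sim_sym by blast
          then have "{x1, x2} = {x2, x5}"
            using dist by (intro sim_disjoint[OF mem(1,2,2,5) n0[OF mem(1,2)]]) auto
          then show False using dist by (auto simp: doubleton_eq_iff)
        qed
        ultimately consider "sim x1 x2 x3 x5" | "sim x1 x2 x4 x5" by blast
        then show ?thesis
        proof cases
          case 1
          then show ?thesis using core[OF V dist sim] by blast
        next
          case 2
          have "V = {x1, x2, x4, x3, x5}" "distinct [x1, x2, x4, x3, x5]" using V dist by auto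
          moreover have "sim x2 x5 x4 x3" using sim_trans[OF sim sim_swap[OF mem(3,4)]] .
          ultimately show ?thesis using core 2 by blast
        qed
      qed
      \<comment> \<open>The partner of the edge from \<open>v1\<close> to \<open>v2\<close> leaves
        out one vertex; that vertex is renamed \<open>x1\<close>.\<close>
      have "sim v1 v2 v3 v4 \<or> sim v1 v2 v3 v5 \<or> sim v1 v2 v4 v5"
        using V mem dist by (intro partner_5[OF r _ n0]) auto
      then show ?thesis
      proof (elim disjE)
        assume "sim v1 v2 v3 v4"
        then show ?thesis using V dist by (intro mid[of v5 v1 v3 v4 v2]) auto
      next
        assume "sim v1 v2 v3 v5"
        then show ?thesis using V dist by (intro mid[of v4 v1 v3 v5 v2]) auto
      next
        assume "sim v1 v2 v4 v5"
        then show ?thesis using V dist by (intro mid[of v3 v1 v4 v5 v2]) auto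
      qed
    qed
  qed
qed

lemma classify:
  assumes q: "q \<le> 5"
  shows "\<exists>k\<in>{1..12}. lie_isomorphic L (lie_of (listed_pres k))"
proof -
  obtain vs where vs: "V = set vs" "length vs = q" using enumerate_V by metis
  have s: "0 < s" "s < q" using pos(4) degree_less by auto
  \<comment> \<open>A single generator is excluded because the positive degree \<open>s\<close> lies
    below \<open>q\<close>.\<close>
  then consider "q = 2" | "q = 3" | "q = 4" | "q = 5" using q by linarith
  then show ?thesis
  proof cases
    case q: 1
    then obtain v1 v2 where V: "V = {v1, v2}"
      using vs by (auto simp: numeral_eq_Suc length_Suc_conv)
    have r: "r = 1" using colour_class_matching pos(3) q by simp
    have "s = 1" using s q by simp
    then have "lie_isomorphic L (lie_of (listed_pres 1))"
      by (intro iso_listed_1[OF q V p_value]) (simp add: q r)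
    then show ?thesis by (intro bexI[of _ 1]) simp_all
  next
    case q: 2
    then obtain v1 v2 v3 where V: "V = {v1, v2, v3}"
      using vs by (auto simp: numeral_eq_Suc length_Suc_conv)
    have r: "r = 1" using colour_class_matching pos(3) q by simp
    have "even (3 * s)" using handshake q by simp
    then have "s = 2" using s q by presburger
    then have "lie_isomorphic L (lie_of (listed_pres 4))"
      by (intro iso_listed_4[OF q V p_value]) (simp add: q r)
    then show ?thesis by (intro bexI[of _ 4]) simp_all
  next
    case 3
    then show ?thesis by (rule classify_4)
  next
    case 4
    then show ?thesis by (rule classify_5)
  qed
qed

end

theorem theorem6p3:
  shows "(\<forall>(n :: ('a::real_vector) lie) p q r. uniform_lie n p q r \<and> q \<le> 5 \<longrightarrow>
            (\<exists>!k. k \<in> {1..12} \<and> lie_isomorphic n (lie_of (listed_pres k))))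
       \<and> (\<forall>k\<in>{1..12}. displays_type (listed_pres k) (listed_type k))
       \<and> displays_type alt_pres_3 (2, 4, 2)
       \<and> lie_isomorphic (lie_of alt_pres_3) (lie_of (listed_pres 3))"
proof (intro conjI allI impI ballI)
  fix n :: "'a lie" and p q r
  assume n: "uniform_lie n p q r \<and> q \<le> 5"
  then obtain V Z s where "uniform_algebra n V Z p q r s"
    using uniform_lie_uniform_algebra by metis
  then interpret uniform_algebra n V Z p q r s .
  obtain k where k: "k \<in> {1..12}" "lie_isomorphic n (lie_of (listed_pres k))"
    using classify n by blast
  show "\<exists>!k. k \<in> {1..12} \<and> lie_isomorphic n (lie_of (listed_pres k))"
  proof (rule ex1I[of _ k])
    fix l assume l: "l \<in> {1..12} \<and> lie_isomorphic n (lie_of (listed_pres l))"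
    then have "lie_isomorphic (lie_of (listed_pres l)) (lie_of (listed_pres k))"
      using lie_isomorphic_trans[OF lie_isomorphic_sym[OF lie] k(2)] by blast
    then show "l = k" using listed_isomorphic_unique l k(1) by blast
  qed (use k in simp)
qed (simp_all only: displays_listed displays_alt alt_pres_isomorphic_3)

end
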